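(* Let $X$ be a spectrally negative L\'evy process, let $\omega:\mathbb{R}\to[0,\infty)$ be measurable and locally bounded, and let $\mathcal{W}^{(\omega)},\mathcal{Z}^{(\omega)}$ be the associated $\omega$-scale functions. Then for every $c>0$ and every $x\leq c$, $$\mathbb{E}_x\left[\exp\left(-\int_0^{\tau_c^+}\omega(X_t)\,dt\right);\ \tau_c^+<\tau_0^-\right]=\frac{\mathcal{W}^{(\omega)}(x)}{\mathcal{W}^{(\omega)}(c)},$$ $$\mathbb{E}_x\left[\exp\left(-\int_0^{\tau_0^-}\omega(X_t)\,dt\right);\ \tau_0^-<\tau_c^+\right]=\mathcal{Z}^{(\omega)}(x)-\frac{\mathcal{W}^{(\omega)}(x)}{\mathcal{W}^{(\omega)}(c)}\,\mathcal{Z}^{(\omega)}(c).$$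
   Context: $X=\{X_t,t\ge 0\}$ is a spectrally negative L\'evy process (a c\`adl\`ag process with stationary independent increments and no positive jumps) that is not the negative of a subordinator. Its Laplace exponent $\psi$, defined by $\mathbb{E}[e^{\theta X_t}]=e^{t\psi(\theta)}$ for $\theta\ge 0$, is continuous and strictly convex on $[0,\infty)$ and tends to $\infty$ at $\infty$. $\mathbb{P}_x$ is the law of $X$ with $X_0=x$, and $\mathbb{E}_x$ its expectation ($\mathbb{P}=\mathbb{P}_0$, $\mathbb{E}=\mathbb{E}_0$). $\mathbb{E}[\,\cdot\,;A]$ means $\mathbb{E}[\,\cdot\,\mathbf 1_A]$. $\Phi(\theta)=\inf\{s>0:\psi(s)>\theta\}$, $\theta\ge0$. For $q\ge 0$ the scale function $W^{(q)}:\mathbb{R}\to[0,\infty)$ vanishes on $(-\infty,0)$, is continuous and increasing on $[0,\infty)$, and satisfies $\int_0^\infty e^{-\theta y}W^{(q)}(y)\,dy=1/(\psi(\theta)-q)$ for $\theta>\Phi(q)$. $W:=W^{(0)}$. First passage times: $\tau_z^-=\inf\{t>0:X_t<z\}$, $\tau_c^+=\inf\{t>0:X_t>c\}$, with $\inf\emptyset=\infty$. The $\omega$-scale functions are the unique locally bounded functions on $\mathbb{R}$ satisfying $\mathcal{W}^{(\omega)}(x)=W(x)+\int_0^x W(x-y)\omega(y)\mathcal{W}^{(\omega)}(y)\,dy$ and $\mathcal{Z}^{(\omega)}(x)=1+\int_0^x W(x-y)\omega(y)\mathcal{Z}^{(\omega)}(y)\,dy$; for $x<0$ the integrals vanish,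 so $\mathcal{W}^{(\omega)}(x)=0$ and $\mathcal{Z}^{(\omega)}(x)=1$. *)

theory Defs
  imports "HOL-Probability.Probability"
begin

section \<open>Paths indexed by the half-line\<close>

text \<open>Paths are functions on \<^typ>\<open>real\<close>, of which only the values at times \<open>t \<ge> 0\<close> matter.\<close>

definition cadlag :: "(real \<Rightarrow> real) \<Rightarrow> bool" where
  "cadlag p \<longleftrightarrow>
     (\<forall>t\<ge>0. (p \<longlongrightarrow> p t) (at_right t)) \<and>
     (\<forall>t>0. \<exists>l. (p \<longlongrightarrow> l) (at_left t))"

definition no_positive_jumps :: "(real \<Rightarrow> real) \<Rightarrow> bool" where
  "no_positive_jumps p \<longleftrightarrow> (\<forall>t>0. \<forall>l. (p \<longlongrightarrow> l) (at_left t) \<longrightarrow> p t \<le> l)"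

text \<open>In \<^typ>\<open>ereal\<close> the infimum of the empty set is \<open>\<infinity>\<close>.\<close>

definition tau_minus :: "real \<Rightarrow> (real \<Rightarrow> real) \<Rightarrow> ereal" where
  "tau_minus z p = Inf {ereal t | t. 0 < t \<and> p t < z}"

definition tau_plus :: "real \<Rightarrow> (real \<Rightarrow> real) \<Rightarrow> ereal" where
  "tau_plus c p = Inf {ereal t | t. 0 < t \<and> p t > c}"


section \<open>Spectrally negative Levy processes\<close>

text \<open>
  The process starts at \<open>0\<close>, i.e. it is considered under \<open>P = P\<^sub>0\<close>. All paths
  (not only almost all) are cadlag, so that path functionals such as the first passage times
  are measurable although \<open>M\<close> need not be complete.
\<close>

definition levy_process :: "'a measure \<Rightarrow> (real \<Rightarrow> 'a \<Rightarrow> real) \<Rightarrow> bool" where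
  "levy_process M X \<longleftrightarrow>
     prob_space M \<and>
     (\<forall>t\<ge>0. X t \<in> borel_measurable M) \<and>
     (AE w in M. X 0 w = 0) \<and>
     (\<forall>w\<in>space M. cadlag (\<lambda>t. X t w)) \<and>
     (\<forall>s\<ge>0. \<forall>t\<ge>0. distr M borel (\<lambda>w. X (s + t) w - X s w) = distr M borel (X t)) \<and>
     (\<forall>(t::nat \<Rightarrow> real) n. 0 \<le> t 0 \<and> incseq t \<longrightarrow>
        prob_space.indep_vars M (\<lambda>_. borel) (\<lambda>i w. X (t (Suc i)) w - X (t i) w) {..<n})"

definition subordinator :: "'a measure \<Rightarrow> (real \<Rightarrow> 'a \<Rightarrow> real) \<Rightarrow> bool" where
  "subordinator M X \<longleftrightarrow>
     levy_process M X \<and> (AE w in M. \<forall>s t. 0 \<le> s \<and> s \<le> t \<longrightarrow> X s w \<le> X t w)"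

definition spectrally_negative_levy :: "'a measure \<Rightarrow> (real \<Rightarrow> 'a \<Rightarrow> real) \<Rightarrow> bool" where
  "spectrally_negative_levy M X \<longleftrightarrow>
     levy_process M X \<and>
     (\<forall>w\<in>space M. no_positive_jumps (\<lambda>t. X t w)) \<and>
     \<not> subordinator M (\<lambda>t w. - X t w)"

text \<open>
  \<open>E\<^sub>x[F; A]\<close> for a path functional \<open>F\<close> and a set of paths \<open>A\<close>:
  \<open>P\<^sub>x\<close> is the law of the process \<open>x + X\<close> under \<open>P\<close>.
\<close>

definition expectation_from ::
    "'a measure \<Rightarrow> (real \<Rightarrow> 'a \<Rightarrow> real) \<Rightarrow> real \<Rightarrow>
     ((real \<Rightarrow> real) \<Rightarrow> real) \<Rightarrow> (real \<Rightarrow> real) set \<Rightarrow> real" where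
  "expectation_from M X x F A =
     (LINT w|M. F (\<lambda>t. x + X t w) * indicator A (\<lambda>t. x + X t w))"


section \<open>Scale functions\<close>

text \<open>
  The right-hand side is positive, so the equation forces \<open>exp (\<theta> * X t)\<close> to be integrable;
  \<open>\<psi>\<close> is determined on \<open>[0,\<infinity>)\<close>. The same remark on integrability applies to the
  Laplace transform in \<open>scale_function\<close>, as \<open>\<psi> \<theta> > q\<close> for \<open>\<theta> > \<Phi>(q)\<close>.
\<close>

definition laplace_exponent ::
    "'a measure \<Rightarrow> (real \<Rightarrow> 'a \<Rightarrow> real) \<Rightarrow> (real \<Rightarrow> real) \<Rightarrow> bool" where
  "laplace_exponent M X \<psi> \<longleftrightarrow>
     (\<forall>\<theta>\<ge>0. \<forall>t\<ge>0. (LINT w|M. exp (\<theta> * X t w)) = exp (t * \<psi> \<theta>))"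

definition right_inverse :: "(real \<Rightarrow> real) \<Rightarrow> real \<Rightarrow> real" where
  "right_inverse \<psi> q = Inf {s. 0 < s \<and> \<psi> s > q}"

text \<open>\<open>scale_function \<psi> q W\<close> says that \<open>W\<close> is the scale function \<open>W\<^sup>(\<^sup>q\<^sup>)\<close>.\<close>

definition scale_function :: "(real \<Rightarrow> real) \<Rightarrow> real \<Rightarrow> (real \<Rightarrow> real) \<Rightarrow> bool" where
  "scale_function \<psi> q W \<longleftrightarrow>
     (\<forall>x. 0 \<le> W x) \<and>
     (\<forall>x<0. W x = 0) \<and>
     continuous_on {0..} W \<and>
     mono_on {0..} W \<and>
     (\<forall>\<theta>>right_inverse \<psi> q. (LBINT y=0..\<infinity>. exp (- \<theta> * y) * W y) = 1 / (\<psi> \<theta> - q))"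

definition locally_bounded :: "(real \<Rightarrow> real) \<Rightarrow> bool" where
  "locally_bounded f \<longleftrightarrow> (\<forall>K. compact K \<longrightarrow> bounded (f ` K))"

text \<open>
  Measurability is part of the requirement that the integrals in the two renewal equations make
  sense. For \<open>x < 0\<close> the integrals are oriented integrals over \<open>(x, 0)\<close>, where
  \<open>W (x - y) = 0\<close>.
\<close>

definition omega_scale_W ::
    "(real \<Rightarrow> real) \<Rightarrow> (real \<Rightarrow> real) \<Rightarrow> (real \<Rightarrow> real) \<Rightarrow> bool" where
  "omega_scale_W W \<omega> Wo \<longleftrightarrow>
     Wo \<in> borel_measurable borel \<and> locally_bounded Wo \<and>
     (\<forall>x. Wo x = W x + (LBINT y=0..ereal x. W (x - y) * \<omega> y * Wo y))"

definition omega_scale_Z ::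
    "(real \<Rightarrow> real) \<Rightarrow> (real \<Rightarrow> real) \<Rightarrow> (real \<Rightarrow> real) \<Rightarrow> bool" where
  "omega_scale_Z W \<omega> Zo \<longleftrightarrow>
     Zo \<in> borel_measurable borel \<and> locally_bounded Zo \<and>
     (\<forall>x. Zo x = 1 + (LBINT y=0..ereal x. W (x - y) * \<omega> y * Zo y))"

end

theory Submission
  imports Defs "HOL-Complex_Analysis.Complex_Analysis"
begin

text \<open>
  Comparing Laplace transforms, \<open>E[W(z + X\<^sub>t)] dz = W(z) dz + \<integral>\<^sub>0\<^sup>t P(-X\<^sub>s \<in> dz) ds\<close>. Hence for bounded
  \<open>g\<close> with compact support the convolution \<open>f = W * g\<close> satisfies Dynkin's formula with generator value \<open>g\<close>.
  Stopping at the exit from \<open>[a, c]\<close>, approximated by exit times from a grid so that only the Markov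
  property at fixed times is used, \<open>f(X) exp(-\<integral>\<omega>(X))\<close> has drift \<open>g - \<omega> f\<close>. This drift vanishes for
  \<open>f = Zo = 1 + W * (\<omega> Zo)\<close>. For \<open>Wo = W + W * (\<omega> Wo)\<close> the summand \<open>W\<close> is replaced by \<open>W * e\<^sub>d\<close>, with
  \<open>e\<^sub>d\<close> the uniform density on \<open>[-d, 0)\<close>. Stopping at the exit from \<open>[0, c]\<close> bounds the exit functional
  from above and stopping at the exit from \<open>[-d, c]\<close> bounds it from below as \<open>d \<rightarrow> 0\<close>; no statement on creeping
  or on the regularity of \<open>0\<close> is needed.
\<close>

subsection \<open>Uniqueness of Laplace transforms\<close>

text \<open>\<open>W\<close> itself is the convolution of \<open>W\<close> with a unit mass at 0,
  not with a bounded function, and it may jump at 0, the very barrier at which the process is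
  stopped. Moving the mass into \<open>[-d, 0)\<close> costs nothing on \<open>[0, c]\<close>, where
  the smeared source vanishes, and only raises \<open>W\<close>; so the smeared function is a
  supersolution there. With the barrier at \<open>-d\<close> the same function vanishes at every
  downward exit, and it misses being a subsolution only by a multiple of the oscillation of
  \<open>W\<close> over distance \<open>d\<close>, to be multiplied by a mean exit time that is
  bounded uniformly in \<open>d\<close>. The grid is the other obstacle: it overlooks excursions
  between its points, so at a grid exit the process may lie far above \<open>c\<close>, where the
  functions of interest grow exponentially. Hence limits are taken under uniform bounds on second
  moments, supplied by the submartingale \<open>exp (2 * rate * X)\<close>. The barrier
  \<open>c\<close> yields a pathwise bound only after the mesh has gone to 0, since only the true
  exit time cannot jump over it.\<close>

lemma mgf_holomorphic:
  fixes M :: "real measure"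
  assumes [measurable_cong, simp]: "sets M = sets borel"
    and int: "\<And>\<theta>. \<bar>\<theta>\<bar> < d \<Longrightarrow> integrable M (\<lambda>x. exp (\<theta> * x))"
  shows "(\<lambda>z. LINT x|M. exp (z * complex_of_real x)) holomorphic_on {z. \<bar>Re z\<bar> < d}"
proof -
  let ?F = "\<lambda>z. LINT x|M. exp (z * complex_of_real x)"
  have cint: "integrable M (\<lambda>x. exp (z * complex_of_real x))" if "\<bar>Re z\<bar> < d" for z
    by (rule Bochner_Integration.integrable_bound[OF int[OF that]]) (auto simp: norm_exp_eq_Re)
  have "\<exists>D. (?F has_field_derivative D) (at z)" if z: "\<bar>Re z\<bar> < d" for z
  proof -
    \<comment> \<open>A third of the distance to the edge of the strip: one \<open>e\<close> bounds
      the increment \<open>h\<close>, a second one absorbs the factor \<open>\<bar>x\<bar>\<close>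
      of the derivative through \<open>\<bar>x\<bar> \<le> exp (e * \<bar>x\<bar>) / e\<close>, and
      the exponents \<open>Re z + 2 * e\<close> and \<open>Re z - 2 * e\<close> of the majorant
      still lie in the strip.\<close>
    define e where "e = (d - \<bar>Re z\<bar>) / 3"
    have e: "e > 0" "\<bar>Re z\<bar> + 2 * e < d" using z by (auto simp: e_def field_simps)
    define D where "D = (LINT x|M. of_real x * exp (z * complex_of_real x))"
    have "((\<lambda>h. (?F (z + h) - ?F z) / h) \<longlongrightarrow> D) (at 0)"
      unfolding tendsto_at_iff_sequentially comp_def
    proof (intro allI impI)
      fix h :: "nat \<Rightarrow> complex" assume h0: "\<forall>i. h i \<in> UNIV - {0}" and h: "h \<longlonglongrightarrow> 0"
      have "eventually (\<lambda>n. norm (h n) < e) sequentially"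
        using h e(1) by (simp add: tendsto_iff)
      then obtain N where N: "\<And>n. n \<ge> N \<Longrightarrow> norm (h n) < e"
        by (auto simp: eventually_sequentially)
      let ?w = "\<lambda>x. (exp ((Re z + 2 * e) * x) + exp ((Re z - 2 * e) * x)) / e"
      let ?q = "\<lambda>n x. (exp ((z + h (n + N)) * complex_of_real x) - exp (z * complex_of_real x)) / h (n + N)"
      have "(\<lambda>n. LINT x|M. ?q n x) \<longlonglongrightarrow> D"
        unfolding D_def
      proof (rule integral_dominated_convergence[where w="?w"])
        show "integrable M ?w" using e by (intro integrable_divide Bochner_Integration.integrable_add int) auto
        show "AE x in M. (\<lambda>n. ?q n x) \<longlonglongrightarrow> of_real x * exp (z * complex_of_real x)"
        proof (rule AE_I2)
          fix x
          have "((\<lambda>w. exp (w * complex_of_real x)) has_field_derivative of_real x * exp (z * complex_of_real x)) (at z)"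
            by (auto intro!: derivative_eq_intros)
          then have "((\<lambda>h. (exp ((z + h) * complex_of_real x) - exp (z * complex_of_real x)) / h) \<longlongrightarrow>
             of_real x * exp (z * complex_of_real x)) (at 0)"
            by (simp add: DERIV_def)
          moreover have "filterlim (\<lambda>n. h (n + N)) (at 0) sequentially"
            using h0 LIMSEQ_ignore_initial_segment[OF h] by (auto simp: filterlim_at)
          ultimately show "(\<lambda>n. ?q n x) \<longlonglongrightarrow> of_real x * exp (z * complex_of_real x)"
            by (rule filterlim_compose)
        qed
        show "AE x in M. norm (?q n x) \<le> ?w x" for n
        proof (rule AE_I2)
          fix x
          let ?k = "h (n + N)"
          have k: "norm ?k < e" "?k \<noteq> 0" using N h0 by auto
          have "?q n x = exp (z * of_real x) * ((exp (?k * of_real x) - 1) / ?k)"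
            by (simp add: ring_distribs exp_add diff_divide_distrib)
          then have "norm (?q n x) = exp (Re z * x) * (norm (exp (?k * of_real x) - 1) / norm ?k)"
            by (simp only: norm_mult norm_divide norm_exp_eq_Re Re_complex_of_real) simp
          also have "norm (exp (?k * of_real x) - 1) \<le> exp \<bar>Re (?k * of_real x)\<bar> * norm (?k * of_real x)"
            using Taylor_exp[of "?k * of_real x" 0] by simp
          also have "\<bar>Re (?k * of_real x)\<bar> \<le> e * \<bar>x\<bar>"
            using k(1) abs_Re_le_cmod[of ?k] by (simp add: abs_mult) (intro mult_right_mono, auto)
          finally have "norm (?q n x) \<le> exp (Re z * x) * ((exp (e * \<bar>x\<bar>) * norm (?k * of_real x)) / norm ?k)"
            by (simp add: divide_right_mono mult_right_mono)
          also have "\<dots> = exp (Re z * x) * (exp (e * \<bar>x\<bar>) * \<bar>x\<bar>)"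
            using k(2) by (simp add: norm_mult)
          also have "\<bar>x\<bar> \<le> exp (e * \<bar>x\<bar>) / e"
            using exp_ge_add_one_self[of "e * \<bar>x\<bar>"] e(1) by (simp add: field_simps del: exp_ge_add_one_self)
          then have "exp (Re z * x) * (exp (e * \<bar>x\<bar>) * \<bar>x\<bar>) \<le> exp (Re z * x) * (exp (e * \<bar>x\<bar>) * (exp (e * \<bar>x\<bar>) / e))"
            by (intro mult_left_mono) auto
          also have "\<dots> = exp (Re z * x + 2 * e * \<bar>x\<bar>) / e"
            by (simp add: mult_exp_exp algebra_simps)
          also have "\<dots> \<le> ?w x"
            using e(1) by (intro divide_right_mono) (auto simp: abs_if algebra_simps)
          finally show "norm (?q n x) \<le> ?w x" .
        qed
      qed measurable
      moreover have "\<forall>\<^sub>F n in sequentially. (LINT x|M. ?q n x) = (?F (z + h (n + N)) - ?F z) / h (n + N)"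
      proof (intro always_eventually allI)
        fix n
        have "\<bar>Re (z + h (n + N))\<bar> < d"
          using N[of "n+N"] abs_Re_le_cmod[of "h (n+N)"] e by auto
        then show "(LINT x|M. ?q n x) = (?F (z + h (n + N)) - ?F z) / h (n + N)"
          using cint[of z] cint[of "z + h (n + N)"] z
          by (simp add: Bochner_Integration.integral_diff)
      qed
      ultimately have "(\<lambda>n. (?F (z + h (n + N)) - ?F z) / h (n + N)) \<longlonglongrightarrow> D"
        by (rule Lim_transform_eventually)
      then show "(\<lambda>n. (?F (z + h n) - ?F z) / h n) \<longlonglongrightarrow> D"
        by (rule LIMSEQ_offset)
    qed
    then show ?thesis by (auto simp: DERIV_def)
  qed
  then show ?thesis
    unfolding holomorphic_on_def field_differentiable_def
    by (blast intro: has_field_derivative_at_within)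
qed

text \<open>The identity theorem: the difference of the two transforms is holomorphic on the strip
  and vanishes on a real segment accumulating at 0, hence also on the imaginary axis, where the
  transforms are the characteristic functions.\<close>

lemma mgf_uniqueness:
  fixes M N :: "real measure"
  assumes M: "real_distribution M" and N: "real_distribution N" and "d > 0"
    and intM: "\<And>\<theta>. \<bar>\<theta>\<bar> < d \<Longrightarrow> integrable M (\<lambda>x. exp (\<theta> * x))"
    and intN: "\<And>\<theta>. \<bar>\<theta>\<bar> < d \<Longrightarrow> integrable N (\<lambda>x. exp (\<theta> * x))"
    and eq: "\<And>\<theta>. \<bar>\<theta>\<bar> < d \<Longrightarrow> (LINT x|M. exp (\<theta> * x)) = (LINT x|N. exp (\<theta> * x))"
  shows "M = N"
proof (rule Levy_uniqueness[OF M N])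
  interpret M: real_distribution M by fact
  interpret N: real_distribution N by fact
  let ?S = "{z. \<bar>Re z\<bar> < d}"
  let ?F = "\<lambda>M z. LINT x|M. exp (z * complex_of_real x)"
  have S: "?S = {z. Re z < d} \<inter> {z. - d < Re z}" by auto
  have "open ?S" unfolding S by (intro open_Int open_halfspace_Re_lt open_halfspace_Re_gt)
  moreover have "connected ?S" unfolding S
    by (intro convex_connected convex_Int convex_halfspace_Re_lt convex_halfspace_Re_gt)
  moreover have "0 islimpt complex_of_real ` {0<..<d}"
  proof -
    have "(\<lambda>n. complex_of_real (d / (real n + 2))) \<longlonglongrightarrow> complex_of_real 0"
      by (intro tendsto_of_real) real_asymp
    then show ?thesis using \<open>d > 0\<close>
      unfolding islimpt_sequential
      by (intro exI[of _ "\<lambda>n. complex_of_real (d / (real n + 2))"] conjI allI DiffI imageI)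
         (auto simp: field_simps add_pos_nonneg simp del: of_real_divide)
  qed
  moreover have "complex_of_real ` {0<..<d} \<subseteq> ?S" by auto
  moreover have "(\<lambda>z. ?F M z - ?F N z) holomorphic_on ?S"
    by (intro holomorphic_intros mgf_holomorphic intM intN) auto
  moreover have "?F M z - ?F N z = 0" if "z \<in> complex_of_real ` {0<..<d}" for z
  proof -
    from that obtain t where t: "z = of_real t" "0 < t" "t < d" by auto
    have "?F K z = of_real (LINT x|K. exp (t * x))" for K
      unfolding t by (simp add: exp_of_real flip: of_real_mult)
    then show ?thesis using eq[of t] t by simp
  qed
  ultimately have *: "?F M w - ?F N w = 0" if "w \<in> ?S" for w
    using analytic_continuation[of "\<lambda>z. ?F M z - ?F N z" ?S "complex_of_real ` {0<..<d}" 0 w] that \<open>d > 0\<close> by auto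
  show "char M = char N"
    using *[of "\<i> * of_real t" for t] \<open>d > 0\<close>
    by (auto simp: char_def fun_eq_iff cis_conv_exp mult_ac)
qed

text \<open>Exponential tilting. The measures may be infinite and may charge both half-lines, but
  the density \<open>exp (- t * x) / k\<close> turns each of them into a probability measure with
  two-sided exponential moments. Positivity of the transform permits the normalisation, and the tilt
  is undone at the end.\<close>

lemma laplace_uniqueness:
  fixes M N :: "real measure"
  assumes sM: "sets M = sets borel" and sN: "sets N = sets borel"
    and eq: "\<And>\<theta>. \<theta> > b \<Longrightarrow> (\<integral>\<^sup>+x. ennreal (exp (- \<theta> * x)) \<partial>M) = (\<integral>\<^sup>+x. ennreal (exp (- \<theta> * x)) \<partial>N)"
    and fin: "\<And>\<theta>. \<theta> > b \<Longrightarrow> (\<integral>\<^sup>+x. ennreal (exp (- \<theta> * x)) \<partial>M) < \<infinity>"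
    and pos: "\<And>\<theta>. \<theta> > b \<Longrightarrow> (\<integral>\<^sup>+x. ennreal (exp (- \<theta> * x)) \<partial>M) > 0"
  shows "M = N"
proof -
  \<comment> \<open>The distance 1 from \<open>b\<close> gives the tilted measures finite moments of
    \<open>exp (\<theta> * x)\<close> for \<open>\<bar>\<theta>\<bar> < 1\<close>.\<close>
  define t where "t = b + 1"
  define k where "k = enn2real (\<integral>\<^sup>+x. ennreal (exp (- t * x)) \<partial>M)"
  have k: "ennreal k = (\<integral>\<^sup>+x. ennreal (exp (- t * x)) \<partial>M)" "k > 0"
    using fin[of t] pos[of t] by (auto simp: k_def t_def enn2real_positive_iff less_top)
  define T where "T K = density K (\<lambda>x. ennreal (exp (- t * x) / k))" for K :: "real measure"
  have nn: "(\<integral>\<^sup>+x. ennreal (exp (\<theta> * x)) \<partial>T K) = (\<integral>\<^sup>+x. ennreal (exp (- (t - \<theta>) * x)) \<partial>K) / k"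
    if [measurable_cong]: "sets K = sets borel" for K \<theta>
  proof -
    have "(\<integral>\<^sup>+x. ennreal (exp (\<theta> * x)) \<partial>T K) = (\<integral>\<^sup>+x. ennreal (exp (- t * x) / k) * ennreal (exp (\<theta> * x)) \<partial>K)"
      unfolding T_def by (rule nn_integral_density) measurable
    also have "\<dots> = (\<integral>\<^sup>+x. ennreal (exp (- (t - \<theta>) * x)) / ennreal k \<partial>K)"
      using k(2) by (intro nn_integral_cong) (simp add: divide_ennreal exp_add[symmetric] algebra_simps flip: ennreal_mult')
    also have "\<dots> = (\<integral>\<^sup>+x. ennreal (exp (- (t - \<theta>) * x)) \<partial>K) / k"
      by (rule nn_integral_divide) measurable
    finally show ?thesis .
  qed
  have eqt: "(\<integral>\<^sup>+x. ennreal (exp (\<theta> * x)) \<partial>T M) = (\<integral>\<^sup>+x. ennreal (exp (\<theta> * x)) \<partial>T N)" if "\<bar>\<theta>\<bar> < 1" for \<theta>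
    using nn[OF sM] nn[OF sN] eq[of "t - \<theta>"] that by (simp add: t_def)
  have fint: "(\<integral>\<^sup>+x. ennreal (exp (\<theta> * x)) \<partial>T M) < \<infinity>" if "\<bar>\<theta>\<bar> < 1" for \<theta>
    unfolding nn[OF sM] using fin[of "t - \<theta>"] that k(2)
    by (auto simp: t_def ennreal_divide_eq_top_iff less_top[symmetric])
  have setsT: "sets (T M) = sets borel" "sets (T N) = sets borel" "space (T M) = UNIV" "space (T N) = UNIV"
    using sM sN sets_eq_imp_space_eq[OF sM] sets_eq_imp_space_eq[OF sN] by (auto simp: T_def)
  note [measurable_cong] = setsT(1,2)
  have intT: "integrable (T K) (\<lambda>x. exp (\<theta> * x))" if "K = M \<or> K = N" "\<bar>\<theta>\<bar> < 1" for K \<theta>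
    using that eqt[of \<theta>] fint[of \<theta>] by (intro integrableI_nonneg) (auto cong: measurable_cong_sets simp: setsT)
  have prob: "prob_space (T M)" "prob_space (T N)"
    using nn[OF sM, of 0] eqt[of 0] k(2)
    by (auto intro!: prob_spaceI simp: ennreal_divide_self k(1)[simplified, symmetric])
  have "T M = T N"
  proof (rule mgf_uniqueness[of _ _ 1])
    show "real_distribution (T M)" "real_distribution (T N)"
      using prob setsT by (auto simp: real_distribution_def real_distribution_axioms_def)
    show "(LINT x|T M. exp (\<theta> * x)) = (LINT x|T N. exp (\<theta> * x))" if "\<bar>\<theta>\<bar> < 1" for \<theta>
      using eqt[OF that] by (simp add: integral_eq_nn_integral)
  qed (use intT in auto)
  moreover have "density (T K) (\<lambda>x. ennreal (k / exp (- t * x))) = K" if [measurable_cong]: "sets K = sets borel" for K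
  proof -
    have "density (T K) (\<lambda>x. ennreal (k / exp (- t * x))) = density K (\<lambda>x. ennreal (exp (- t * x) / k) * ennreal (k / exp (- t * x)))"
      unfolding T_def by (rule density_density_eq) measurable
    also have "\<dots> = density K (\<lambda>_. 1)"
      using k(2) by (simp flip: ennreal_mult')
    finally show ?thesis by (simp add: density_1)
  qed
  ultimately show ?thesis using sM sN by metis
qed

subsection \<open>Right-continuous processes\<close>

text \<open>The truncation at level \<open>k\<close> changes each of the integrals by at most \<open>C / k\<close>.\<close>

lemma (in finite_measure) tendsto_integral_of_bounded_second_moments:
  fixes Y :: "nat \<Rightarrow> 'a \<Rightarrow> real"
  assumes [measurable]: "\<And>n. Y n \<in> borel_measurable M" "Z \<in> borel_measurable M"
    and conv: "AE w in M. (\<lambda>n. Y n w) \<longlonglongrightarrow> Z w"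
    and bd: "\<And>n. (\<integral>\<^sup>+w. ennreal ((Y n w)\<^sup>2) \<partial>M) \<le> ennreal C"
  shows "integrable M Z" "\<And>n. integrable M (Y n)" "(\<lambda>n. LINT w|M. Y n w) \<longlonglongrightarrow> (LINT w|M. Z w)"
proof -
  \<comment> \<open>A negative \<open>C\<close> is read as 0 by \<open>ennreal\<close>; the real
    estimates below need a nonnegative constant.\<close>
  have "\<exists>C'\<ge>0. \<forall>n. (\<integral>\<^sup>+w. ennreal ((Y n w)\<^sup>2) \<partial>M) \<le> ennreal C'"
    using bd by (intro exI[of _ "max C 0"]) auto
  then obtain C where C0: "C \<ge> 0" and bd: "\<And>n. (\<integral>\<^sup>+w. ennreal ((Y n w)\<^sup>2) \<partial>M) \<le> ennreal C"
    by auto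
  \<comment> \<open>Fatou's lemma passes the second moment bound to the limit.\<close>
  have Zbd: "(\<integral>\<^sup>+w. ennreal ((Z w)\<^sup>2) \<partial>M) \<le> ennreal C"
  proof -
    have "(\<integral>\<^sup>+w. ennreal ((Z w)\<^sup>2) \<partial>M) = (\<integral>\<^sup>+w. liminf (\<lambda>n. ennreal ((Y n w)\<^sup>2)) \<partial>M)"
    proof (rule nn_integral_cong_AE)
      show "AE w in M. ennreal ((Z w)\<^sup>2) = liminf (\<lambda>n. ennreal ((Y n w)\<^sup>2))"
        using conv
      proof eventually_elim
        case (elim w)
        have "(\<lambda>n. ennreal ((Y n w)\<^sup>2)) \<longlonglongrightarrow> ennreal ((Z w)\<^sup>2)"
          using elim by (intro tendsto_ennrealI tendsto_power)
        then show ?case using lim_imp_Liminf[OF trivial_limit_sequentially] by metis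
      qed
    qed
    also have "\<dots> \<le> liminf (\<lambda>n. (\<integral>\<^sup>+w. ennreal ((Y n w)\<^sup>2) \<partial>M))"
      by (rule nn_integral_liminf) measurable
    also have "\<dots> \<le> ennreal C"
      using bd by (intro Liminf_le) auto
    finally show ?thesis .
  qed
  have sq: "integrable M (\<lambda>w. (V w)\<^sup>2) \<and> (LINT w|M. (V w)\<^sup>2) \<le> C \<and> integrable M V"
    if [measurable]: "V \<in> borel_measurable M" and V: "(\<integral>\<^sup>+w. ennreal ((V w)\<^sup>2) \<partial>M) \<le> ennreal C" for V :: "'a \<Rightarrow> real"
  proof -
    have i: "integrable M (\<lambda>w. (V w)\<^sup>2)"
      using V by (intro integrableI_nonneg) (auto intro: le_less_trans)
    moreover have "(LINT w|M. (V w)\<^sup>2) \<le> C"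
      using V C0 i by (simp add: nn_integral_eq_integral)
    moreover have "integrable M V"
    proof (rule Bochner_Integration.integrable_bound)
      show "integrable M (\<lambda>w. 1 + (V w)\<^sup>2)" using i by auto
      have "\<bar>v\<bar> \<le> 1 + v\<^sup>2" for v :: real
        using zero_le_power2[of "\<bar>v\<bar> - 1"] by (simp add: power2_eq_square algebra_simps abs_mult_self_eq)
      then show "AE w in M. norm (V w) \<le> norm (1 + (V w)\<^sup>2)" by (auto intro!: AE_I2 order_trans[OF _ abs_ge_self])
    qed auto
    ultimately show ?thesis by blast
  qed
  show iZ: "integrable M Z" and iY: "\<And>n. integrable M (Y n)"
    using sq[OF _ Zbd] sq[OF _ bd] by auto
  define cl where "cl k v = max (- k) (min k v)" for k v :: real
  have clm [measurable]: "cl k \<in> borel_measurable borel" for k by (auto simp: cl_def[abs_def])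
  have cl_bd: "\<bar>cl k v\<bar> \<le> k" if "k > 0" for k v using that by (auto simp: cl_def)
  have cl_err: "\<bar>v - cl k v\<bar> \<le> v\<^sup>2 / k" if "k > 0" for k v
  proof (cases "\<bar>v\<bar> \<le> k")
    case True then show ?thesis using that by (auto simp: cl_def)
  next
    case False
    then have "\<bar>v - cl k v\<bar> \<le> \<bar>v\<bar>" using that by (auto simp: cl_def)
    also have "\<bar>v\<bar> * k \<le> \<bar>v\<bar> * \<bar>v\<bar>" using False by (intro mult_left_mono) auto
    then have "\<bar>v\<bar> \<le> v\<^sup>2 / k" using that by (simp add: pos_le_divide_eq power2_eq_square)
    finally show ?thesis .
  qed
  have cl_int: "integrable M (\<lambda>w. cl k (V w))" if [measurable]: "V \<in> borel_measurable M" and "k > 0" for k V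
    using that cl_bd[OF that(2)] by (intro integrable_const_bound[of _ k]) auto
  have err: "\<bar>(LINT w|M. V w) - (LINT w|M. cl k (V w))\<bar> \<le> C / k"
    if [measurable]: "V \<in> borel_measurable M" and V: "(\<integral>\<^sup>+w. ennreal ((V w)\<^sup>2) \<partial>M) \<le> ennreal C" and k: "k > 0" for V k
  proof -
    have "\<bar>(LINT w|M. V w) - (LINT w|M. cl k (V w))\<bar> = \<bar>LINT w|M. V w - cl k (V w)\<bar>"
      using sq[OF _ V] cl_int k by (subst Bochner_Integration.integral_diff) auto
    also have "\<dots> \<le> (LINT w|M. (V w)\<^sup>2 / k)"
      using sq[OF _ V] cl_int k cl_err
      by (intro order_trans[OF integral_abs_bound integral_mono] integrable_abs Bochner_Integration.integrable_diff) auto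
    also have "\<dots> \<le> C / k" using sq[OF _ V] k by (simp add: divide_right_mono)
    finally show ?thesis .
  qed
  show "(\<lambda>n. LINT w|M. Y n w) \<longlonglongrightarrow> (LINT w|M. Z w)"
  proof (rule LIMSEQ_I)
    fix r :: real assume r: "0 < r"
    \<comment> \<open>Makes each of the two truncation errors \<open>C / k\<close> smaller than
      \<open>r / 3\<close>; the \<open>1\<close> keeps \<open>k\<close> positive when
      \<open>C = 0\<close>.\<close>
    define k where "k = 3 * (C + 1) / r"
    have k: "k > 0" using r C0 by (simp add: k_def)
    have Ck: "C / k < r / 3" using r C0 by (simp add: k_def field_simps)
    have "(\<lambda>n. LINT w|M. cl k (Y n w)) \<longlonglongrightarrow> (LINT w|M. cl k (Z w))"
    proof (rule integral_dominated_convergence[where w="\<lambda>_. k"])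
      show "AE w in M. (\<lambda>n. cl k (Y n w)) \<longlonglongrightarrow> cl k (Z w)"
        using conv by eventually_elim (auto simp: cl_def intro!: tendsto_intros)
      show "AE w in M. norm (cl k (Y n w)) \<le> k" for n using cl_bd[OF k] by auto
    qed auto
    from LIMSEQ_D[OF this, of "r/3"] r obtain N where
      N: "\<And>n. n \<ge> N \<Longrightarrow> \<bar>(LINT w|M. cl k (Y n w)) - (LINT w|M. cl k (Z w))\<bar> < r / 3" by auto
    show "\<exists>N. \<forall>n\<ge>N. norm ((LINT w|M. Y n w) - (LINT w|M. Z w)) < r"
    proof (intro exI allI impI)
      fix n assume "n \<ge> N"
      show "norm ((LINT w|M. Y n w) - (LINT w|M. Z w)) < r"
        using N[OF \<open>n \<ge> N\<close>] err[OF assms(1) bd k, of n] err[OF assms(2) Zbd k] Ck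
        unfolding real_norm_def by linarith
    qed
  qed
qed

text \<open>Demanded at every real time. Processes on the half-line will be extended by their value
  at 0, which frees joint measurability from any restriction on time.\<close>

definition right_continuous :: "(real \<Rightarrow> real) \<Rightarrow> bool" where
  "right_continuous p \<longleftrightarrow> (\<forall>t. (p \<longlongrightarrow> p t) (at_right t))"

lemma right_continuous_tendsto:
  assumes "right_continuous p" and t: "t \<longlonglongrightarrow> s" and ge: "\<And>n. s \<le> t n"
  shows "(\<lambda>n. p (t n)) \<longlonglongrightarrow> p s"
proof -
  have "(p \<longlongrightarrow> p s) (at s within {s..})"
    using assms(1) unfolding right_continuous_def
    by (metis at_within_Ici_at_right)
  then have "continuous (at s within {s..}) p" by (simp add: continuous_within)
  then show ?thesis using t ge
    by (auto simp: continuous_within_sequentially comp_def)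
qed

text \<open>Each time is approached from the right by the next point of the grid of mesh
  \<open>1 / Suc n\<close>. On the grid only countably many random variables occur, so the
  approximations are jointly measurable.\<close>

lemma right_continuous_joint_measurable:
  fixes Y :: "real \<Rightarrow> 'a \<Rightarrow> real"
  assumes meas: "\<And>t. Y t \<in> borel_measurable N"
    and rc: "\<And>w. w \<in> space N \<Longrightarrow> right_continuous (\<lambda>t. Y t w)"
  shows "(\<lambda>(t, w). Y t w) \<in> borel_measurable (borel \<Otimes>\<^sub>M N)"
proof (rule borel_measurable_LIMSEQ_real)
  let ?u = "\<lambda>n t. (of_int \<lfloor>t * real (Suc n)\<rfloor> + 1) / real (Suc n)"
  fix z :: "real \<times> 'a" assume z: "z \<in> space (borel \<Otimes>\<^sub>M N)"
  obtain t w where tw: "z = (t, w)" "w \<in> space N" using z by (auto simp: space_pair_measure)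
  have ge: "t \<le> ?u n t" for n
    using floor_correct[of "t * real (Suc n)"] by (subst pos_le_divide_eq) auto
  have "(\<lambda>n. ?u n t) \<longlonglongrightarrow> t"
  proof (rule tendsto_sandwich)
    show "\<forall>\<^sub>F n in sequentially. t \<le> ?u n t"
      using ge by simp
    show "\<forall>\<^sub>F n in sequentially. ?u n t \<le> t + 1 / real (Suc n)"
    proof (intro always_eventually allI)
      fix n show "?u n t \<le> t + 1 / real (Suc n)"
        using floor_correct[of "t * real (Suc n)"]
        by (simp only: add_divide_distrib add_le_cancel_right, subst pos_divide_le_eq) auto
    qed
    show "(\<lambda>n. t + 1 / real (Suc n)) \<longlonglongrightarrow> t" by real_asymp
  qed auto
  then show "(\<lambda>n. case z of (t, w) \<Rightarrow> Y (?u n t) w) \<longlonglongrightarrow> (case z of (t, w) \<Rightarrow> Y t w)"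
    using right_continuous_tendsto[OF rc[OF tw(2)] _ ge] tw by simp
next
  fix n
  have "(\<lambda>z. Y ((of_int \<lfloor>fst z * real (Suc n)\<rfloor> + 1) / real (Suc n)) (snd z)) \<in> borel_measurable (borel \<Otimes>\<^sub>M N)"
    by (rule measurable_compose_countable[where f="\<lambda>i z. Y ((of_int i + 1) / real (Suc n)) (snd z)"
          and g="\<lambda>z. \<lfloor>fst z * real (Suc n)\<rfloor>"])
      (auto intro!: measurable_compose[OF measurable_snd meas])
  then show "(\<lambda>z. case z of (t, w) \<Rightarrow> Y ((of_int \<lfloor>t * real (Suc n)\<rfloor> + 1) / real (Suc n)) w)
     \<in> borel_measurable (borel \<Otimes>\<^sub>M N)"
    by (simp add: case_prod_beta')
qed

subsection \<open>The Markov property at fixed times\<close>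

locale spectrally_negative = prob_space M
  for M :: "'a measure" and X :: "real \<Rightarrow> 'a \<Rightarrow> real" and \<psi> W :: "real \<Rightarrow> real" +
  assumes snl: "spectrally_negative_levy M X"
    and exponent: "laplace_exponent M X \<psi>"
    and scale: "scale_function \<psi> 0 W"
begin

lemma levy: "levy_process M X"
  using snl by (simp add: spectrally_negative_levy_def)

lemma X_measurable [measurable]: "0 \<le> t \<Longrightarrow> X t \<in> borel_measurable M"
  using levy by (simp add: levy_process_def)

lemma X_max_measurable [measurable]: "X (max 0 t) \<in> borel_measurable M"
  by (rule X_measurable) simp

lemma X_0: "AE w in M. X 0 w = 0"
  using levy by (simp add: levy_process_def)

lemma distr_increment:
  "0 \<le> s \<Longrightarrow> 0 \<le> t \<Longrightarrow> distr M borel (\<lambda>w. X (s + t) w - X s w) = distr M borel (X t)"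
  using levy by (simp add: levy_process_def)

lemma indep_increments:
  "0 \<le> t 0 \<Longrightarrow> incseq t \<Longrightarrow> indep_vars (\<lambda>_. borel) (\<lambda>i w. X (t (Suc i)) w - X (t i) w) {..<n}"
  using levy by (simp add: levy_process_def)

lemma exp_moment:
  assumes "0 \<le> \<theta>" "0 \<le> t"
  shows "integrable M (\<lambda>w. exp (\<theta> * X t w))" "(LINT w|M. exp (\<theta> * X t w)) = exp (t * \<psi> \<theta>)"
proof -
  show eq: "(LINT w|M. exp (\<theta> * X t w)) = exp (t * \<psi> \<theta>)"
    using exponent assms by (auto simp: laplace_exponent_def)
  then show "integrable M (\<lambda>w. exp (\<theta> * X t w))"
    by (metis exp_not_eq_zero not_integrable_integral_eq)
qed

text \<open>Kept constant before time 0, so that it is right-continuous on the whole line and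
  measurable at every real time.\<close>

definition path :: "real \<Rightarrow> real \<Rightarrow> 'a \<Rightarrow> real" where
  "path x t w = x + X (max 0 t) w"

lemma path_right_continuous:
  assumes "w \<in> space M" shows "right_continuous (\<lambda>t. path x t w)"
  unfolding right_continuous_def
proof
  fix t :: real
  have cadlag: "cadlag (\<lambda>t. X t w)" using levy assms by (simp add: levy_process_def)
  show "((\<lambda>t. path x t w) \<longlongrightarrow> path x t w) (at_right t)"
  proof (cases "0 \<le> t")
    case True
    then have "((\<lambda>t. X t w) \<longlongrightarrow> X t w) (at_right t)" using cadlag by (simp add: cadlag_def)
    then have "((\<lambda>t. x + X t w) \<longlongrightarrow> x + X t w) (at_right t)" by (intro tendsto_intros)
    moreover have "\<forall>\<^sub>F s in at_right t. x + X s w = path x s w"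
      using True by (auto simp: path_def max_def intro!: eventually_mono[OF eventually_at_right_less[of t]])
    ultimately show ?thesis using True by (auto simp: path_def max_def intro: Lim_transform_eventually)
  next
    case False
    have "\<forall>\<^sub>F s in at_right t. path x t w = path x s w"
      using False by (intro eventually_at_rightI[of t 0]) (auto simp: path_def)
    then show ?thesis by (rule Lim_transform_eventually[OF tendsto_const])
  qed
qed

lemma path_measurable [measurable]: "path x t \<in> borel_measurable M"
  unfolding path_def[abs_def] by measurable

lemma path_joint_measurable [measurable]: "(\<lambda>(t, w). path x t w) \<in> borel_measurable (borel \<Otimes>\<^sub>M M)"
  by (rule right_continuous_joint_measurable) (auto intro: path_right_continuous)

lemma path_0: "AE w in M. path x 0 w = x"
  using X_0 by (auto simp: path_def)

section \<open>The history up to a fixed time and its independence of later increments\<close>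

definition past :: "real \<Rightarrow> 'a measure" where
  "past s = sigma (space M) (\<Union>t\<in>{0..s}. {X t -` B \<inter> space M | B. B \<in> sets borel})"

lemma space_past [simp]: "space (past s) = space M"
  by (auto simp: past_def space_measure_of_conv)

lemma sets_past: "sets (past s) = sigma_sets (space M) (\<Union>t\<in>{0..s}. {X t -` B \<inter> space M | B. B \<in> sets borel})"
  unfolding past_def by (rule sets_measure_of) auto

lemma past_subalgebra: "subalgebra M (past s)"
  unfolding subalgebra_def sets_past
  by (auto intro!: sets.sigma_sets_subset measurable_sets[OF X_measurable])

lemma past_measurable: "f \<in> measurable (past s) N \<Longrightarrow> f \<in> measurable M N"
  by (rule measurable_from_subalg[OF past_subalgebra])

lemma X_past_measurable: "0 \<le> t \<Longrightarrow> t \<le> s \<Longrightarrow> X t \<in> borel_measurable (past s)"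
  by (rule measurableI) (force simp: sets_past intro!: sigma_sets.Basic)+

lemma path_past_measurable: "t \<le> s \<Longrightarrow> 0 \<le> s \<Longrightarrow> path x t \<in> borel_measurable (past s)"
  unfolding path_def[abs_def]
  by (intro borel_measurable_add measurable_const X_past_measurable) auto

text \<open>Progressive measurability, by freezing the path at time \<open>s\<close>; it is needed
  because the clock integrates over all times up to \<open>s\<close>.\<close>

lemma path_past_joint_measurable:
  assumes "0 \<le> s"
  shows "(\<lambda>(t, w). path x (min s t) w) \<in> borel_measurable (borel \<Otimes>\<^sub>M past s)"
proof (rule right_continuous_joint_measurable)
  show "path x (min s t) \<in> borel_measurable (past s)" for t
    by (rule path_past_measurable) (use assms in auto)
  fix w assume w: "w \<in> space (past s)"
  show "right_continuous (\<lambda>t. path x (min s t) w)"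
    unfolding right_continuous_def
  proof
    fix t
    show "((\<lambda>t. path x (min s t) w) \<longlongrightarrow> path x (min s t) w) (at_right t)"
    proof (cases "t < s")
      case True
      have "((\<lambda>t. path x t w) \<longlongrightarrow> path x t w) (at_right t)"
        using path_right_continuous w by (simp add: right_continuous_def)
      moreover have "\<forall>\<^sub>F r in at_right t. path x r w = path x (min s r) w"
        using True by (auto simp: eventually_at_right intro!: exI[of _ s])
      ultimately show ?thesis using True by (auto intro: Lim_transform_eventually)
    next
      case False
      have "\<forall>\<^sub>F r in at_right t. path x (min s t) w = path x (min s r) w"
        using False by (auto intro!: eventually_mono[OF eventually_at_right_less[of t]])
      then show ?thesis by (rule Lim_transform_eventually[OF tendsto_const])
    qed
  qed
qed

text \<open>Independence is given only for the increments along an increasing sequence of times.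
  Sorting \<open>J\<close> together with 0 and \<open>s\<close> makes each value of the process at a
  time in \<open>J\<close> a sum of increments before \<open>s\<close>, at least where
  \<open>X 0 = 0\<close>, which is almost everywhere.\<close>

lemma cylinder_indep_increment:
  assumes s: "0 \<le> s" and u: "0 \<le> u" and J: "finite J" "J \<subseteq> {0..s}"
    and B: "\<And>t. B t \<in> sets borel" and D: "D \<in> sets borel"
  defines "C \<equiv> {w\<in>space M. \<forall>t\<in>J. X t w \<in> B t}"
    and "E \<equiv> {w\<in>space M. X (s + u) w - X s w \<in> D}"
  shows "prob (C \<inter> E) = prob C * prob E"
proof -
  define l where "l = sorted_list_of_set (insert 0 (insert s J))"
  define n where "n = length l"
  have setl: "set l = insert 0 (insert s J)" unfolding l_def by (rule set_sorted_list_of_set) (use J in auto)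
  have sl: "sorted l" "distinct l" by (simp_all add: l_def)
  have n0: "0 < n" using setl by (auto simp: n_def)
  have nths: "l ! i \<in> {0..s}" if "i < n" for i
    using nth_mem[of i l] that J s by (auto simp: setl n_def)
  have l0: "l ! 0 = 0"
  proof -
    obtain i where "i < n" "l ! i = 0" using setl by (metis in_set_conv_nth insertI1 n_def)
    then show ?thesis using sorted_nth_mono[OF sl(1), of 0 i] nths[of 0] n0 by (auto simp: n_def)
  qed
  have ln: "l ! (n - 1) = s"
  proof -
    obtain i where "i < n" "l ! i = s" using setl by (metis in_set_conv_nth insertI1 insertI2 n_def)
    then show ?thesis using sorted_nth_mono[OF sl(1), of i "n - 1"] nths[of "n - 1"] n0 by (auto simp: n_def)
  qed
  \<comment> \<open>The list ends at \<open>s\<close>, so the increment with index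
    \<open>n - 1\<close> is the one over \<open>[s, s + u]\<close>; the constant continuation makes
    \<open>t\<close> increasing on all naturals.\<close>
  define t where "t i = (if i < n then l ! i else s + u)" for i
  have "incseq t"
    using nths u sorted_nth_mono[OF sl(1)] by (force simp: incseq_def t_def n_def)
  moreover have "0 \<le> t 0" using l0 n0 by (simp add: t_def)
  ultimately have ind: "indep_vars (\<lambda>_. borel) (\<lambda>i w. X (t (Suc i)) w - X (t i) w) {..<n}"
    by (intro indep_increments)
  let ?xi = "\<lambda>i w. X (t (Suc i)) w - X (t i) w"
  let ?P = "PiM {..<n - 1} (\<lambda>_. borel :: real measure)" and ?Q = "PiM {n - 1} (\<lambda>_. borel :: real measure)"
  have ind2: "indep_var ?P (\<lambda>w. restrict (\<lambda>i. ?xi i w) {..<n - 1}) ?Q (\<lambda>w. restrict (\<lambda>i. ?xi i w) {n - 1})"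
    by (rule indep_var_restrict[OF ind]) (use n0 in auto)
  \<comment> \<open>The cylinder in terms of increments. Its sums run over
    \<open>j < i \<le> n - 1\<close>, hence over coordinates of the first block only.\<close>
  define SA where "SA = {f\<in>space ?P. \<forall>i\<in>{..<n}. l ! i \<in> J \<longrightarrow> (\<Sum>j<i. f j) \<in> B (l ! i)}"
  define SB where "SB = {f\<in>space ?Q. f (n - 1) \<in> D}"
  have "SA \<in> sets ?P"
    unfolding SA_def
  proof (intro sets.sets_Collect_finite_All' sets.sets_Collect_imp sets.sets_Collect_const)
    fix i assume i: "i \<in> {..<n}"
    have m: "(\<lambda>f. \<Sum>j<i. f j) \<in> borel_measurable ?P"
      using i by (intro borel_measurable_sum measurable_component_singleton) auto
    show "{f \<in> space ?P. (\<Sum>j<i. f j) \<in> B (l ! i)} \<in> sets ?P"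
      using measurable_sets[OF m B[of "l ! i"]] by (simp add: vimage_def Int_def conj_commute)
  qed (use n0 in auto)
  moreover have "SB \<in> sets ?Q"
  proof -
    have "(\<lambda>f. f (n - 1)) \<in> borel_measurable ?Q" by (intro measurable_component_singleton) auto
    from measurable_sets[OF this D] show ?thesis by (simp add: SB_def vimage_def Int_def conj_commute)
  qed
  ultimately have prod: "prob ((\<lambda>w. (restrict (\<lambda>i. ?xi i w) {..<n - 1}, restrict (\<lambda>i. ?xi i w) {n - 1})) -` (SA \<times> SB) \<inter> space M)
      = prob ((\<lambda>w. restrict (\<lambda>i. ?xi i w) {..<n - 1}) -` SA \<inter> space M)
        * prob ((\<lambda>w. restrict (\<lambda>i. ?xi i w) {n - 1}) -` SB \<inter> space M)"
    by (rule indep_varD[OF ind2])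
  define C' where "C' = (\<lambda>w. restrict (\<lambda>i. ?xi i w) {..<n - 1}) -` SA \<inter> space M"
  have SBE: "(\<lambda>w. restrict (\<lambda>i. ?xi i w) {n - 1}) -` SB \<inter> space M = E"
    using n0 ln by (auto simp: SB_def E_def space_PiM t_def)
  have C'E: "(\<lambda>w. (restrict (\<lambda>i. ?xi i w) {..<n - 1}, restrict (\<lambda>i. ?xi i w) {n - 1})) -` (SA \<times> SB) \<inter> space M = C' \<inter> E"
    unfolding C'_def SBE[symmetric] by auto
  have SAE: "w \<in> C' \<longleftrightarrow> w \<in> C" if w: "w \<in> space M" "X 0 w = 0" for w
  proof -
    have "(\<Sum>j<i. restrict (\<lambda>i. ?xi i w) {..<n - 1} j) = X (l ! i) w" if i: "i < n" for i
    proof -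
      have "(\<Sum>j<i. restrict (\<lambda>i. ?xi i w) {..<n - 1} j) = (\<Sum>j<i. X (t (Suc j)) w - X (t j) w)"
        using i by (intro sum.cong) auto
      also have "\<dots> = X (t i) w - X (t 0) w" by (rule sum_lessThan_telescope)
      finally show ?thesis using i w n0 l0 by (simp add: t_def)
    qed
    moreover have "J \<subseteq> set l" using setl by auto
    ultimately show ?thesis using w
      by (auto simp: C'_def SA_def C_def space_PiM in_set_conv_nth n_def[symmetric] subset_iff)
  qed
  have AE_eq: "AE w in M. w \<in> C' \<longleftrightarrow> w \<in> C"
    using X_0 AE_space by eventually_elim (rule SAE)
  have Cm [measurable]: "C \<in> events"
    unfolding C_def using J B measurable_sets[OF X_measurable]
    by (intro sets.sets_Collect_finite_All) (auto simp: vimage_def Int_def conj_commute)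
  have Em [measurable]: "E \<in> events"
    unfolding E_def using D s u measurable_sets[OF borel_measurable_diff[OF X_measurable X_measurable] D, of "s + u" s]
    by (simp add: vimage_def Int_def conj_commute)
  have C'm [measurable]: "C' \<in> events"
    unfolding C'_def using indep_var_rv1[OF ind2] \<open>SA \<in> sets ?P\<close> by (rule measurable_sets)
  have "prob C' = prob C"
    using AE_eq by (intro finite_measure_eq_AE) auto
  moreover have "prob (C' \<inter> E) = prob (C \<inter> E)"
    using AE_eq by (intro finite_measure_eq_AE) auto
  ultimately show ?thesis
    using prod unfolding C'E SBE C'_def[symmetric] by simp
qed

text \<open>Cylinders over finitely many times are closed under intersection and generate the
  history, so independence extends from them by the \<pi>-\<lambda> argument.\<close>

lemma past_indep_increment:
  assumes s: "0 \<le> s" and u: "0 \<le> u"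
  shows "indep_set (sets (past s)) (sigma_sets (space M) {(\<lambda>w. X (s + u) w - X s w) -` D \<inter> space M | D. D \<in> sets borel})"
proof -
  let ?xi = "\<lambda>w. X (s + u) w - X s w"
  let ?E = "{?xi -` D \<inter> space M | D. D \<in> sets borel}"
  define cyl where "cyl J B = {w\<in>space M. \<forall>t\<in>J. X t w \<in> B t}" for J and B :: "real \<Rightarrow> real set"
  define G where "G = {cyl J B | J B. finite J \<and> J \<subseteq> {0..s} \<and> (\<forall>t. B t \<in> sets borel)}"
  have xi [measurable]: "?xi \<in> borel_measurable M"
    using s u by (intro borel_measurable_diff X_measurable) auto
  have cyl_sets: "cyl J B \<in> events" if "finite J" "J \<subseteq> {0..s}" "\<forall>t. B t \<in> sets borel" for J B
    unfolding cyl_def using that measurable_sets[OF X_measurable]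
    by (intro sets.sets_Collect_finite_All) (auto simp: vimage_def Int_def conj_commute)
  have "Int_stable G"
  proof (rule Int_stableI)
    fix a b assume "a \<in> G" "b \<in> G"
    then obtain J B K C where J: "a = cyl J B" "finite J" "J \<subseteq> {0..s}" "\<forall>t. B t \<in> sets borel"
      and K: "b = cyl K C" "finite K" "K \<subseteq> {0..s}" "\<forall>t. C t \<in> sets borel"
      by (auto simp: G_def)
    \<comment> \<open>Padding with \<open>UNIV\<close> lets both cylinders be written over the
      common index set \<open>J \<union> K\<close>.\<close>
    let ?D = "\<lambda>t. (if t \<in> J then B t else UNIV) \<inter> (if t \<in> K then C t else UNIV)"
    have "a \<inter> b = cyl (J \<union> K) ?D" unfolding J(1) K(1) cyl_def by auto
    moreover have "\<forall>t. ?D t \<in> sets borel" using J K by auto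
    ultimately show "a \<inter> b \<in> G" unfolding G_def using J K by blast
  qed
  moreover have "Int_stable ?E"
  proof (rule Int_stableI)
    fix a b assume "a \<in> ?E" "b \<in> ?E"
    then obtain C D where "a = ?xi -` C \<inter> space M" "b = ?xi -` D \<inter> space M" "C \<in> sets borel" "D \<in> sets borel"
      by auto
    then show "a \<inter> b \<in> ?E" by (intro CollectI exI[of _ "C \<inter> D"]) auto
  qed
  moreover have "indep_set G ?E"
  proof (rule indep_setI)
    show "G \<subseteq> events" using cyl_sets by (auto simp: G_def)
    show "?E \<subseteq> events" using measurable_sets[OF xi] by auto
    fix a b assume "a \<in> G" "b \<in> ?E"
    then obtain J B D where "a = cyl J B" "finite J" "J \<subseteq> {0..s}" "\<forall>t. B t \<in> sets borel"
      "b = {w\<in>space M. ?xi w \<in> D}" "D \<in> sets borel"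
      by (auto simp: G_def)
    then show "prob (a \<inter> b) = prob a * prob b"
      using cylinder_indep_increment[OF s u, of J B D] by (simp add: cyl_def)
  qed
  ultimately have "indep_set (sigma_sets (space M) G) (sigma_sets (space M) ?E)"
    by (intro indep_set_sigma_sets)
  moreover have "sets (past s) \<subseteq> sigma_sets (space M) G"
    unfolding sets_past
  proof (rule sigma_sets_mono, safe)
    fix t and B :: "real set" assume "t \<in> {0..s}" "B \<in> sets borel"
    then have "X t -` B \<inter> space M = cyl {t} (\<lambda>_. B)" "cyl {t} (\<lambda>_. B) \<in> G"
      unfolding G_def by (force simp: cyl_def, intro CollectI exI[of _ "{t}"] exI[of _ "\<lambda>_. B"], auto)
    then show "X t -` B \<inter> space M \<in> sigma_sets (space M) G" by auto
  qed
  ultimately show ?thesis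
    unfolding indep_set_def
    by (elim indep_sets_mono_sets) (auto split: bool.split)
qed

lemma past_increment_distr:
  assumes s: "0 \<le> s" and u: "0 \<le> u" and V: "V \<in> measurable (past s) N"
  shows "distr M (N \<Otimes>\<^sub>M borel) (\<lambda>w. (V w, X (s + u) w - X s w)) = distr M N V \<Otimes>\<^sub>M distr M borel (X u)"
proof -
  let ?xi = "\<lambda>w. X (s + u) w - X s w"
  have [measurable]: "V \<in> measurable M N" by (rule past_measurable[OF V])
  have xi [measurable]: "?xi \<in> borel_measurable M"
    using s u by (intro borel_measurable_diff X_measurable) auto
  interpret V: prob_space "distr M N V" by (rule prob_space_distr) measurable
  interpret U: prob_space "distr M borel ?xi" by (rule prob_space_distr) measurable
  have "distr M N V \<Otimes>\<^sub>M distr M borel ?xi = distr M (N \<Otimes>\<^sub>M borel) (\<lambda>w. (V w, ?xi w))"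
  proof (rule pair_measure_eqI)
    fix A B assume A: "A \<in> sets (distr M N V)" and B: "B \<in> sets (distr M borel ?xi)"
    have "V -` A \<inter> space M \<in> sets (past s)"
      using measurable_sets[OF V] A by simp
    moreover have "?xi -` B \<inter> space M \<in> sigma_sets (space M) {?xi -` D \<inter> space M | D. D \<in> sets borel}"
      using B by auto
    ultimately have "prob ((V -` A \<inter> space M) \<inter> (?xi -` B \<inter> space M)) = prob (V -` A \<inter> space M) * prob (?xi -` B \<inter> space M)"
      by (rule indep_setD[OF past_indep_increment[OF s u]])
    moreover have "(V -` A \<inter> space M) \<inter> (?xi -` B \<inter> space M) = (\<lambda>w. (V w, ?xi w)) -` (A \<times> B) \<inter> space M"
      by auto
    ultimately show "emeasure (distr M N V) A * emeasure (distr M borel ?xi) B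
        = emeasure (distr M (N \<Otimes>\<^sub>M borel) (\<lambda>w. (V w, ?xi w))) (A \<times> B)"
      using A B by (simp add: emeasure_distr emeasure_eq_measure ennreal_mult')
  qed (auto intro: V.sigma_finite_measure_axioms U.sigma_finite_measure_axioms)
  then show ?thesis by (simp add: distr_increment[OF s u])
qed

text \<open>The weight \<open>Z\<close> stands in for conditional expectations: it will carry the
  killing factor and the event that the exit has not yet happened. The pair of \<open>Z\<close> and
  the present state is independent of the next increment, and Fubini's theorem does the
  rest.\<close>

lemma markov:
  fixes Z :: "'a \<Rightarrow> real" and f :: "real \<Rightarrow> real"
  assumes s: "0 \<le> s" and u: "0 \<le> u" and Z: "Z \<in> borel_measurable (past s)"
    and f [measurable]: "f \<in> borel_measurable borel"
    and int: "integrable M (\<lambda>w. Z w * f (path x (s + u) w))"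
  shows "(LINT w|M. Z w * f (path x (s + u) w)) = (LINT w|M. Z w * (LINT v|M. f (path x s w + X u v)))"
proof -
  let ?xi = "\<lambda>w. X (s + u) w - X s w" and ?V = "\<lambda>w. (Z w, path x s w)"
  let ?B = "borel \<Otimes>\<^sub>M borel :: (real \<times> real) measure"
  let ?h = "\<lambda>(v, e). fst v * f (snd v + e) :: real"
  have [measurable]: "Z \<in> borel_measurable M" by (rule past_measurable[OF Z])
  have xi [measurable]: "?xi \<in> borel_measurable M"
    using s u by (intro borel_measurable_diff X_measurable) auto
  have [measurable]: "X u \<in> borel_measurable M" using u by measurable
  have eq: "distr M (?B \<Otimes>\<^sub>M borel) (\<lambda>w. (?V w, ?xi w)) = distr M ?B ?V \<Otimes>\<^sub>M distr M borel (X u)"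
    using s u by (intro past_increment_distr measurable_Pair Z path_past_measurable) auto
  interpret V: prob_space "distr M ?B ?V" by (rule prob_space_distr) measurable
  interpret U: prob_space "distr M borel (X u)" by (rule prob_space_distr) measurable
  interpret VU: pair_prob_space "distr M ?B ?V" "distr M borel (X u)" ..
  have hV: "path x s w + ?xi w = path x (s + u) w" for w
    using s u by (simp add: path_def algebra_simps)
  have "integrable (distr M ?B ?V \<Otimes>\<^sub>M distr M borel (X u)) ?h"
    unfolding eq[symmetric] by (subst integrable_distr_eq) (use int hV in simp_all)
  note fub = VU.integral_fst'[OF this]
  have "(LINT w|M. Z w * f (path x (s + u) w)) = (LINT z|distr M (?B \<Otimes>\<^sub>M borel) (\<lambda>w. (?V w, ?xi w)). ?h z)"
    by (subst integral_distr) (use hV in simp_all)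
  also have "\<dots> = (LINT v|distr M ?B ?V. LINT e|distr M borel (X u). ?h (v, e))"
    unfolding eq fub ..
  also have "\<dots> = (LINT v|distr M ?B ?V. LINT w|M. ?h (v, X u w))"
    by (subst integral_distr) simp_all
  also have "\<dots> = (LINT w|M. LINT v|M. ?h (?V w, X u v))"
    by (subst integral_distr) (simp_all add: case_prod_beta')
  finally show ?thesis by simp
qed

subsection \<open>The scale function\<close>

lemma levy_process_uminus: "levy_process M (\<lambda>t w. - X t w)"
  unfolding levy_process_def
proof (intro conjI allI impI ballI)
  show "prob_space M" by unfold_locales
  show "AE w in M. - X 0 w = 0" using X_0 by auto
  show "cadlag (\<lambda>t. - X t w)" if "w \<in> space M" for w
  proof -
    have "cadlag (\<lambda>t. X t w)" using levy that by (simp add: levy_process_def)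
    then show ?thesis unfolding cadlag_def by (auto intro!: tendsto_minus) (metis tendsto_minus)
  qed
  show "distr M borel (\<lambda>w. - X (s + t) w - - X s w) = distr M borel (\<lambda>w. - X t w)"
    if st: "0 \<le> s" "0 \<le> t" for s t
  proof -
    have [measurable]: "X (s + t) \<in> borel_measurable M" "X s \<in> borel_measurable M" "X t \<in> borel_measurable M"
      using st by (auto intro: X_measurable)
    have "distr M borel (\<lambda>w. - X (s + t) w - - X s w) = distr (distr M borel (\<lambda>w. X (s + t) w - X s w)) borel uminus"
      by (subst distr_distr) (auto simp: comp_def)
    also have "\<dots> = distr M borel (\<lambda>w. - X t w)"
      unfolding distr_increment[OF st] by (subst distr_distr) (auto simp: comp_def)
    finally show ?thesis .
  qed
  show "indep_vars (\<lambda>_. borel) (\<lambda>i w. - X (t (Suc i)) w - - X (t i) w) {..<n}"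
    if "0 \<le> t 0 \<and> incseq t" for t :: "nat \<Rightarrow> real" and n
    using indep_vars_compose2[OF indep_increments[of t n], of "\<lambda>_. uminus" "\<lambda>_. borel"] that by simp
qed (auto intro: borel_measurable_uminus)

text \<open>Otherwise stationarity gives \<open>X r \<le> X q\<close> almost surely for each pair
  \<open>q \<le> r\<close>, hence simultaneously for all rational pairs, and right-continuity
  carries this to all times: \<open>- X\<close> would be a subordinator.\<close>

lemma positive_somewhere: "\<exists>t\<ge>0. prob {w\<in>space M. 0 < X t w} > 0"
proof (rule ccontr)
  assume "\<not> (\<exists>t\<ge>0. prob {w\<in>space M. 0 < X t w} > 0)"
  then have np: "prob {w\<in>space M. 0 < X t w} = 0" if "0 \<le> t" for t
    using that by (meson measure_nonneg not_less order_antisym)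
  have pair: "AE w in M. X r w \<le> X q w" if "0 \<le> q" "q \<le> r" for q r :: real
  proof -
    have [measurable]: "X q \<in> borel_measurable M" "X r \<in> borel_measurable M" "X (r - q) \<in> borel_measurable M"
      using that by (auto intro: X_measurable)
    have "AE w in M. X (r - q) w \<le> 0"
      using np[of "r - q"] that by (simp add: AE_iff_measurable[OF _ refl] emeasure_eq_measure not_le)
    then have "AE z in distr M borel (X (r - q)). z \<le> 0" by (subst AE_distr_iff) auto
    also have "distr M borel (X (r - q)) = distr M borel (\<lambda>w. X r w - X q w)"
      using distr_increment[of q "r - q"] that by simp
    finally show ?thesis by (subst (asm) AE_distr_iff) auto
  qed
  have "AE w in M. \<forall>q\<in>\<rat>. \<forall>r\<in>\<rat>. 0 \<le> q \<and> q \<le> r \<longrightarrow> X r w \<le> X q w"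
    using pair by (intro AE_ball_countable[THEN iffD2] countable_rat ballI) auto
  then have "AE w in M. \<forall>s t. 0 \<le> s \<and> s \<le> t \<longrightarrow> - X s w \<le> - X t w"
    using AE_space
  proof eventually_elim
    case (elim w)
    show ?case
    proof (intro allI impI)
      fix s t :: real assume st: "0 \<le> s \<and> s \<le> t"
      show "- X s w \<le> - X t w"
      proof (cases "s = t")
        case False
        with st have st: "0 \<le> s" "s < t" by auto
        \<comment> \<open>Rationals strictly to the right of \<open>u\<close>, to be used at
          \<open>u = s\<close> and at \<open>u = t\<close>; eventually \<open>a n < t < b n\<close>,
          so the rational comparison applies.\<close>
        have "\<exists>a. \<forall>n. a n \<in> \<rat> \<and> u < a n \<and> a n < u + 1 / real (Suc n)" for u :: real
        proof (intro choice allI)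
          fix n
          have "u < u + 1 / real (Suc n)" by simp
          from Rats_dense_in_real[OF this] show "\<exists>q. q \<in> \<rat> \<and> u < q \<and> q < u + 1 / real (Suc n)" by auto
        qed
        then obtain a b where a: "\<And>n. a n \<in> \<rat> \<and> s < a n \<and> a n < s + 1 / real (Suc n)"
          and b: "\<And>n. b n \<in> \<rat> \<and> t < b n \<and> b n < t + 1 / real (Suc n)" by meson
        have lim: "f \<longlonglongrightarrow> u" if "\<And>n. f n \<in> \<rat> \<and> u < f n \<and> f n < u + 1 / real (Suc n)" for f u
        proof (rule tendsto_sandwich[of "\<lambda>_. u" f _ "\<lambda>n. u + 1 / real (Suc n)"])
          show "(\<lambda>n. u + 1 / real (Suc n)) \<longlonglongrightarrow> u" by real_asymp
        qed (use that in \<open>auto intro!: always_eventually intro: less_imp_le simp del: of_nat_Suc\<close>)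
        have Xlim: "(\<lambda>n. X (f n) w) \<longlonglongrightarrow> X u w" if f: "\<And>n. f n \<in> \<rat> \<and> u < f n \<and> f n < u + 1 / real (Suc n)" "0 \<le> u" for f u
        proof -
          have "(\<lambda>n. path 0 (f n) w) \<longlonglongrightarrow> path 0 u w"
            using f by (intro right_continuous_tendsto[OF path_right_continuous] elim(2) lim) (auto intro: less_imp_le)
          moreover have "path 0 (f n) w = X (f n) w" "path 0 u w = X u w" for n
            using f(1)[of n] f(2) by (auto simp: path_def)
          ultimately show ?thesis by simp
        qed
        have "eventually (\<lambda>n. a n < t) sequentially"
          using lim[OF a] st by (intro order_tendstoD)
        then have "eventually (\<lambda>n. X (b n) w \<le> X (a n) w) sequentially"
        proof eventually_elim
          case (elim n)
          then show ?case using \<open>\<forall>q\<in>\<rat>. \<forall>r\<in>\<rat>. 0 \<le> q \<and> q \<le> r \<longrightarrow> X r w \<le> X q w\<close> a[of n] b[of n] st by auto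
        qed
        then have "X t w \<le> X s w"
          using tendsto_le[OF sequentially_bot Xlim[OF a] Xlim[OF b]] st by auto
        then show ?thesis by simp
      qed auto
    qed
  qed
  then have "subordinator M (\<lambda>t w. - X t w)"
    using levy_process_uminus by (simp add: subordinator_def)
  then show False using snl by (simp add: spectrally_negative_levy_def)
qed

text \<open>If \<open>X t > e\<close> with probability \<open>p > 0\<close>, then
  \<open>exp (t * \<psi> \<theta>) \<ge> exp (\<theta> * e) * p\<close>, which exceeds 1 for large
  \<open>\<theta>\<close>.\<close>

lemma exponent_eventually_pos: "\<exists>b>0. \<forall>\<theta>\<ge>b. 0 < \<psi> \<theta>"
proof -
  obtain t where t: "0 \<le> t" and p: "prob {w\<in>space M. 0 < X t w} > 0"
    using positive_somewhere by blast
  have [measurable]: "X t \<in> borel_measurable M" using t by measurable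
  have "\<exists>n. prob {w\<in>space M. 1 / real (Suc n) < X t w} > 0"
  proof (rule ccontr)
    assume "\<not> ?thesis"
    then have "prob {w\<in>space M. 1 / real (Suc n) < X t w} = 0" for n
      by (meson measure_nonneg not_less order_antisym)
    then have "AE w in M. \<not> 1 / real (Suc n) < X t w" for n
      by (subst AE_iff_measurable[OF _ refl]) (auto simp: emeasure_eq_measure)
    then have "AE w in M. \<forall>n. \<not> 1 / real (Suc n) < X t w" by (simp add: AE_all_countable)
    then have "AE w in M. \<not> 0 < X t w"
    proof eventually_elim
      case (elim w)
      then show ?case using reals_Archimedean[of "X t w"] by (auto simp: inverse_eq_divide)
    qed
    then have "prob {w\<in>space M. 0 < X t w} = 0"
      by (subst (asm) AE_iff_measurable[OF _ refl]) (auto simp: emeasure_eq_measure)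
    with p show False by simp
  qed
  then obtain n where n: "prob {w\<in>space M. 1 / real (Suc n) < X t w} > 0" by blast
  define e where "e = 1 / real (Suc n)"
  define A where "A = {w\<in>space M. e < X t w}"
  have [measurable]: "A \<in> events" by (simp add: A_def)
  have e: "e > 0" and pA: "prob A > 0" using n by (auto simp: e_def A_def)
  \<comment> \<open>Chosen so that \<open>\<theta> * e * prob A \<ge> 1\<close> for
    \<open>\<theta> \<ge> b\<close>; then \<open>(1 + \<theta> * e) * prob A > 1\<close>.\<close>
  define b where "b = 1 / (e * prob A)"
  have b: "b > 0" using e pA by (simp add: b_def)
  have "0 < \<psi> \<theta>" if \<theta>: "\<theta> \<ge> b" for \<theta>
  proof -
    have "1 < (1 + \<theta> * e) * prob A"
      using \<theta> e pA by (simp add: b_def field_simps)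
    also have "\<dots> \<le> exp (\<theta> * e) * prob A"
      by (intro mult_right_mono exp_ge_add_one_self) auto
    also have "\<dots> = (LINT w|M. exp (\<theta> * e) * indicator A w)"
      by simp
    also have "\<dots> \<le> (LINT w|M. exp (\<theta> * X t w))"
    proof (intro integral_mono exp_moment)
      show "exp (\<theta> * e) * indicator A w \<le> exp (\<theta> * X t w)" for w
        using \<theta> b by (auto simp: A_def indicator_def)
    qed (use \<theta> b t in \<open>auto intro!: integrable_real_indicator simp: less_top[symmetric]\<close>)
    also have "\<dots> = exp (t * \<psi> \<theta>)" using exp_moment \<theta> b t by simp
    finally have "0 < t * \<psi> \<theta>" by simp
    then show ?thesis using t by (simp add: zero_less_mult_iff)
  qed
  then show ?thesis using b by blast
qed

section \<open>Regularity, Laplace transform and growth of the scale function\<close>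

lemma W_nonneg: "0 \<le> W x" and W_neg: "x < 0 \<Longrightarrow> W x = 0"
  and W_continuous_on: "continuous_on {0..} W"
  using scale by (auto simp: scale_function_def)

lemma W_mono: "mono W"
proof
  fix x y :: real assume "x \<le> y"
  moreover have "mono_on {0..} W" using scale by (simp add: scale_function_def)
  ultimately show "W x \<le> W y"
    using W_nonneg[of y] W_neg[of x] by (cases "x < 0") (auto simp: mono_on_def)
qed

lemma W_measurable [measurable]: "W \<in> borel_measurable borel"
  by (rule borel_measurable_mono[OF W_mono])

text \<open>At 0 the scale function may jump from 0 to a positive value, as it does for paths of
  bounded variation.\<close>

lemma W_isCont: "x \<noteq> 0 \<Longrightarrow> isCont W x"
proof (cases "x < 0")
  case True
  have "continuous_on {..<0} (\<lambda>_. 0 :: real)" by simp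
  then have "continuous_on {..<0} W" by (rule continuous_on_cong[THEN iffD1, rotated -1]) (auto simp: W_neg)
  then show ?thesis using True continuous_on_eq_continuous_at[of "{..<0}" W] by auto
next
  case False
  assume "x \<noteq> 0"
  with False show ?thesis using continuous_on_interior[OF W_continuous_on, of x] by auto
qed

lemma W_laplace_eventually:
  "\<exists>b>0. \<forall>\<theta>\<ge>b. 0 < \<psi> \<theta> \<and> (\<integral>\<^sup>+y. ennreal (exp (- \<theta> * y) * W y) \<partial>lborel) = ennreal (1 / \<psi> \<theta>)"
proof -
  obtain b where b: "b > 0" "\<And>\<theta>. \<theta> \<ge> b \<Longrightarrow> 0 < \<psi> \<theta>" using exponent_eventually_pos by blast
  \<comment> \<open>\<open>b\<close> lies in the closure of the set whose infimum is
    \<open>right_inverse \<psi> 0\<close>, being itself a member; the later shift to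
    \<open>b + 1\<close> makes the inequality strict.\<close>
  have "right_inverse \<psi> 0 \<le> b"
    unfolding right_inverse_def by (rule cInf_lower) (use b in \<open>auto intro!: bdd_belowI[of _ 0]\<close>)
  have "(\<integral>\<^sup>+y. ennreal (exp (- \<theta> * y) * W y) \<partial>lborel) = ennreal (1 / \<psi> \<theta>)" if "\<theta> \<ge> b + 1" for \<theta>
  proof -
    have pos: "0 < \<psi> \<theta>" using b(2)[of \<theta>] that by simp
    let ?g = "\<lambda>y. indicator {0<..} y * (exp (- \<theta> * y) * W y)"
    have "(LBINT y=0..\<infinity>. exp (- \<theta> * y) * W y) = 1 / \<psi> \<theta>"
      using scale that \<open>right_inverse \<psi> 0 \<le> b\<close> by (auto simp: scale_function_def)
    then have eq: "(LINT y|lborel. ?g y) = 1 / \<psi> \<theta>"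
      by (simp add: interval_lebesgue_integral_def set_lebesgue_integral_def zero_ereal_def)
    \<comment> \<open>The integral of a non-integrable function is 0 by convention, whereas
      \<open>1 / \<psi> \<theta>\<close> is positive.\<close>
    then have "integrable lborel ?g"
      using pos not_integrable_integral_eq by fastforce
    then have "(\<integral>\<^sup>+y. ennreal (?g y) \<partial>lborel) = ennreal (1 / \<psi> \<theta>)"
      unfolding eq[symmetric] by (rule nn_integral_eq_integral) (auto simp: W_nonneg)
    moreover have "(\<integral>\<^sup>+y. ennreal (?g y) \<partial>lborel) = (\<integral>\<^sup>+y. ennreal (exp (- \<theta> * y) * W y) \<partial>lborel)"
    proof (rule nn_integral_cong_AE)
      show "AE y in lborel. ennreal (?g y) = ennreal (exp (- \<theta> * y) * W y)"
        using AE_lborel_singleton[of 0] by eventually_elim (auto simp: indicator_def W_neg)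
    qed
    ultimately show ?thesis by simp
  qed
  then show ?thesis using b by (intro exI[of _ "b + 1"]) auto
qed

text \<open>One constant serves two ends: the transforms converge from here on, and
  \<open>exp (rate * x)\<close> measures the growth of \<open>W\<close> and of all functions to
  which Dynkin's formula is applied.\<close>

definition rate :: real where
  "rate = (SOME b. 0 < b \<and> (\<forall>\<theta>\<ge>b. 0 < \<psi> \<theta> \<and>
     (\<integral>\<^sup>+y. ennreal (exp (- \<theta> * y) * W y) \<partial>lborel) = ennreal (1 / \<psi> \<theta>)))"

lemma rate: "0 < rate \<and> (\<forall>\<theta>\<ge>rate. 0 < \<psi> \<theta> \<and>
     (\<integral>\<^sup>+y. ennreal (exp (- \<theta> * y) * W y) \<partial>lborel) = ennreal (1 / \<psi> \<theta>))"
  unfolding rate_def by (rule someI_ex[OF W_laplace_eventually])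

lemma rate_pos: "0 < rate"
  and exponent_pos: "rate \<le> \<theta> \<Longrightarrow> 0 < \<psi> \<theta>"
  and W_laplace: "rate \<le> \<theta> \<Longrightarrow> (\<integral>\<^sup>+y. ennreal (exp (- \<theta> * y) * W y) \<partial>lborel) = ennreal (1 / \<psi> \<theta>)"
  using rate by blast+

text \<open>By monotonicity the single value \<open>W x\<close> is dominated by the part of the
  Laplace integral over \<open>[x, x + 1]\<close>.\<close>

lemma W_exp_bound: "\<exists>C\<ge>0. \<forall>x. W x \<le> C * exp (rate * x)"
proof (intro exI conjI allI)
  show "0 \<le> exp rate / \<psi> rate" using exponent_pos[of rate] by simp
  fix x
  have "ennreal (exp (- rate * (x + 1)) * W x) = (\<integral>\<^sup>+y. ennreal (exp (- rate * (x + 1)) * W x) * indicator {x..x+1} y \<partial>lborel)"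
    by (subst nn_integral_cmult_indicator) auto
  also have "\<dots> \<le> (\<integral>\<^sup>+y. ennreal (exp (- rate * y) * W y) \<partial>lborel)"
    using rate_pos monoD[OF W_mono] W_nonneg
    by (intro nn_integral_mono) (auto simp: indicator_def intro!: mult_mono)
  also have "\<dots> = ennreal (1 / \<psi> rate)" by (rule W_laplace) simp
  finally have "exp (- rate * (x + 1)) * W x \<le> 1 / \<psi> rate"
    using exponent_pos[of rate] by (simp add: ennreal_le_iff)
  then have "exp (rate * (x + 1)) * (exp (- rate * (x + 1)) * W x) \<le> exp (rate * (x + 1)) * (1 / \<psi> rate)"
    by (intro mult_left_mono) auto
  moreover have "exp (rate * (x + 1)) * (exp (- rate * (x + 1)) * W x) = W x"
    by (simp add: mult.assoc[symmetric] mult_exp_exp)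
  moreover have "exp (rate * (x + 1)) = exp rate * exp (rate * x)"
    by (simp add: algebra_simps exp_add)
  ultimately show "W x \<le> exp rate / \<psi> rate * exp (rate * x)"
    by (metis mult.right_neutral times_divide_eq_left times_divide_eq_right)
qed

lemma nn_integral_exp_interval:
  assumes "0 < a" "0 \<le> t"
  shows "(\<integral>\<^sup>+s. indicator {0..t} s * ennreal (exp (s * a)) \<partial>lborel) = ennreal ((exp (t * a) - 1) / a)"
proof -
  have "(\<integral>\<^sup>+s. ennreal (exp (s * a)) * indicator {0..t} s \<partial>lborel) = ennreal (exp (t * a) / a - exp (0 * a) / a)"
    by (rule nn_integral_FTC_Icc) (use assms in \<open>auto intro!: derivative_eq_intros\<close>)
  then show ?thesis by (simp add: mult.commute diff_divide_distrib)
qed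

lemma nn_integral_exp_path:
  assumes "0 \<le> \<theta>" "0 \<le> s"
  shows "(\<integral>\<^sup>+w. ennreal (exp (\<theta> * path x s w)) \<partial>M) = ennreal (exp (\<theta> * x + s * \<psi> \<theta>))"
proof -
  have "(\<integral>\<^sup>+w. ennreal (exp (\<theta> * path x s w)) \<partial>M) = (\<integral>\<^sup>+w. ennreal (exp (\<theta> * x)) * ennreal (exp (\<theta> * X s w)) \<partial>M)"
    using assms by (simp add: path_def distrib_left exp_add ennreal_mult')
  also have "\<dots> = ennreal (exp (\<theta> * x)) * (\<integral>\<^sup>+w. ennreal (exp (\<theta> * X s w)) \<partial>M)"
    using assms by (intro nn_integral_cmult) auto
  also have "(\<integral>\<^sup>+w. ennreal (exp (\<theta> * X s w)) \<partial>M) = ennreal (exp (s * \<psi> \<theta>))"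
    using exp_moment[OF assms] by (subst nn_integral_eq_integral) auto
  finally show ?thesis by (simp add: exp_add ennreal_mult')
qed

text \<open>Both sides are the integral of \<open>g (x - z)\<close> against a measure on the line, and the two measures
  have the Laplace transform \<open>exp (t * \<psi> \<theta>) / \<psi> \<theta> = 1 / \<psi> \<theta> + (\<integral>s\<in>{0..t}. exp (s * \<psi> \<theta>))\<close>.
  The second measure, a sum, is realised on \<open>\<real> \<times> \<Omega>\<close> with positive reals for the first summand and
  nonpositive reals, as reversed times, for the second.\<close>

lemma scale_function_renewal:
  fixes g :: "real \<Rightarrow> ennreal"
  assumes t: "0 \<le> t" and g [measurable]: "g \<in> borel_measurable borel"
  shows "(\<integral>\<^sup>+w. (\<integral>\<^sup>+z. W z * g (path x t w - z) \<partial>lborel) \<partial>M)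
    = (\<integral>\<^sup>+z. W z * g (x - z) \<partial>lborel) + (\<integral>\<^sup>+s. indicator {0..t} s * (\<integral>\<^sup>+w. g (path x s w) \<partial>M) \<partial>lborel)"
proof -
  \<comment> \<open>The convolution of \<open>W z dz\<close> with the law of \<open>- X t\<close>,
    so that its Laplace transform is the product of the two transforms.\<close>
  define m1 where "m1 = density lborel (\<lambda>z. \<integral>\<^sup>+w. W (z + path 0 t w) \<partial>M)"
  define Psi where "Psi = (\<lambda>(r, w). if 0 < r then r else - path 0 (- r) w)"
  define wt where "wt = (\<lambda>(r, w::'a). if 0 < r then ennreal (W r) else indicator {0..t} (- r))"
  have neg [measurable]: "(\<lambda>z. path y (- fst z) (snd z)) \<in> borel_measurable (borel \<Otimes>\<^sub>M M)" for y
    using measurable_compose[OF _ path_joint_measurable, of "\<lambda>z. (- fst z, snd z)"] by simp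
  have pm [measurable]: "(\<lambda>z. path y (fst z) (snd z)) \<in> borel_measurable (borel \<Otimes>\<^sub>M M)" for y
    using path_joint_measurable[of y] by (simp add: case_prod_beta')
  have [measurable]: "Psi \<in> borel_measurable (lborel \<Otimes>\<^sub>M M)"
    unfolding Psi_def case_prod_beta' by measurable
  have [measurable]: "wt \<in> borel_measurable (lborel \<Otimes>\<^sub>M M)"
    unfolding wt_def case_prod_beta' by measurable
  define m2 where "m2 = distr (density (lborel \<Otimes>\<^sub>M M) wt) borel Psi"
  interpret LM: pair_sigma_finite lborel M ..
  have m1: "(\<integral>\<^sup>+z. f z \<partial>m1) = (\<integral>\<^sup>+w. \<integral>\<^sup>+z. W z * f (z - path 0 t w) \<partial>lborel \<partial>M)"
    if [measurable]: "f \<in> borel_measurable borel" for f :: "real \<Rightarrow> ennreal"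
  proof -
    have "(\<integral>\<^sup>+z. f z \<partial>m1) = (\<integral>\<^sup>+z. (\<integral>\<^sup>+w. W (z + path 0 t w) \<partial>M) * f z \<partial>lborel)"
      unfolding m1_def by (rule nn_integral_density) measurable
    also have "\<dots> = (\<integral>\<^sup>+z. \<integral>\<^sup>+w. W (z + path 0 t w) * f z \<partial>M \<partial>lborel)"
      by (subst nn_integral_multc) auto
    also have "\<dots> = (\<integral>\<^sup>+w. \<integral>\<^sup>+z. W (z + path 0 t w) * f z \<partial>lborel \<partial>M)"
      by (rule LM.Fubini'[symmetric]) measurable
    also have "\<dots> = (\<integral>\<^sup>+w. \<integral>\<^sup>+z. W z * f (z - path 0 t w) \<partial>lborel \<partial>M)"
    proof (rule nn_integral_cong)
      fix w
      show "(\<integral>\<^sup>+z. W (z + path 0 t w) * f z \<partial>lborel) = (\<integral>\<^sup>+z. W z * f (z - path 0 t w) \<partial>lborel)"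
        by (subst nn_integral_real_affine[of _ 1 "- path 0 t w"]) auto
    qed
    finally show ?thesis .
  qed
  have m2: "(\<integral>\<^sup>+z. f z \<partial>m2) = (\<integral>\<^sup>+z. W z * f z \<partial>lborel)
      + (\<integral>\<^sup>+s. indicator {0..t} s * (\<integral>\<^sup>+w. f (- path 0 s w) \<partial>M) \<partial>lborel)"
    if [measurable]: "f \<in> borel_measurable borel" for f :: "real \<Rightarrow> ennreal"
  proof -
    have "(\<integral>\<^sup>+z. f z \<partial>m2) = (\<integral>\<^sup>+z. wt z * f (Psi z) \<partial>(lborel \<Otimes>\<^sub>M M))"
      unfolding m2_def by (subst nn_integral_distr) (auto simp: nn_integral_density)
    also have "\<dots> = (\<integral>\<^sup>+r. \<integral>\<^sup>+w. wt (r, w) * f (Psi (r, w)) \<partial>M \<partial>lborel)"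
      by (rule sigma_finite_measure.nn_integral_fst[OF sigma_finite_measure_axioms, symmetric]) measurable
    also have "\<dots> = (\<integral>\<^sup>+r. W r * f r + indicator {0..t} (- r) * (\<integral>\<^sup>+w. f (- path 0 (- r) w) \<partial>M) \<partial>lborel)"
    proof (rule nn_integral_cong_AE)
      \<comment> \<open>At \<open>r = 0\<close> the left-hand side sees only the reversed time,
        while \<open>W 0\<close> may be positive; the point is discarded as a null set.\<close>
      show "AE r in lborel. (\<integral>\<^sup>+w. wt (r, w) * f (Psi (r, w)) \<partial>M)
          = W r * f r + indicator {0..t} (- r) * (\<integral>\<^sup>+w. f (- path 0 (- r) w) \<partial>M)"
        using AE_lborel_singleton[of 0]
      proof eventually_elim
        case (elim r)
        then consider "0 < r" | "r < 0" by linarith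
        then show ?case
        proof cases
          case 1 then show ?thesis by (simp add: wt_def Psi_def emeasure_space_1)
        next
          case 2 then show ?thesis by (simp add: wt_def Psi_def W_neg nn_integral_cmult)
        qed
      qed
    qed
    also have "\<dots> = (\<integral>\<^sup>+z. W z * f z \<partial>lborel)
      + (\<integral>\<^sup>+r. indicator {0..t} (- r) * (\<integral>\<^sup>+w. f (- path 0 (- r) w) \<partial>M) \<partial>lborel)"
      by (rule nn_integral_add) measurable
    also have "(\<integral>\<^sup>+r. indicator {0..t} (- r) * (\<integral>\<^sup>+w. f (- path 0 (- r) w) \<partial>M) \<partial>lborel)
      = (\<integral>\<^sup>+s. indicator {0..t} s * (\<integral>\<^sup>+w. f (- path 0 s w) \<partial>M) \<partial>lborel)"
      by (subst nn_integral_real_affine[of _ "-1" 0]) auto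
    finally show ?thesis .
  qed
  have lap1: "(\<integral>\<^sup>+z. ennreal (exp (- \<theta> * z)) \<partial>m1) = ennreal (exp (t * \<psi> \<theta>) / \<psi> \<theta>)" if "\<theta> > rate" for \<theta>
  proof -
    have \<theta>: "0 < \<theta>" "0 < \<psi> \<theta>" using that rate_pos exponent_pos[of \<theta>] by auto
    have "(\<integral>\<^sup>+z. ennreal (exp (- \<theta> * z)) \<partial>m1)
        = (\<integral>\<^sup>+w. \<integral>\<^sup>+z. ennreal (exp (- \<theta> * z) * W z) * ennreal (exp (\<theta> * path 0 t w)) \<partial>lborel \<partial>M)"
      using W_nonneg by (subst m1) (auto intro!: nn_integral_cong simp: ennreal_mult''[symmetric] right_diff_distrib exp_diff exp_minus field_simps)
    also have "\<dots> = (\<integral>\<^sup>+w. ennreal (1 / \<psi> \<theta>) * ennreal (exp (\<theta> * path 0 t w)) \<partial>M)"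
      using W_laplace[of \<theta>] that by (simp add: nn_integral_multc)
    also have "\<dots> = ennreal (1 / \<psi> \<theta>) * ennreal (exp (t * \<psi> \<theta>))"
      using nn_integral_exp_path[of \<theta> t 0] \<theta> t by (simp add: nn_integral_cmult)
    finally show ?thesis using \<theta> by (simp add: ennreal_mult'[symmetric])
  qed
  have lap2: "(\<integral>\<^sup>+z. ennreal (exp (- \<theta> * z)) \<partial>m2) = ennreal (exp (t * \<psi> \<theta>) / \<psi> \<theta>)" if "\<theta> > rate" for \<theta>
  proof -
    have \<theta>: "0 < \<theta>" "0 < \<psi> \<theta>" using that rate_pos exponent_pos[of \<theta>] by auto
    have "(\<integral>\<^sup>+s. indicator {0..t} s * (\<integral>\<^sup>+w. ennreal (exp (- \<theta> * - path 0 s w)) \<partial>M) \<partial>lborel)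
      = (\<integral>\<^sup>+s. indicator {0..t} s * ennreal (exp (s * \<psi> \<theta>)) \<partial>lborel)"
      using nn_integral_exp_path[of \<theta> _ 0] \<theta> by (intro nn_integral_cong) (auto simp: indicator_def)
    moreover have "(\<integral>\<^sup>+z. W z * ennreal (exp (- \<theta> * z)) \<partial>lborel) = ennreal (1 / \<psi> \<theta>)"
      using W_laplace[of \<theta>] that W_nonneg by (simp add: ennreal_mult'[symmetric] mult.commute)
    ultimately have "(\<integral>\<^sup>+z. ennreal (exp (- \<theta> * z)) \<partial>m2) = ennreal (1 / \<psi> \<theta>) + ennreal ((exp (t * \<psi> \<theta>) - 1) / \<psi> \<theta>)"
      using nn_integral_exp_interval[OF \<theta>(2) t] by (subst m2) auto
    also have "\<dots> = ennreal (1 / \<psi> \<theta> + (exp (t * \<psi> \<theta>) - 1) / \<psi> \<theta>)"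
      using \<theta> t by (intro ennreal_plus[symmetric]) auto
    finally show ?thesis using \<theta> by (simp add: diff_divide_distrib)
  qed
  have "m1 = m2"
  proof (rule laplace_uniqueness[where b = rate])
    show "sets m1 = sets borel" "sets m2 = sets borel" by (simp_all add: m1_def m2_def)
  qed (simp_all only: lap1 lap2, auto simp: exponent_pos less_imp_le)
  \<comment> \<open>Tested with \<open>\<lambda>z. g (x - z)\<close>, the point
    \<open>z - X t\<close> contributes \<open>g (x + X t - z)\<close> and the point
    \<open>- X s\<close> contributes \<open>g (x + X s)\<close>.\<close>
  then show ?thesis
    using m1[of "\<lambda>z. g (x - z)"] m2[of "\<lambda>z. g (x - z)"] by (simp add: path_def algebra_simps)
qed

section \<open>Convolutions of the scale function with bounded functions of compact support\<close>

definition conv :: "(real \<Rightarrow> real) \<Rightarrow> real \<Rightarrow> real" where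
  "conv g x = (LINT y|lborel. W (x - y) * g y)"

text \<open>Continuity will come from the convolution with \<open>W\<close>, so functions built from
  a merely measurable killing rate qualify.\<close>

definition test_function :: "(real \<Rightarrow> real) \<Rightarrow> bool" where
  "test_function g \<longleftrightarrow> g \<in> borel_measurable borel \<and>
     (\<exists>B l r. 0 \<le> B \<and> (\<forall>y. \<bar>g y\<bar> \<le> B * indicator {l..r} y))"

lemma test_functionD [measurable_dest]: "test_function g \<Longrightarrow> g \<in> borel_measurable borel"
  by (simp add: test_function_def)

lemma test_function_bounded: assumes "test_function g" shows "\<exists>B. \<forall>y. \<bar>g y\<bar> \<le> B"
proof -
  obtain B l r where B: "0 \<le> B" "\<And>y. \<bar>g y\<bar> \<le> B * indicator {l..r} y"
    using assms by (auto simp: test_function_def)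
  have "\<bar>g y\<bar> \<le> B" for y using B(1) B(2)[of y] by (cases "y \<in> {l..r}") auto
  then show ?thesis by blast
qed

lemma test_function_mono:
  assumes g: "test_function g" and h: "h \<in> borel_measurable borel" "\<And>y. \<bar>h y\<bar> \<le> \<bar>g y\<bar>"
  shows "test_function h"
proof -
  obtain B l r where B: "0 \<le> B" "\<And>y. \<bar>g y\<bar> \<le> B * indicator {l..r} y"
    using g by (auto simp: test_function_def)
  then have "\<forall>y. \<bar>h y\<bar> \<le> B * indicator {l..r} y" using h(2) order_trans by blast
  then show ?thesis using B(1) h(1) unfolding test_function_def by blast
qed

lemma integrable_indicator_Icc: "integrable lborel (\<lambda>y. K * indicator {l..r} y :: real)" for l r :: real
  by (intro integrable_mult_right integrable_real_indicator) (auto simp: emeasure_lborel_Icc_eq)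

lemma conv_integrable:
  assumes g: "test_function g" shows "integrable lborel (\<lambda>y. W (x - y) * g y)"
proof -
  obtain B l r where B: "0 \<le> B" "\<And>y. \<bar>g y\<bar> \<le> B * indicator {l..r} y"
    using g by (auto simp: test_function_def)
  note [measurable] = test_functionD[OF g]
  show ?thesis
  proof (rule Bochner_Integration.integrable_bound)
    show "integrable lborel (\<lambda>y. W (x - l) * B * indicator {l..r} y)" by (rule integrable_indicator_Icc)
    show "AE y in lborel. norm (W (x - y) * g y) \<le> norm (W (x - l) * B * indicator {l..r} y)"
    proof (intro AE_I2)
      fix y
      have "W (x - y) * \<bar>g y\<bar> \<le> W (x - l) * (B * indicator {l..r} y)"
      proof (cases "y \<in> {l..r}")
        case True
        then show ?thesis using B(1) B(2)[of y] monoD[OF W_mono, of "x - y" "x - l"] W_nonneg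
          by (intro mult_mono) auto
      qed (use B(2)[of y] in auto)
      then show "norm (W (x - y) * g y) \<le> norm (W (x - l) * B * indicator {l..r} y)"
        using W_nonneg B(1) by (simp add: abs_mult)
    qed
  qed measurable
qed

lemma conv_cong_below:
  assumes "\<And>y. y \<le> x \<Longrightarrow> g y = h y" shows "conv g x = conv h x"
  unfolding conv_def
proof (rule Bochner_Integration.integral_cong)
  fix y show "W (x - y) * g y = W (x - y) * h y"
    using assms[of y] W_neg[of "x - y"] by (cases "y \<le> x") auto
qed simp

lemma conv_nonneg: "(\<And>y. 0 \<le> g y) \<Longrightarrow> 0 \<le> conv g x"
  unfolding conv_def using W_nonneg by (intro integral_nonneg_AE) auto

lemma conv_add: "test_function g \<Longrightarrow> test_function h \<Longrightarrow> conv (\<lambda>y. g y + h y) x = conv g x + conv h x"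
  unfolding conv_def using conv_integrable by (simp add: distrib_left Bochner_Integration.integral_add)

lemma conv_diff: "test_function g \<Longrightarrow> test_function h \<Longrightarrow> conv (\<lambda>y. g y - h y) x = conv g x - conv h x"
  unfolding conv_def using conv_integrable by (simp add: right_diff_distrib Bochner_Integration.integral_diff)

lemma conv_exp_bound:
  assumes g: "test_function g" shows "\<exists>C\<ge>0. \<forall>x. \<bar>conv g x\<bar> \<le> C * exp (rate * x)"
proof -
  obtain B l r where B: "0 \<le> B" "\<And>y. \<bar>g y\<bar> \<le> B * indicator {l..r} y"
    using g by (auto simp: test_function_def)
  obtain C where C: "0 \<le> C" "\<And>x. W x \<le> C * exp (rate * x)" using W_exp_bound by auto
  \<comment> \<open>The support interval \<open>{l..r}\<close> may be empty; \<open>?r\<close> keeps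
    the length nonnegative.\<close>
  let ?r = "max l r"
  show ?thesis
  proof (intro exI conjI allI)
    show "0 \<le> C * exp (rate * - l) * B * (?r - l)" using B C by simp
    fix x
    have "\<bar>conv g x\<bar> \<le> (LINT y|lborel. (C * exp (rate * (x - l)) * B) * indicator {l..?r} y)"
      unfolding conv_def
    proof (rule order_trans[OF integral_abs_bound], rule integral_mono)
      show "integrable lborel (\<lambda>y. \<bar>W (x - y) * g y\<bar>)" using conv_integrable[OF g] by (rule integrable_abs)
      fix y
      show "\<bar>W (x - y) * g y\<bar> \<le> (C * exp (rate * (x - l)) * B) * indicator {l..?r} y"
      proof (cases "y \<in> {l..r}")
        case True
        have "\<bar>W (x - y) * g y\<bar> \<le> W (x - l) * B"
          using True B(1) B(2)[of y] monoD[OF W_mono, of "x - y" "x - l"] W_nonneg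
          by (auto simp: abs_mult intro!: mult_mono)
        also have "\<dots> \<le> C * exp (rate * (x - l)) * B" using C(2) B(1) by (rule mult_right_mono)
        finally show ?thesis using True by simp
      next
        case False
        then show ?thesis using B(2)[of y] B(1) C(1) by simp
      qed
    qed simp
    also have "\<dots> = C * exp (rate * (x - l)) * B * (?r - l)" by simp
    also have "exp (rate * (x - l)) = exp (rate * - l) * exp (rate * x)"
      by (simp add: right_diff_distrib flip: exp_add)
    also have "C * (exp (rate * - l) * exp (rate * x)) * B * (?r - l) = C * exp (rate * - l) * B * (?r - l) * exp (rate * x)"
      by (simp only: mult_ac)
    finally show "\<bar>conv g x\<bar> \<le> C * exp (rate * - l) * B * (?r - l) * exp (rate * x)" .
  qed
qed

text \<open>For fixed \<open>x\<close> the discontinuity of \<open>W\<close> is met only at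
  \<open>y = x\<close>, a null set; compact support provides the majorant.\<close>

lemma conv_continuous:
  assumes g: "test_function g" shows "isCont (conv g) x"
  unfolding continuous_at_sequentially comp_def conv_def
proof (intro allI impI)
  fix u assume u: "u \<longlonglongrightarrow> x"
  obtain B l r where B: "0 \<le> B" "\<And>y. \<bar>g y\<bar> \<le> B * indicator {l..r} y"
    using g by (auto simp: test_function_def)
  note [measurable] = test_functionD[OF g]
  obtain D where D: "\<And>n. \<bar>u n\<bar> \<le> D"
    using convergent_imp_bounded[OF u] by (auto simp: bounded_iff)
  show "(\<lambda>n. LINT y|lborel. W (u n - y) * g y) \<longlonglongrightarrow> (LINT y|lborel. W (x - y) * g y)"
  proof (rule integral_dominated_convergence[where w="\<lambda>y. W (D - l) * B * indicator {l..r} y"])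
    show "integrable lborel (\<lambda>y. W (D - l) * B * indicator {l..r} y)" by (rule integrable_indicator_Icc)
    show "AE y in lborel. (\<lambda>n. W (u n - y) * g y) \<longlonglongrightarrow> W (x - y) * g y"
      using AE_lborel_singleton[of x]
    proof eventually_elim
      case (elim y)
      have "(\<lambda>n. u n - y) \<longlonglongrightarrow> x - y" using u by (intro tendsto_intros)
      then have "(\<lambda>n. W (u n - y)) \<longlonglongrightarrow> W (x - y)"
        using elim by (intro isCont_tendsto_compose[OF W_isCont]) auto
      then show ?case by (intro tendsto_intros)
    qed
    show "AE y in lborel. norm (W (u n - y) * g y) \<le> W (D - l) * B * indicator {l..r} y" for n
    proof (intro AE_I2)
      fix y
      have "W (u n - y) * \<bar>g y\<bar> \<le> W (D - l) * (B * indicator {l..r} y)"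
      proof (cases "y \<in> {l..r}")
        case True
        then show ?thesis using B(1) B(2)[of y] D[of n] monoD[OF W_mono, of "u n - y" "D - l"] W_nonneg
          by (intro mult_mono) auto
      qed (use B(2)[of y] in auto)
      then show "norm (W (u n - y) * g y) \<le> W (D - l) * B * indicator {l..r} y"
        using W_nonneg B(1) by (simp add: abs_mult)
    qed
  qed auto
qed

lemma conv_measurable [measurable]: "test_function g \<Longrightarrow> conv g \<in> borel_measurable borel"
  using conv_continuous by (intro borel_measurable_continuous_onI) (simp add: continuous_at_imp_continuous_on)

section \<open>Dynkin's formula at fixed times\<close>

lemma exp_path_integrable:
  assumes "0 \<le> \<theta>" shows "integrable M (\<lambda>w. exp (\<theta> * path x t w))"
  using exp_moment(1)[OF assms, of "max 0 t"] by (simp add: path_def distrib_left exp_add)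

lemma growth_path_integrable:
  assumes f [measurable]: "f \<in> borel_measurable borel" and C: "\<And>y. \<bar>f y\<bar> \<le> C * (1 + exp (rate * y))"
  shows "integrable M (\<lambda>w. f (path x t w))"
proof (rule Bochner_Integration.integrable_bound)
  show "integrable M (\<lambda>w. C * (1 + exp (rate * path x t w)))"
    using rate_pos by (intro integrable_mult_right Bochner_Integration.integrable_add exp_path_integrable) auto
  show "AE w in M. norm (f (path x t w)) \<le> norm (C * (1 + exp (rate * path x t w)))"
    using C by (auto intro!: AE_I2 order_trans[OF _ abs_ge_self])
qed measurable

text \<open>An integrated form of \<open>g\<close> being the generator applied to \<open>f\<close>.
  Continuity of \<open>f\<close> serves the passage from grid times to exit times. Growth is allowed
  only towards \<infinity>, where exponential moments of the process control it.\<close>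

definition dynkin_pair :: "(real \<Rightarrow> real) \<Rightarrow> (real \<Rightarrow> real) \<Rightarrow> bool" where
  "dynkin_pair f g \<longleftrightarrow> (\<forall>y. isCont f y) \<and> (\<exists>C\<ge>0. \<forall>y. \<bar>f y\<bar> \<le> C * (1 + exp (rate * y))) \<and>
     g \<in> borel_measurable borel \<and> (\<exists>B. \<forall>y. \<bar>g y\<bar> \<le> B) \<and>
     (\<forall>x t. 0 \<le> t \<longrightarrow> (LINT w|M. f (path x t w))
        = f x + (LINT s|lborel. indicator {0..t} s * (LINT w|M. g (path x s w))))"

lemma bounded_occupation_integrable:
  fixes g :: "real \<Rightarrow> real"
  assumes [measurable]: "g \<in> borel_measurable borel" and B: "\<And>y. \<bar>g y\<bar> \<le> B"
  shows "integrable lborel (\<lambda>s. indicator {0..t} s * (LINT w|M. g (path x s w)))"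
proof (rule Bochner_Integration.integrable_bound)
  show "integrable lborel (\<lambda>s. B * indicator {0..t} s)" by (rule integrable_indicator_Icc)
  have "\<bar>LINT w|M. g (path x s w)\<bar> \<le> B" for s
  proof -
    have i: "integrable M (\<lambda>w. g (path x s w))" using B by (intro integrable_const_bound[of _ B]) auto
    have "\<bar>LINT w|M. g (path x s w)\<bar> \<le> (LINT w|M. \<bar>g (path x s w)\<bar>)" by (rule integral_abs_bound)
    also have "\<dots> \<le> (LINT w|M. B)" using i B by (intro integral_mono) auto
    finally show ?thesis by (simp add: prob_space)
  qed
  note bd = this
  show "AE s in lborel. norm (indicator {0..t} s * (LINT w|M. g (path x s w))) \<le> norm (B * indicator {0..t} s)"
  proof (rule AE_I2)
    fix s
    show "norm (indicator {0..t} s * (LINT w|M. g (path x s w))) \<le> norm (B * indicator {0..t} s)"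
      using bd[of s] by (cases "s \<in> {0..t}") auto
  qed
  have [measurable]: "(\<lambda>(t, w). path x t w) \<in> borel_measurable (lborel \<Otimes>\<^sub>M M)" by measurable
  have "(\<lambda>(s, w). g (path x s w)) \<in> borel_measurable (lborel \<Otimes>\<^sub>M M)"
    using measurable_compose[OF \<open>(\<lambda>(t, w). path x t w) \<in> borel_measurable (lborel \<Otimes>\<^sub>M M)\<close> assms(1)]
    by (simp add: case_prod_beta')
  then show "(\<lambda>s. indicator {0..t} s * (LINT w|M. g (path x s w))) \<in> borel_measurable lborel"
    by measurable
qed

text \<open>For nonnegative \<open>g\<close> all integrals can be read in \<open>ennreal\<close>,
  where the renewal identity holds without integrability conditions; the exponential bounds then
  make them finite.\<close>

lemma conv_renewal_nonneg:
  assumes g: "test_function g" and nn: "\<And>y. 0 \<le> g y" and t: "0 \<le> t"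
  shows "(LINT w|M. conv g (path x t w)) = conv g x + (LINT s|lborel. indicator {0..t} s * (LINT w|M. g (path x s w)))"
proof -
  note [measurable] = test_functionD[OF g]
  obtain B where B: "\<And>y. \<bar>g y\<bar> \<le> B" using test_function_bounded[OF g] by auto
  obtain C where C: "0 \<le> C" "\<And>y. \<bar>conv g y\<bar> \<le> C * exp (rate * y)" using conv_exp_bound[OF g] by auto
  have cnn: "0 \<le> conv g y" for y using nn by (rule conv_nonneg)
  have ci: "integrable M (\<lambda>w. conv g (path x t w))"
    using C by (intro growth_path_integrable[of _ C] order_trans[OF C(2)]) (auto simp: g algebra_simps)
  have conv_nn: "(\<integral>\<^sup>+z. W z * ennreal (g (y - z)) \<partial>lborel) = ennreal (conv g y)" for y
  proof -
    have "(\<integral>\<^sup>+z. W z * ennreal (g (y - z)) \<partial>lborel) = (\<integral>\<^sup>+z. W (y - z) * ennreal (g z) \<partial>lborel)"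
      by (subst nn_integral_real_affine[of _ "-1" y]) auto
    also have "\<dots> = (\<integral>\<^sup>+z. ennreal (W (y - z) * g z) \<partial>lborel)"
      using W_nonneg by (simp add: ennreal_mult' nn)
    also have "\<dots> = ennreal (conv g y)"
      unfolding conv_def using conv_integrable[OF g] nn W_nonneg by (intro nn_integral_eq_integral) auto
    finally show ?thesis .
  qed
  have gi: "integrable M (\<lambda>w. g (path x s w))" for s
    using B by (intro integrable_const_bound[of _ B]) auto
  have occ: "(\<integral>\<^sup>+s. indicator {0..t} s * (\<integral>\<^sup>+w. ennreal (g (path x s w)) \<partial>M) \<partial>lborel)
    = ennreal (LINT s|lborel. indicator {0..t} s * (LINT w|M. g (path x s w)))"
  proof -
    have "(\<integral>\<^sup>+s. indicator {0..t} s * (\<integral>\<^sup>+w. ennreal (g (path x s w)) \<partial>M) \<partial>lborel)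
      = (\<integral>\<^sup>+s. ennreal (indicator {0..t} s * (LINT w|M. g (path x s w))) \<partial>lborel)"
      using gi nn by (intro nn_integral_cong) (auto simp: nn_integral_eq_integral indicator_def)
    also have "\<dots> = ennreal (LINT s|lborel. indicator {0..t} s * (LINT w|M. g (path x s w)))"
      using B nn by (intro nn_integral_eq_integral bounded_occupation_integrable[of _ B] AE_I2 mult_nonneg_nonneg integral_nonneg_AE) auto
    finally show ?thesis .
  qed
  have occ0: "0 \<le> (LINT s|lborel. indicator {0..t} s * (LINT w|M. g (path x s w)))"
    using nn by (intro integral_nonneg_AE AE_I2 mult_nonneg_nonneg) auto
  have "ennreal (LINT w|M. conv g (path x t w)) = (\<integral>\<^sup>+w. ennreal (conv g (path x t w)) \<partial>M)"
    using ci cnn by (intro nn_integral_eq_integral[symmetric]) auto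
  also have "\<dots> = ennreal (conv g x) + ennreal (LINT s|lborel. indicator {0..t} s * (LINT w|M. g (path x s w)))"
    using scale_function_renewal[OF t, of "\<lambda>y. ennreal (g y)" x] by (simp add: conv_nn occ)
  also have "\<dots> = ennreal (conv g x + (LINT s|lborel. indicator {0..t} s * (LINT w|M. g (path x s w))))"
    using cnn occ0 by (intro ennreal_plus[symmetric]) auto
  finally show ?thesis
    using cnn occ0 by (subst (asm) ennreal_inj) (auto intro!: add_nonneg_nonneg integral_nonneg_AE AE_I2)
qed

text \<open>Splitting \<open>g\<close> into positive and negative parts reduces to the nonnegative
  case. Constants have generator value 0, hence the free summand \<open>k\<close>: it will be 1 for
  \<open>Zo\<close> and 0 for the approximations of \<open>Wo\<close>.\<close>

lemma dynkin_pair_conv: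
  assumes g: "test_function g"
  shows "dynkin_pair (\<lambda>y. k + conv g y) g"
  unfolding dynkin_pair_def
proof (intro conjI allI impI)
  note [measurable] = test_functionD[OF g]
  show "isCont (\<lambda>y. k + conv g y) y" for y using conv_continuous[OF g] by (intro continuous_intros)
  obtain C where C: "0 \<le> C" "\<And>y. \<bar>conv g y\<bar> \<le> C * exp (rate * y)" using conv_exp_bound[OF g] by auto
  show "\<exists>C\<ge>0. \<forall>y. \<bar>k + conv g y\<bar> \<le> C * (1 + exp (rate * y))"
  proof (intro exI[of _ "\<bar>k\<bar> + C"] conjI allI)
    fix y
    have "\<bar>k + conv g y\<bar> \<le> \<bar>k\<bar> + C * exp (rate * y)" using C(2)[of y] by linarith
    also have "\<dots> \<le> (\<bar>k\<bar> + C) * (1 + exp (rate * y))" using C(1) by (simp add: algebra_simps)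
    finally show "\<bar>k + conv g y\<bar> \<le> (\<bar>k\<bar> + C) * (1 + exp (rate * y))" .
  qed (use C in auto)
  show "g \<in> borel_measurable borel" by measurable
  show "\<exists>B. \<forall>y. \<bar>g y\<bar> \<le> B" using test_function_bounded[OF g] .
  then obtain B where B: "\<And>y. \<bar>g y\<bar> \<le> B" by auto
  fix x t :: real assume t: "0 \<le> t"
  define gp where "gp y = max (g y) 0" for y
  define gm where "gm y = max (- g y) 0" for y
  have tp: "test_function gp" and tm: "test_function gm"
    unfolding gp_def[abs_def] gm_def[abs_def] by (auto intro!: test_function_mono[OF g])
  note [measurable] = test_functionD[OF tp] test_functionD[OF tm]
  have geq: "g = (\<lambda>y. gp y - gm y)" by (auto simp: gp_def gm_def)
  have bp: "\<bar>gp y\<bar> \<le> \<bar>B\<bar>" and bm: "\<bar>gm y\<bar> \<le> \<bar>B\<bar>" for y using B[of y] by (auto simp: gp_def gm_def)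
  have ci: "integrable M (\<lambda>w. conv h (path x t w))" if h: "test_function h" for h
  proof -
    obtain C where C: "0 \<le> C" "\<And>y. \<bar>conv h y\<bar> \<le> C * exp (rate * y)" using conv_exp_bound[OF h] by auto
    show ?thesis
      using C by (intro growth_path_integrable[of _ C] order_trans[OF C(2)]) (auto simp: h algebra_simps)
  qed
  have gi: "integrable M (\<lambda>w. gp (path x s w))" "integrable M (\<lambda>w. gm (path x s w))" for s
    using bp bm by (auto intro!: integrable_const_bound[of _ "\<bar>B\<bar>"])
  have "(LINT w|M. conv g (path x t w)) = (LINT w|M. conv gp (path x t w)) - (LINT w|M. conv gm (path x t w))"
    unfolding geq conv_diff[OF tp tm] using ci[OF tp] ci[OF tm] by simp
  also have "\<dots> = conv gp x - conv gm x +
      ((LINT s|lborel. indicator {0..t} s * (LINT w|M. gp (path x s w))) - (LINT s|lborel. indicator {0..t} s * (LINT w|M. gm (path x s w))))"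
    using conv_renewal_nonneg[OF tp _ t] conv_renewal_nonneg[OF tm _ t] by (simp add: gp_def gm_def)
  also have "conv gp x - conv gm x = conv g x" unfolding geq conv_diff[OF tp tm] ..
  also have "(LINT s|lborel. indicator {0..t} s * (LINT w|M. gp (path x s w))) - (LINT s|lborel. indicator {0..t} s * (LINT w|M. gm (path x s w)))
    = (LINT s|lborel. indicator {0..t} s * (LINT w|M. g (path x s w)))"
    unfolding geq using bounded_occupation_integrable[of gp "\<bar>B\<bar>"] bounded_occupation_integrable[of gm "\<bar>B\<bar>"] gi bp bm
    by (subst Bochner_Integration.integral_diff[symmetric]) (simp_all add: right_diff_distrib)
  finally have "(LINT w|M. conv g (path x t w)) = conv g x + (LINT s|lborel. indicator {0..t} s * (LINT w|M. g (path x s w)))" .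
  then show "(LINT w|M. k + conv g (path x t w)) = k + conv g x + (LINT s|lborel. indicator {0..t} s * (LINT w|M. g (path x s w)))"
    using ci[OF g] by (simp add: prob_space)
qed

subsection \<open>Optional stopping at exit times\<close>

definition killing_rate :: "real \<Rightarrow> (real \<Rightarrow> real) \<Rightarrow> bool" where
  "killing_rate B k \<longleftrightarrow> k \<in> borel_measurable borel \<and> (\<forall>y. 0 \<le> k y \<and> k y \<le> B)"

definition clock :: "(real \<Rightarrow> real) \<Rightarrow> real \<Rightarrow> real \<Rightarrow> 'a \<Rightarrow> real" where
  "clock k x t w = (LINT s|lborel. indicator {0..t} s * k (path x s w))"

lemma killing_rateD:
  assumes "killing_rate B k"
  shows "k \<in> borel_measurable borel" "0 \<le> k y" "k y \<le> B" "0 \<le> B"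
  using assms by (auto simp: killing_rate_def intro: order_trans[of 0 "k 0" B])

lemma path_time_measurable: "w \<in> space M \<Longrightarrow> (\<lambda>s. path x s w) \<in> borel_measurable borel"
  using measurable_compose[OF measurable_Pair2'[of w M borel] path_joint_measurable] by simp

lemma path_joint_measurable' [measurable]:
  "(\<lambda>z. path x (fst z) (snd z)) \<in> borel_measurable (borel \<Otimes>\<^sub>M M)"
  using path_joint_measurable[of x] by (simp add: case_prod_beta')

lemma rate_along_path_integrable:
  assumes k: "killing_rate B k" and w: "w \<in> space M" and S: "S \<in> sets borel" "S \<subseteq> {a..b}"
  shows "integrable lborel (\<lambda>s. indicator S s * k (path x s w))"
proof (rule Bochner_Integration.integrable_bound)
  show "integrable lborel (\<lambda>s. B * indicator {a..b} s)" by (rule integrable_indicator_Icc)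
  note [measurable] = killing_rateD(1)[OF k] path_time_measurable[OF w] S(1)
  show "(\<lambda>s. indicator S s * k (path x s w)) \<in> borel_measurable lborel" by measurable
  show "AE s in lborel. norm (indicator S s * k (path x s w)) \<le> norm (B * indicator {a..b} s)"
    using killing_rateD(2-4)[OF k] S(2) by (auto intro!: AE_I2 simp: indicator_def)
qed

lemma clock_diff:
  assumes k: "killing_rate B k" and w: "w \<in> space M" and st: "0 \<le> s" "s \<le> t"
  shows "clock k x t w - clock k x s w = (LINT r|lborel. indicator {s..<t} r * k (path x r w))"
proof -
  note i = rate_along_path_integrable[OF k w]
  note [measurable] = killing_rateD(1)[OF k] path_time_measurable[OF w]
  have "clock k x t w - clock k x s w
      = (LINT r|lborel. indicator {0..t} r * k (path x r w) - indicator {0..s} r * k (path x r w))"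
    unfolding clock_def by (intro Bochner_Integration.integral_diff[symmetric] i) auto
  also have "\<dots> = (LINT r|lborel. indicator {s..<t} r * k (path x r w))"
  proof (rule integral_cong_AE)
    show "AE r in lborel. indicator {0..t} r * k (path x r w) - indicator {0..s} r * k (path x r w) = indicator {s..<t} r * k (path x r w)"
      using AE_lborel_singleton[of s] AE_lborel_singleton[of t]
    proof eventually_elim
      case (elim r)
      then show ?case using st by (cases "r < s"; cases "r < t") (auto simp: indicator_def)
    qed
  qed measurable
  finally show ?thesis .
qed

lemma clock_increment:
  assumes k: "killing_rate B k" and w: "w \<in> space M" and st: "0 \<le> s" "s \<le> t"
  shows "clock k x s w \<le> clock k x t w" "clock k x t w - clock k x s w \<le> B * (t - s)"
proof -
  note i = rate_along_path_integrable[OF k w]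
  show "clock k x s w \<le> clock k x t w"
  proof -
    have "0 \<le> (LINT r|lborel. indicator {s..<t} r * k (path x r w))"
      using killing_rateD(2)[OF k] by (intro integral_nonneg_AE AE_I2) simp
    then show ?thesis using clock_diff[OF k w st, of x] by simp
  qed
  have "(LINT r|lborel. indicator {s..<t} r * k (path x r w)) \<le> (LINT r|lborel. B * indicator {s..t} r)"
    using killing_rateD(3,4)[OF k] by (intro integral_mono i[of _ s t] integrable_indicator_Icc) (auto simp: indicator_def)
  then show "clock k x t w - clock k x s w \<le> B * (t - s)"
    using clock_diff[OF k w st, of x] st by simp
qed

lemma clock_0 [simp]: "clock k x 0 w = 0"
proof -
  have "AE s in lborel. indicator {0..0} s * k (path x s w) = 0"
    using AE_lborel_singleton[of 0] by eventually_elim simp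
  then show ?thesis unfolding clock_def by (rule integral_eq_zero_AE)
qed

lemma clock_nonneg: "killing_rate B k \<Longrightarrow> w \<in> space M \<Longrightarrow> 0 \<le> clock k x t w"
  unfolding clock_def using killing_rateD(2) by (intro integral_nonneg_AE AE_I2 mult_nonneg_nonneg) auto

lemma clock_Lipschitz:
  assumes k: "killing_rate B k" and w: "w \<in> space M" and "0 \<le> s" "0 \<le> t"
  shows "\<bar>clock k x t w - clock k x s w\<bar> \<le> B * \<bar>t - s\<bar>"
  using clock_increment[OF k w, of s t x] clock_increment[OF k w, of t s x] assms(3,4)
  by (cases "s \<le> t") auto

lemma clock_tendsto:
  assumes k: "killing_rate B k" and w: "w \<in> space M" and t: "\<And>n. 0 \<le> t n" "t \<longlonglongrightarrow> s"
  shows "(\<lambda>n. clock k x (t n) w) \<longlonglongrightarrow> clock k x s w"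
proof -
  have s: "0 \<le> s" using LIMSEQ_le_const[OF t(2)] t(1) by auto
  have "(\<lambda>n. B * \<bar>t n - s\<bar>) \<longlonglongrightarrow> B * \<bar>s - s\<bar>" by (intro tendsto_intros t)
  then have lim: "(\<lambda>n. B * \<bar>t n - s\<bar>) \<longlonglongrightarrow> 0" by simp
  have "\<forall>n. norm (clock k x (t n) w - clock k x s w) \<le> B * \<bar>t n - s\<bar>"
    unfolding real_norm_def by (intro allI clock_Lipschitz[OF k w s] t(1))
  then have "(\<lambda>n. clock k x (t n) w - clock k x s w) \<longlonglongrightarrow> 0"
    by (intro Lim_null_comparison[OF _ lim] always_eventually)
  then show ?thesis by (simp add: LIM_zero_iff)
qed

lemma clock_past_measurable:
  assumes k: "killing_rate B k" and t: "0 \<le> t"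
  shows "clock k x t \<in> borel_measurable (past t)"
proof -
  note [measurable] = killing_rateD(1)[OF k]
  have [measurable]: "(\<lambda>z. path x (min t (fst z)) (snd z)) \<in> borel_measurable (borel \<Otimes>\<^sub>M past t)"
    using path_past_joint_measurable[OF t, of x] by (simp add: case_prod_beta')
  have [measurable]: "(\<lambda>z. path x (min t (snd z)) (fst z)) \<in> borel_measurable (past t \<Otimes>\<^sub>M lborel)"
    using measurable_compose[OF _ \<open>(\<lambda>z. path x (min t (fst z)) (snd z)) \<in> borel_measurable (borel \<Otimes>\<^sub>M past t)\<close>, of "\<lambda>z. (snd z, fst z)"]
    by simp
  have "clock k x t = (\<lambda>w. LINT s|lborel. indicator {0..t} s * k (path x (min t s) w))"
    unfolding clock_def[abs_def] by (intro ext Bochner_Integration.integral_cong) (auto simp: indicator_def)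
  also have "\<dots> \<in> borel_measurable (past t)"
    by (rule lborel.borel_measurable_lebesgue_integral) (simp add: case_prod_beta')
  finally show ?thesis .
qed

lemma clock_measurable: "killing_rate B k \<Longrightarrow> 0 \<le> t \<Longrightarrow> clock k x t \<in> borel_measurable M"
  by (rule past_measurable[OF clock_past_measurable])

lemma clock_joint_measurable:
  assumes k: "killing_rate B k"
  shows "(\<lambda>z. clock k x (fst z) (snd z)) \<in> borel_measurable (borel \<Otimes>\<^sub>M M)"
proof -
  note [measurable] = killing_rateD(1)[OF k]
  have [measurable]: "(\<lambda>z. path x (snd z) (snd (fst z))) \<in> borel_measurable ((borel \<Otimes>\<^sub>M M) \<Otimes>\<^sub>M lborel)"
    using measurable_compose[OF _ path_joint_measurable'[of x], of "\<lambda>z. (snd z, snd (fst z))" "(borel \<Otimes>\<^sub>M M) \<Otimes>\<^sub>M lborel"]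
    by simp
  show ?thesis
    unfolding clock_def
  proof (rule lborel.borel_measurable_lebesgue_integral)
    have "(\<lambda>z. if 0 \<le> snd z \<and> snd z \<le> fst (fst z) then k (path x (snd z) (snd (fst z))) else 0)
        \<in> borel_measurable ((borel \<Otimes>\<^sub>M M) \<Otimes>\<^sub>M lborel)"
      using measurable_compose[OF \<open>(\<lambda>z. path x (snd z) (snd (fst z))) \<in> borel_measurable ((borel \<Otimes>\<^sub>M M) \<Otimes>\<^sub>M lborel)\<close> killing_rateD(1)[OF k]]
      by measurable
    moreover have "(if 0 \<le> snd z \<and> snd z \<le> fst (fst z) then k (path x (snd z) (snd (fst z))) else 0)
        = indicator {0..fst (fst z)} (snd z) * k (path x (snd z) (snd (fst z)))" for z :: "(real \<times> 'a) \<times> real"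
      by (simp add: indicator_def)
    ultimately show "(\<lambda>(z, s). indicator {0..fst z} s * k (path x s (snd z))) \<in> borel_measurable ((borel \<Otimes>\<^sub>M M) \<Otimes>\<^sub>M lborel)"
      by (simp add: case_prod_beta')
  qed
qed

text \<open>Time integral and expectation in a single finite measure, so that the convergence
  theorem for bounded second moments applies to the drift term as it does to the boundary term. The
  half-open time interval is tiled exactly by half-open grid cells.\<close>

definition timespace :: "real \<Rightarrow> (real \<times> 'a) measure" where
  "timespace T = density lborel (indicator {0..<T}) \<Otimes>\<^sub>M M"

lemma sets_timespace [measurable_cong]: "sets (timespace T) = sets (borel \<Otimes>\<^sub>M M)"
  unfolding timespace_def by (intro sets_pair_measure_cong) auto

lemma finite_time: "finite_measure (density lborel (indicator {0..<T::real}))"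
proof (rule finite_measureI)
  have "{0..<T} \<subseteq> {0..T}" by auto
  then have "bounded {0..<T}" by (rule bounded_subset[OF bounded_closed_interval])
  then show "emeasure (density lborel (indicator {0..<T})) (space (density lborel (indicator {0..<T}))) \<noteq> \<infinity>"
    using emeasure_bounded_finite[of "{0..<T}"] by (simp add: emeasure_density less_top)
qed

lemma timespace_finite: "finite_measure (timespace T)"
  unfolding timespace_def using finite_measure_axioms finite_time by (rule finite_measure_pair_measure)

lemma nn_integral_timespace:
  assumes [measurable]: "f \<in> borel_measurable (borel \<Otimes>\<^sub>M M)"
  shows "(\<integral>\<^sup>+z. f z \<partial>timespace T) = (\<integral>\<^sup>+s. indicator {0..<T} s * (\<integral>\<^sup>+w. f (s, w) \<partial>M) \<partial>lborel)"
proof -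
  have "(\<integral>\<^sup>+z. f z \<partial>timespace T) = (\<integral>\<^sup>+s. (\<integral>\<^sup>+w. f (s, w) \<partial>M) \<partial>density lborel (indicator {0..<T}))"
    unfolding timespace_def
    by (rule sigma_finite_measure.nn_integral_fst[OF sigma_finite_measure_axioms, symmetric]) measurable
  also have "\<dots> = (\<integral>\<^sup>+s. indicator {0..<T} s * (\<integral>\<^sup>+w. f (s, w) \<partial>M) \<partial>lborel)"
    by (rule nn_integral_density) measurable
  finally show ?thesis .
qed

lemma integral_timespace:
  fixes f :: "real \<times> 'a \<Rightarrow> real"
  assumes f: "integrable (timespace T) f"
  shows "(LINT z|timespace T. f z) = (LINT s|lborel. indicator {0..<T} s * (LINT w|M. f (s, w)))"
    and "(LINT z|timespace T. f z) = (LINT w|M. LINT s|lborel. indicator {0..<T} s * f (s, w))"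
    and "integrable M (\<lambda>w. LINT s|lborel. indicator {0..<T} s * f (s, w))"
proof -
  interpret D: finite_measure "density lborel (indicator {0..<T::real})" by (rule finite_time)
  interpret P: pair_sigma_finite "density lborel (indicator {0..<T::real})" M ..
  have [measurable]: "f \<in> borel_measurable (borel \<Otimes>\<^sub>M M)"
    using borel_measurable_integrable[OF f] by simp
  have f': "integrable (density lborel (indicator {0..<T::real}) \<Otimes>\<^sub>M M) f" using f by (simp add: timespace_def)
  have dens: "(LINT s|density lborel (indicator {0..<T::real}). h s) = (LINT s|lborel. indicator {0..<T} s * h s)"
    if [measurable]: "h \<in> borel_measurable borel" for h :: "real \<Rightarrow> real"
    using integral_density[of h lborel "indicator {0..<T}"] by (simp add: ennreal_indicator)
  show "(LINT z|timespace T. f z) = (LINT s|lborel. indicator {0..<T} s * (LINT w|M. f (s, w)))"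
    using P.integral_fst'[OF f'] by (subst (asm) dens) (simp_all add: timespace_def)
  have f2: "integrable (M \<Otimes>\<^sub>M density lborel (indicator {0..<T::real})) (\<lambda>(y, x). f (x, y))"
    using P.integrable_product_swap[OF f'] .
  have eq: "(LINT w|M. LINT s|density lborel (indicator {0..<T::real}). f (s, w)) = (LINT w|M. LINT s|lborel. indicator {0..<T} s * f (s, w))"
    by (intro Bochner_Integration.integral_cong refl dens) (auto intro!: measurable_compose[OF measurable_Pair2'])
  show "(LINT z|timespace T. f z) = (LINT w|M. LINT s|lborel. indicator {0..<T} s * f (s, w))"
    using P.integral_snd[of "\<lambda>x y. f (x, y)"] f' eq by (simp add: timespace_def)
  have "integrable M (\<lambda>w. LINT s|density lborel (indicator {0..<T::real}). f (s, w))"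
    using P.integrable_snd[of "\<lambda>x y. f (x, y)"] f' by simp
  also have "integrable M (\<lambda>w. LINT s|density lborel (indicator {0..<T::real}). f (s, w))
      \<longleftrightarrow> integrable M (\<lambda>w. LINT s|lborel. indicator {0..<T} s * f (s, w))"
    by (intro Bochner_Integration.integrable_cong refl dens) (auto intro!: measurable_compose[OF measurable_Pair2'])
  finally show "integrable M (\<lambda>w. LINT s|lborel. indicator {0..<T} s * f (s, w))" .
qed

text \<open>The Markov property is used in both directions: at time \<open>s\<close> to restart
  Dynkin's formula from \<open>path x s\<close>, and then for every intermediate time to return from
  the restarted process to the original one.\<close>

lemma dynkin_step:
  fixes Z :: "'a \<Rightarrow> real"
  assumes fg: "dynkin_pair f g" and s: "0 \<le> s" and h: "0 \<le> h" and T: "s + h \<le> T"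
    and Z: "Z \<in> borel_measurable (past s)" "\<And>w. \<bar>Z w\<bar> \<le> 1"
  shows "(LINT w|M. Z w * (f (path x (s + h) w) - f (path x s w)))
    = (LINT z|timespace T. indicator {s..<s + h} (fst z) * (Z (snd z) * g (path x (fst z) (snd z))))"
proof -
  obtain C where C: "\<And>y. \<bar>f y\<bar> \<le> C * (1 + exp (rate * y))" and cf: "\<And>y. isCont f y"
    and g [measurable]: "g \<in> borel_measurable borel"
    and fg_eq: "\<And>x t. 0 \<le> t \<Longrightarrow> (LINT w|M. f (path x t w))
        = f x + (LINT s|lborel. indicator {0..t} s * (LINT w|M. g (path x s w)))"
    using fg by (auto simp: dynkin_pair_def)
  obtain B where B: "\<And>y. \<bar>g y\<bar> \<le> B" using fg by (auto simp: dynkin_pair_def)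
  have [measurable]: "f \<in> borel_measurable borel"
    using cf by (intro borel_measurable_continuous_onI) (simp add: continuous_at_imp_continuous_on)
  have Zm [measurable]: "Z \<in> borel_measurable M" by (rule past_measurable[OF Z(1)])
  have Zf: "integrable M (\<lambda>w. Z w * f (path x t w))" for t
    by (rule Bochner_Integration.integrable_bound[OF growth_path_integrable[of f C x t]])
      (use C Z(2) in \<open>auto simp: abs_mult mult_left_le_one_le\<close>)
  have Zg: "\<bar>Z w * g y\<bar> \<le> B" for w y
    using mult_mono[OF Z(2)[of w] B[of y]] by (simp add: abs_mult)
  have Zgi: "integrable M (\<lambda>w. Z w * g (path x t w))" for t
    using Zg by (intro integrable_const_bound[of _ B]) auto
  have Pg: "\<bar>LINT v|M. g (path y r v)\<bar> \<le> B" for y r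
  proof -
    have i: "integrable M (\<lambda>w. g (path y r w))" using B by (intro integrable_const_bound[of _ B]) auto
    have "\<bar>LINT w|M. g (path y r w)\<bar> \<le> (LINT w|M. \<bar>g (path y r w)\<bar>)" by (rule integral_abs_bound)
    also have "\<dots> \<le> (LINT w|M. B)" using i B by (intro integral_mono) auto
    finally show ?thesis by (simp add: prob_space)
  qed
  have [measurable]: "(\<lambda>z. LINT v|M. g (path (snd z) (fst z) v)) \<in> borel_measurable (borel \<Otimes>\<^sub>M borel)"
  proof (rule borel_measurable_lebesgue_integral)
    have *: "(\<lambda>z. path 0 (fst (fst z)) (snd z)) \<in> borel_measurable ((borel \<Otimes>\<^sub>M borel) \<Otimes>\<^sub>M M)"
      using measurable_compose[OF _ path_joint_measurable'[of 0], of "\<lambda>z. (fst (fst z), snd z)" "(borel \<Otimes>\<^sub>M borel) \<Otimes>\<^sub>M M"]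
      by simp
    have "(\<lambda>z. g (snd (fst z) + path 0 (fst (fst z)) (snd z))) \<in> borel_measurable ((borel \<Otimes>\<^sub>M borel) \<Otimes>\<^sub>M M)"
      using * by measurable
    then show "(\<lambda>(z, v). g (path (snd z) (fst z) v)) \<in> borel_measurable ((borel \<Otimes>\<^sub>M borel) \<Otimes>\<^sub>M M)"
      by (simp add: path_def case_prod_beta')
  qed
  let ?G = "\<lambda>r w. Z w * (LINT v|M. g (path (path x s w) r v))"
  have Gm: "(\<lambda>z. ?G (fst z) (snd z)) \<in> borel_measurable (borel \<Otimes>\<^sub>M M)"
    using measurable_compose[OF _ \<open>(\<lambda>z. LINT v|M. g (path (snd z) (fst z) v)) \<in> borel_measurable (borel \<Otimes>\<^sub>M borel)\<close>,
        of "\<lambda>z. (fst z, path x s (snd z))" "borel \<Otimes>\<^sub>M M"] by simp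
  have mk: "(LINT w|M. ?G r w) = (LINT w|M. Z w * g (path x (s + r) w))" if "0 \<le> r" for r
    using markov[OF s that Z(1) g Zgi] that by (simp add: path_def)
  have Gbd: "\<bar>?G r w\<bar> \<le> B" for r w
    using mult_mono[OF Z(2)[of w] Pg[of "path x s w" r]] by (simp add: abs_mult)
  \<comment> \<open>The horizon \<open>h + 1\<close> is there to contain the closed interval
    \<open>{0..h}\<close> in a half-open one.\<close>
  interpret TH: finite_measure "timespace (h + 1)" by (rule timespace_finite)
  have Gi: "integrable (timespace (h + 1)) (\<lambda>z. indicator {0..h} (fst z) * ?G (fst z) (snd z))"
  proof (rule TH.integrable_const_bound[of _ B])
    show "AE z in timespace (h + 1). norm (indicator {0..h} (fst z) * ?G (fst z) (snd z)) \<le> B"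
      using Gbd order_trans[OF abs_ge_zero Gbd] by (auto simp: indicator_def)
    show "(\<lambda>z. indicator {0..h} (fst z) * ?G (fst z) (snd z)) \<in> borel_measurable (timespace (h + 1))"
      using Gm by measurable
  qed
  have ind: "indicator {0..<h + 1} r * (indicator {0..h} r * a) = indicator {0..h} r * (a::real)" for r a
    by (auto simp: indicator_def)
  interpret TT: finite_measure "timespace T" by (rule timespace_finite)
  have Ti: "integrable (timespace T) (\<lambda>z. indicator {s..<s + h} (fst z) * (Z (snd z) * g (path x (fst z) (snd z))))"
    by (rule TT.integrable_const_bound[of _ B])
      (use Zg order_trans[OF abs_ge_zero Zg] in \<open>auto simp: indicator_def\<close>)
  have "(LINT w|M. Z w * f (path x (s + h) w)) = (LINT w|M. Z w * (LINT v|M. f (path (path x s w) h v)))"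
    using markov[OF s h Z(1) _ Zf] h by (simp add: path_def)
  also have "\<dots> = (LINT w|M. Z w * f (path x s w) + (LINT r|lborel. indicator {0..h} r * ?G r w))"
  proof (rule Bochner_Integration.integral_cong[OF refl])
    fix w
    have "Z w * (LINT r|lborel. indicator {0..h} r * (LINT v|M. g (path (path x s w) r v))) = (LINT r|lborel. indicator {0..h} r * ?G r w)"
      by (subst integral_mult_right_zero[symmetric]) (simp only: mult.left_commute)
    then show "Z w * (LINT v|M. f (path (path x s w) h v)) = Z w * f (path x s w) + (LINT r|lborel. indicator {0..h} r * ?G r w)"
      unfolding fg_eq[OF h] by (simp only: distrib_left)
  qed
  also have "\<dots> = (LINT w|M. Z w * f (path x s w)) + (LINT w|M. LINT r|lborel. indicator {0..h} r * ?G r w)"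
    using integral_timespace(3)[OF Gi] by (intro Bochner_Integration.integral_add Zf) (simp add: ind)
  also have "(LINT w|M. LINT r|lborel. indicator {0..h} r * ?G r w) = (LINT r|lborel. indicator {0..h} r * (LINT w|M. ?G r w))"
    using integral_timespace(1,2)[OF Gi] by (simp add: ind)
  also have "\<dots> = (LINT r|lborel. indicator {0..h} r * (LINT w|M. Z w * g (path x (s + r) w)))"
    using mk by (intro Bochner_Integration.integral_cong) (auto simp: indicator_def)
  also have "\<dots> = (LINT r|lborel. indicator {s..s + h} r * (LINT w|M. Z w * g (path x r w)))"
  proof -
    have "indicator {s..s + h} (s + r) = (indicator {0..h} r :: real)" for r
      by (auto simp: indicator_def)
    then show ?thesis
      using lborel_integral_real_affine[of 1 "\<lambda>r. indicator {s..s + h} r * (LINT w|M. Z w * g (path x r w))" s] by simp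
  qed
  also have "\<dots> = (LINT r|lborel. indicator {0..<T} r * (LINT w|M. indicator {s..<s + h} r * (Z w * g (path x r w))))"
  proof (rule integral_cong_AE)
    show "AE r in lborel. indicator {s..s + h} r * (LINT w|M. Z w * g (path x r w))
        = indicator {0..<T} r * (LINT w|M. indicator {s..<s + h} r * (Z w * g (path x r w)))"
      using AE_lborel_singleton[of "s + h"]
      by eventually_elim (use s h T in \<open>auto simp: indicator_def\<close>)
    have *: "(\<lambda>z. Z (snd z) * g (path x (fst z) (snd z))) \<in> borel_measurable (lborel \<Otimes>\<^sub>M M)" by measurable
    have [measurable]: "(\<lambda>r. LINT w|M. Z w * g (path x r w)) \<in> borel_measurable lborel"
      by (rule borel_measurable_lebesgue_integral) (use * in \<open>simp add: case_prod_beta'\<close>)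
    show "(\<lambda>r. indicator {s..s + h} r * (LINT w|M. Z w * g (path x r w))) \<in> borel_measurable lborel"
      by measurable
    show "(\<lambda>r. indicator {0..<T} r * (LINT w|M. indicator {s..<s + h} r * (Z w * g (path x r w)))) \<in> borel_measurable lborel"
      by simp
  qed
  also have "\<dots> = (LINT z|timespace T. indicator {s..<s + h} (fst z) * (Z (snd z) * g (path x (fst z) (snd z))))"
    using integral_timespace(1)[OF Ti] by simp
  finally show ?thesis using Zf by (simp add: right_diff_distrib)
qed

end

section \<open>Stopping on a time grid\<close>

text \<open>Time 0 is not inspected, in accordance with first passage times that range over
  \<open>t > 0\<close>: the starting point may lie outside \<open>{a..c}\<close>. The cap
  \<open>K\<close> keeps the index bounded even if the path never leaves.\<close>

definition step_index :: "real \<Rightarrow> real \<Rightarrow> real \<Rightarrow> nat \<Rightarrow> (real \<Rightarrow> real) \<Rightarrow> nat" where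
  "step_index a c h K p = (LEAST j. (1 \<le> j \<and> p (real j * h) \<notin> {a..c}) \<or> K \<le> j)"

lemma step_index_le: "step_index a c h K p \<le> K"
  unfolding step_index_def by (rule Least_le) simp

lemma step_index_cases:
  "(1 \<le> step_index a c h K p \<and> p (real (step_index a c h K p) * h) \<notin> {a..c}) \<or> step_index a c h K p = K"
proof -
  have "(1 \<le> step_index a c h K p \<and> p (real (step_index a c h K p) * h) \<notin> {a..c}) \<or> K \<le> step_index a c h K p"
    unfolding step_index_def by (rule LeastI[of _ K]) simp
  then show ?thesis using step_index_le[of a c h K p] by auto
qed

lemma step_index_le_exit: "1 \<le> j \<Longrightarrow> p (real j * h) \<notin> {a..c} \<Longrightarrow> step_index a c h K p \<le> j"
  unfolding step_index_def by (rule Least_le) simp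

text \<open>The right-hand side looks at the path only up to time \<open>j * h\<close>; this is what
  makes the index a stopping time.\<close>

lemma less_step_index:
  "j < step_index a c h K p \<longleftrightarrow> j < K \<and> (\<forall>i\<in>{1..j}. p (real i * h) \<in> {a..c})"
proof
  assume j: "j < step_index a c h K p"
  then show "j < K \<and> (\<forall>i\<in>{1..j}. p (real i * h) \<in> {a..c})"
    using step_index_le[of a c h K p] step_index_le_exit[of _ p h a c K] by (meson atLeastAtMost_iff le_trans not_less)
next
  assume j: "j < K \<and> (\<forall>i\<in>{1..j}. p (real i * h) \<in> {a..c})"
  show "j < step_index a c h K p"
  proof (rule ccontr)
    assume "\<not> j < step_index a c h K p"
    then have le: "step_index a c h K p \<le> j" by simp
    show False
      using step_index_cases[of a c h K p]
    proof
      assume *: "1 \<le> step_index a c h K p \<and> p (real (step_index a c h K p) * h) \<notin> {a..c}"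
      then have "step_index a c h K p \<in> {1..j}" using le by simp
      then show False using * j by blast
    qed (use j le in simp)
  qed
qed

text \<open>The ratio of \<open>1 - exp (- z)\<close> to \<open>z\<close>, completed continuously at
  0. It converts the decrease of the killing factor over a step into a multiple of the integral of
  the rate over that step, and it tends to 1 with the mesh.\<close>

definition rho :: "real \<Rightarrow> real" where
  "rho z = (if z = 0 then 1 else (1 - exp (- z)) / z)"

lemma rho_mult: "rho z * z = 1 - exp (- z)" by (simp add: rho_def)

lemma rho_bounds:
  assumes "0 \<le> z" shows "1 / (1 + z) \<le> rho z" "rho z \<le> 1"
proof -
  have "exp (- z) \<le> 1 / (1 + z)"
    using assms exp_ge_add_one_self[of z] by (simp add: exp_minus inverse_eq_divide frac_le)
  then have "z / (1 + z) \<le> 1 - exp (- z)" using assms by (simp add: field_simps)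
  from divide_right_mono[OF this assms] show "1 / (1 + z) \<le> rho z"
    by (cases "z = 0") (auto simp: rho_def)
  show "rho z \<le> 1" using assms exp_ge_add_one_self[of "- z"] by (auto simp: rho_def divide_le_eq)
qed

lemma rho_abs: "0 \<le> z \<Longrightarrow> \<bar>rho z\<bar> \<le> 1"
  using rho_bounds[of z] by (smt (verit) divide_nonneg_nonneg)

lemma rho_tendsto:
  assumes "\<And>n. 0 \<le> z n" "z \<longlonglongrightarrow> 0" shows "(\<lambda>n. rho (z n)) \<longlonglongrightarrow> 1"
proof (rule tendsto_sandwich)
  have "(\<lambda>n. 1 / (1 + z n)) \<longlonglongrightarrow> 1 / (1 + 0)" using assms(2) by (intro tendsto_intros) auto
  then show "(\<lambda>n. 1 / (1 + z n)) \<longlonglongrightarrow> 1" by simp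
qed (use rho_bounds assms(1) in auto)

lemma rho_measurable [measurable]: "rho \<in> borel_measurable borel"
  unfolding rho_def[abs_def] by measurable

context spectrally_negative
begin

abbreviation step_count :: "real \<Rightarrow> real \<Rightarrow> real \<Rightarrow> nat \<Rightarrow> real \<Rightarrow> 'a \<Rightarrow> nat" where
  "step_count a c h K x w \<equiv> step_index a c h K (\<lambda>t. path x t w)"

lemma step_count_past:
  assumes "0 \<le> h" shows "Measurable.pred (past (real j * h)) (\<lambda>w. j < step_count a c h K x w)"
proof -
  have "path x (real i * h) \<in> borel_measurable (past (real j * h))" if "i \<le> j" for i
    using assms that by (intro path_past_measurable mult_right_mono) auto
  then have "Measurable.pred (past (real j * h)) (\<lambda>w. \<forall>i\<in>{1..j}. path x (real i * h) w \<in> {a..c})"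
    by (intro pred_intros_finite pred_sets2[of "{a..c}" borel]) auto
  then show ?thesis unfolding less_step_index by measurable
qed

lemma step_count_measurable [measurable]: "(\<lambda>w. step_count a c h K x w) \<in> measurable M (count_space UNIV)"
  unfolding step_index_def by measurable

lemma timespace_integrable_snd:
  fixes F :: "'a \<Rightarrow> real"
  assumes F: "integrable M F" shows "integrable (timespace T) (\<lambda>z. F (snd z))"
proof (rule integrableI_bounded)
  have [measurable]: "F \<in> borel_measurable M" using F by auto
  show "(\<lambda>z. F (snd z)) \<in> borel_measurable (timespace T)" by measurable
  have "(\<integral>\<^sup>+z. ennreal (norm (F (snd z))) \<partial>timespace T) = (\<integral>\<^sup>+s. (\<integral>\<^sup>+w. ennreal (norm (F w)) \<partial>M) * indicator {0..<T} s \<partial>lborel)"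
    by (subst nn_integral_timespace) (auto simp: mult.commute)
  also have "\<dots> \<le> (\<integral>\<^sup>+s. (\<integral>\<^sup>+w. ennreal (norm (F w)) \<partial>M) * indicator {0..T} s \<partial>lborel)"
    by (intro nn_integral_mono mult_left_mono) (auto simp: indicator_def)
  also have "\<dots> = (\<integral>\<^sup>+w. ennreal (norm (F w)) \<partial>M) * emeasure lborel {0..T}"
    by (rule nn_integral_cmult_indicator) simp
  also have "\<dots> < \<infinity>"
    using F by (auto simp: integrable_iff_bounded ennreal_mult_less_top emeasure_lborel_Icc_eq)
  finally show "(\<integral>\<^sup>+z. ennreal (norm (F (snd z))) \<partial>timespace T) < \<infinity>" .
qed

lemma dynkin_pairD:
  assumes "dynkin_pair f g"
  shows "isCont f y" "f \<in> borel_measurable borel" "g \<in> borel_measurable borel"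
    "\<exists>B. \<forall>y. \<bar>g y\<bar> \<le> B" "\<exists>C\<ge>0. \<forall>y. \<bar>f y\<bar> \<le> C * (1 + exp (rate * y))"
  using assms by (auto simp: dynkin_pair_def intro!: borel_measurable_continuous_onI continuous_at_imp_continuous_on)

lemma dynkin_pair_integrable:
  assumes "dynkin_pair f g" shows "integrable M (\<lambda>w. f (path x t w))"
proof -
  obtain C where "\<And>y. \<bar>f y\<bar> \<le> C * (1 + exp (rate * y))" using dynkin_pairD(5)[OF assms] by auto
  then show ?thesis using dynkin_pairD(2)[OF assms] by (rule growth_path_integrable[rotated])
qed

text \<open>Optional stopping along a grid: on the step \<open>[jh, (j + 1) h)\<close> the increment of
  \<open>f (X) exp (- clock)\<close> splits into an increment of \<open>f\<close>, compensated by \<open>g\<close>, and an increment of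
  \<open>exp (- clock)\<close>, which is \<open>- exp (- clock) rho (\<Delta>) \<Delta>\<close> for the increment \<open>\<Delta>\<close> of the clock.\<close>

lemma discrete_dynkin:
  fixes f g k :: "real \<Rightarrow> real" and a c x h :: real and K :: nat
  assumes fg: "dynkin_pair f g" and k: "killing_rate B k" and h: "0 < h"
  defines "N \<equiv> step_count a c h K x"
  shows "(LINT w|M. f (path x (real (N w) * h) w) * exp (- clock k x (real (N w) * h) w))
    = f x + (LINT z|timespace (real K * h). (\<Sum>j<K. indicator {real j * h..<real (Suc j) * h} (fst z) *
        (of_bool (j < N (snd z)) * exp (- clock k x (real j * h) (snd z)) *
          (g (path x (fst z) (snd z)) -
           rho (clock k x (real (Suc j) * h) (snd z) - clock k x (real j * h) (snd z)) *
             (k (path x (fst z) (snd z)) * f (path x (real (Suc j) * h) (snd z)))))))"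
proof -
  define A where "A j w = clock k x (real j * h) w" for j w
  define p where "p j w = path x (real j * h) w" for j w
  define S where "S j w = f (p j w) * exp (- A j w)" for j w
  \<comment> \<open>The weight of step \<open>j\<close>, known at its left endpoint: the walk is
    still running, discounted by the killing so far.\<close>
  define Z where "Z j w = of_bool (j < N w) * exp (- A j w)" for j w
  note [measurable] = dynkin_pairD(2,3)[OF fg] killing_rateD(1)[OF k]
  have A_past: "A j \<in> borel_measurable (past (real j * h))" for j
    unfolding A_def[abs_def] using h by (intro clock_past_measurable[OF k]) auto
  have [measurable]: "A j \<in> borel_measurable M" for j by (rule past_measurable[OF A_past])
  have [measurable]: "p j \<in> borel_measurable M" for j unfolding p_def[abs_def] by measurable
  have [measurable]: "N \<in> measurable M (count_space UNIV)" unfolding N_def by measurable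
  have Z_past: "Z j \<in> borel_measurable (past (real j * h))" for j
  proof -
    have "Measurable.pred (past (real j * h)) (\<lambda>w. j < N w)"
      unfolding N_def using h by (intro step_count_past) simp
    then show ?thesis unfolding Z_def[abs_def] using A_past[of j] by measurable
  qed
  have [measurable]: "Z j \<in> borel_measurable M" for j by (rule past_measurable[OF Z_past])
  have A_nonneg: "0 \<le> A j w" if "w \<in> space M" for j w
    unfolding A_def by (rule clock_nonneg[OF k that])
  have A_mono: "A j w \<le> A (Suc j) w" if "w \<in> space M" for j w
    unfolding A_def using h by (intro clock_increment(1)[OF k that]) (auto simp: mult_right_mono)
  have Z_bd: "\<bar>Z j w\<bar> \<le> 1" if "w \<in> space M" for j w
    using A_nonneg[OF that, of j] by (auto simp: Z_def)
  \<comment> \<open>Nonnegativity of the clock is available on \<open>space M\<close> only, while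
    \<open>dynkin_step\<close> asks for \<open>\<bar>Z w\<bar> \<le> 1\<close> at every
    point.\<close>
  define Z' where "Z' j w = (if w \<in> space M then Z j w else 0)" for j w
  have Z'_past: "Z' j \<in> borel_measurable (past (real j * h))" for j
    using Z_past[of j] by (rule measurable_cong[THEN iffD1, rotated]) (simp add: Z'_def)
  have Z'_bd: "\<bar>Z' j w\<bar> \<le> 1" for j w using Z_bd by (auto simp: Z'_def)
  have fi: "integrable M (\<lambda>w. f (p j w))" for j unfolding p_def by (rule dynkin_pair_integrable[OF fg])
  have bdi: "integrable M (\<lambda>w. R w * f (p j w))"
    if [measurable]: "R \<in> borel_measurable M" and "\<And>w. w \<in> space M \<Longrightarrow> \<bar>R w\<bar> \<le> 1" for R j
    by (rule Bochner_Integration.integrable_bound[OF fi[of j]])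
      (use that(2) in \<open>auto intro!: AE_I2 simp: abs_mult mult_left_le_one_le\<close>)
  have Si: "integrable M (S j)" for j
    using bdi[of "\<lambda>w. exp (- A j w)" j] A_nonneg by (simp add: S_def[abs_def] mult.commute)
  obtain G where G: "\<And>y. \<bar>g y\<bar> \<le> G" using dynkin_pairD(4)[OF fg] by auto
  let ?T = "real K * h"
  define U where "U j z = indicator {real j * h..<real (Suc j) * h} (fst z) * (Z j (snd z) * g (path x (fst z) (snd z)))" for j z
  define V where "V j z = indicator {real j * h..<real (Suc j) * h} (fst z) *
      (Z j (snd z) * rho (A (Suc j) (snd z) - A j (snd z)) * f (p (Suc j) (snd z)) * k (path x (fst z) (snd z)))" for j z
  interpret T: finite_measure "timespace ?T" by (rule timespace_finite)
  have spT: "z \<in> space (timespace ?T) \<Longrightarrow> snd z \<in> space M" for z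
    by (auto simp: timespace_def space_pair_measure)
  have Ui: "integrable (timespace ?T) (U j)" for j
  proof (rule T.integrable_const_bound[of _ G])
    show "AE z in timespace ?T. norm (U j z) \<le> G"
    proof (rule AE_I2)
      fix z assume "z \<in> space (timespace ?T)"
      then have "\<bar>Z j (snd z)\<bar> * \<bar>g (path x (fst z) (snd z))\<bar> \<le> 1 * G"
        using Z_bd[OF spT] G by (intro mult_mono) auto
      moreover have "0 \<le> G" using G[of 0] by linarith
      ultimately show "norm (U j z) \<le> G" by (simp add: U_def abs_mult indicator_def)
    qed
    show "U j \<in> borel_measurable (timespace ?T)" unfolding U_def[abs_def] by measurable
  qed
  define R where "R j w = Z j w * rho (A (Suc j) w - A j w)" for j w
  have R_bd: "\<bar>R j w\<bar> \<le> 1" if "w \<in> space M" for j w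
    unfolding R_def using mult_mono[OF Z_bd[OF that, of j] rho_abs[of "A (Suc j) w - A j w"]] A_mono[OF that, of j]
    by (simp add: abs_mult)
  have [measurable]: "R j \<in> borel_measurable M" for j unfolding R_def[abs_def] by measurable
  have Rf: "integrable M (\<lambda>w. R j w * f (p (Suc j) w))" for j by (rule bdi) (use R_bd in auto)
  have Vi: "integrable (timespace ?T) (V j)" for j
  proof (rule Bochner_Integration.integrable_bound)
    show "integrable (timespace ?T) (\<lambda>z. R j (snd z) * f (p (Suc j) (snd z)) * B)"
      using timespace_integrable_snd[OF Rf[of j], of ?T] by (rule integrable_mult_left)
    show "V j \<in> borel_measurable (timespace ?T)" unfolding V_def[abs_def] by measurable
    show "AE z in timespace ?T. norm (V j z) \<le> norm (R j (snd z) * f (p (Suc j) (snd z)) * B)"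
      using killing_rateD(2-4)[OF k] by (intro AE_I2) (simp add: V_def R_def abs_mult indicator_def mult_left_mono)
  qed
  have step1: "(LINT w|M. Z j w * (f (p (Suc j) w) - f (p j w))) = (LINT z|timespace ?T. U j z)" if "j < K" for j
  proof -
    have le: "real j * h + h \<le> ?T" using that h mult_right_mono[of "real (Suc j)" "real K" h] by (simp add: algebra_simps)
    have "(LINT w|M. Z j w * (f (p (Suc j) w) - f (p j w))) = (LINT w|M. Z' j w * (f (path x (real j * h + h) w) - f (path x (real j * h) w)))"
      by (intro Bochner_Integration.integral_cong) (auto simp: Z'_def p_def algebra_simps)
    also have "\<dots> = (LINT z|timespace ?T. indicator {real j * h..<real j * h + h} (fst z) * (Z' j (snd z) * g (path x (fst z) (snd z))))"
      using h le Z'_past Z'_bd by (intro dynkin_step[OF fg]) auto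
    also have "\<dots> = (LINT z|timespace ?T. U j z)"
      using spT by (intro Bochner_Integration.integral_cong) (auto simp: Z'_def U_def algebra_simps)
    finally show ?thesis .
  qed
  have step2: "(LINT w|M. Z j w * (f (p (Suc j) w) * (1 - exp (- (A (Suc j) w - A j w))))) = (LINT z|timespace ?T. V j z)" if "j < K" for j
  proof -
    have le: "real (Suc j) * h \<le> ?T" using that h by (intro mult_right_mono) auto
    have "(LINT z|timespace ?T. V j z) = (LINT w|M. LINT s|lborel. indicator {0..<?T} s * V j (s, w))"
      by (rule integral_timespace(2)[OF Vi])
    also have "\<dots> = (LINT w|M. Z j w * (f (p (Suc j) w) * (1 - exp (- (A (Suc j) w - A j w)))))"
    proof (rule Bochner_Integration.integral_cong[OF refl])
      fix w assume w: "w \<in> space M"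
      have "(LINT s|lborel. indicator {0..<?T} s * V j (s, w))
        = (LINT s|lborel. R j w * f (p (Suc j) w) * (indicator {real j * h..<real (Suc j) * h} s * k (path x s w)))"
      proof (rule Bochner_Integration.integral_cong[OF refl])
        fix s
        show "indicator {0..<?T} s * V j (s, w) = R j w * f (p (Suc j) w) * (indicator {real j * h..<real (Suc j) * h} s * k (path x s w))"
        proof (cases "s \<in> {real j * h..<real (Suc j) * h}")
          case True
          then have "real j * h \<le> s" "s < real (Suc j) * h" by simp_all
          moreover have "0 \<le> real j * h" using h by simp
          ultimately have "s \<in> {0..<?T}" unfolding atLeastLessThan_iff using le by linarith
          then show ?thesis using True by (simp add: V_def R_def)
        qed (simp add: V_def)
      qed
      also have "\<dots> = R j w * f (p (Suc j) w) * (A (Suc j) w - A j w)"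
        unfolding A_def using h by (subst clock_diff[OF k w]) (auto simp: mult_right_mono)
      also have "\<dots> = Z j w * (f (p (Suc j) w) * (rho (A (Suc j) w - A j w) * (A (Suc j) w - A j w)))"
        by (simp add: R_def mult_ac)
      finally show "(LINT s|lborel. indicator {0..<?T} s * V j (s, w)) = Z j w * (f (p (Suc j) w) * (1 - exp (- (A (Suc j) w - A j w))))"
        unfolding rho_mult .
    qed
    finally show ?thesis ..
  qed
  have Zfi: "integrable M (\<lambda>w. Z j w * f (p i w))" for i j by (rule bdi) (use Z_bd in auto)
  have Zf2: "integrable M (\<lambda>w. Z j w * (f (p (Suc j) w) * (1 - exp (- (A (Suc j) w - A j w)))))" for j
  proof -
    have "integrable M (\<lambda>w. (Z j w * (1 - exp (- (A (Suc j) w - A j w)))) * f (p (Suc j) w))"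
    proof (rule bdi)
      fix w assume w: "w \<in> space M"
      have "\<bar>1 - exp (- (A (Suc j) w - A j w))\<bar> \<le> 1" using A_mono[OF w, of j] by simp
      from mult_mono[OF Z_bd[OF w, of j] this] show "\<bar>Z j w * (1 - exp (- (A (Suc j) w - A j w)))\<bar> \<le> 1"
        by (simp add: abs_mult)
    qed measurable
    then show ?thesis by (simp add: mult_ac)
  qed
  \<comment> \<open>The decrease of the killing factor is paired with \<open>f\<close> at the right
    end of the step: under refinement this point tends to the current time from the right, where the
    path is continuous.\<close>
  have split: "of_bool (j < N w) * (S (Suc j) w - S j w)
      = Z j w * (f (p (Suc j) w) - f (p j w)) - Z j w * (f (p (Suc j) w) * (1 - exp (- (A (Suc j) w - A j w))))" for j w
    by (simp add: S_def Z_def algebra_simps flip: exp_add)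
  have tele: "S (N w) w = S 0 w + (\<Sum>j<K. of_bool (j < N w) * (S (Suc j) w - S j w))" for w
  proof -
    have "(\<Sum>j<K. of_bool (j < N w) * (S (Suc j) w - S j w)) = (\<Sum>j<N w. S (Suc j) w - S j w)"
      using step_index_le[of a c h K "\<lambda>t. path x t w"]
      by (intro sum.mono_neutral_cong_right) (auto simp: N_def)
    also have "\<dots> = S (N w) w - S 0 w" by (rule sum_lessThan_telescope)
    finally show ?thesis by simp
  qed
  have S0: "(LINT w|M. S 0 w) = f x"
  proof -
    have "(LINT w|M. S 0 w) = (LINT w|M. f x)"
      using path_0[of x] by (intro integral_cong_AE) (auto simp: S_def[abs_def] A_def p_def)
    then show ?thesis by (simp add: prob_space)
  qed
  have "(LINT w|M. S (N w) w) = f x + (\<Sum>j<K. LINT w|M. of_bool (j < N w) * (S (Suc j) w - S j w))"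
  proof -
    have Di: "integrable M (\<lambda>w. of_bool (j < N w) * (S (Suc j) w - S j w))" for j
    proof -
      have "integrable M (\<lambda>w. Z j w * (f (p (Suc j) w) - f (p j w)))" using Zfi by (simp add: right_diff_distrib)
      then show ?thesis unfolding split by (intro Bochner_Integration.integrable_diff Zf2)
    qed
    have "(LINT w|M. S (N w) w) = (LINT w|M. S 0 w) + (LINT w|M. (\<Sum>j<K. of_bool (j < N w) * (S (Suc j) w - S j w)))"
      unfolding tele by (intro Bochner_Integration.integral_add Si Bochner_Integration.integrable_sum Di)
    also have "(LINT w|M. (\<Sum>j<K. of_bool (j < N w) * (S (Suc j) w - S j w))) = (\<Sum>j<K. LINT w|M. of_bool (j < N w) * (S (Suc j) w - S j w))"
      by (intro Bochner_Integration.integral_sum Di)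
    finally show ?thesis unfolding S0 .
  qed
  also have "\<dots> = f x + (\<Sum>j<K. (LINT z|timespace ?T. U j z) - (LINT z|timespace ?T. V j z))"
    unfolding split using Zfi Zf2 step1 step2
    by (simp add: Bochner_Integration.integral_diff right_diff_distrib[of "Z j w" for j w])
  also have "\<dots> = f x + (LINT z|timespace ?T. (\<Sum>j<K. U j z - V j z))"
    using Ui Vi by (simp add: Bochner_Integration.integral_sum)
  also have "(\<lambda>z. \<Sum>j<K. U j z - V j z) = (\<lambda>z. \<Sum>j<K. indicator {real j * h..<real (Suc j) * h} (fst z) *
        (of_bool (j < N (snd z)) * exp (- clock k x (real j * h) (snd z)) *
          (g (path x (fst z) (snd z)) -
           rho (clock k x (real (Suc j) * h) (snd z) - clock k x (real j * h) (snd z)) *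
             (k (path x (fst z) (snd z)) * f (path x (real (Suc j) * h) (snd z))))))"
    unfolding U_def V_def Z_def A_def p_def by (intro ext sum.cong) (simp_all add: algebra_simps)
  finally show ?thesis unfolding S_def A_def p_def .
qed

end

section \<open>Exit times as limits of grid exits\<close>

definition exits :: "real \<Rightarrow> real \<Rightarrow> (real \<Rightarrow> real) \<Rightarrow> real set" where
  "exits a c p = {t. 0 < t \<and> p t \<notin> {a..c}}"

text \<open>The cap \<open>T\<close> makes this the infimum of a nonempty set and the time
  bounded.\<close>

definition exit_time :: "real \<Rightarrow> real \<Rightarrow> real \<Rightarrow> (real \<Rightarrow> real) \<Rightarrow> real" where
  "exit_time a c T p = Inf (insert T (exits a c p))"

lemma exits_bdd_below: "0 \<le> T \<Longrightarrow> bdd_below (insert T (exits a c p))"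
  by (auto simp: exits_def intro!: bdd_belowI[of _ 0])

lemma exit_time_le: "0 \<le> T \<Longrightarrow> exit_time a c T p \<le> T"
  unfolding exit_time_def by (rule cInf_lower[OF _ exits_bdd_below]) auto

lemma exit_time_le_exit: "0 \<le> T \<Longrightarrow> t \<in> exits a c p \<Longrightarrow> exit_time a c T p \<le> t"
  unfolding exit_time_def by (rule cInf_lower[OF _ exits_bdd_below]) auto

lemma exit_time_nonneg: "0 \<le> T \<Longrightarrow> 0 \<le> exit_time a c T p"
  unfolding exit_time_def by (rule cInf_greatest) (auto simp: exits_def)

lemma in_before_exit_time: "0 \<le> T \<Longrightarrow> 0 < s \<Longrightarrow> s < exit_time a c T p \<Longrightarrow> p s \<in> {a..c}"
  using exit_time_le_exit[of T s a c p] by (auto simp: exits_def)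

text \<open>There are \<open>Suc n\<close> steps of length \<open>T / real (Suc n)\<close>, so the
  cap on the index is exactly the cap \<open>T\<close> on time.\<close>

abbreviation grid_exit :: "real \<Rightarrow> real \<Rightarrow> real \<Rightarrow> nat \<Rightarrow> (real \<Rightarrow> real) \<Rightarrow> real" where
  "grid_exit a c T n p \<equiv> real (step_index a c (T / real (Suc n)) (Suc n) p) * (T / real (Suc n))"

lemma grid_exit_bounds:
  assumes "0 < T"
  shows "exit_time a c T p \<le> grid_exit a c T n p" "grid_exit a c T n p \<le> T"
proof -
  let ?h = "T / real (Suc n)"
  have h: "0 < ?h" using assms by simp
  show "grid_exit a c T n p \<le> T"
    using mult_right_mono[of "real (step_index a c ?h (Suc n) p)" "real (Suc n)" ?h] h
      step_index_le[of a c ?h "Suc n" p] by simp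
  from step_index_cases[of a c ?h "Suc n" p] show "exit_time a c T p \<le> grid_exit a c T n p"
  proof
    assume *: "1 \<le> step_index a c ?h (Suc n) p \<and> p (grid_exit a c T n p) \<notin> {a..c}"
    then have "0 < grid_exit a c T n p" using h by (intro mult_pos_pos) auto
    then show ?thesis using * assms by (intro exit_time_le_exit) (auto simp: exits_def)
  next
    assume "step_index a c ?h (Suc n) p = Suc n"
    then have "grid_exit a c T n p = T" by simp
    then show ?thesis using exit_time_le[of T a c p] assms by simp
  qed
qed

lemma ceiling_grid_tendsto:
  fixes T t :: real assumes T: "0 < T"
  shows "(\<lambda>n. of_int \<lceil>t / (T / real (Suc n))\<rceil> * (T / real (Suc n))) \<longlonglongrightarrow> t"
    and "t \<le> of_int \<lceil>t / (T / real (Suc n))\<rceil> * (T / real (Suc n))"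
proof -
  have ge: "t \<le> of_int \<lceil>t / (T / real (Suc n))\<rceil> * (T / real (Suc n))" for n
  proof -
    have h: "0 < T / real (Suc n)" using T by simp
    show ?thesis by (rule ceiling_divide_upper[OF h])
  qed
  have le: "of_int \<lceil>t / (T / real (Suc n))\<rceil> * (T / real (Suc n)) \<le> t + T / real (Suc n)" for n
  proof -
    have h: "0 < T / real (Suc n)" using T by simp
    from ceiling_divide_lower[OF h, of t] show ?thesis by (simp only: left_diff_distrib)
  qed
  show "(\<lambda>n. of_int \<lceil>t / (T / real (Suc n))\<rceil> * (T / real (Suc n))) \<longlonglongrightarrow> t"
  proof (rule tendsto_sandwich[of "\<lambda>_. t" _ _ "\<lambda>n. t + T / real (Suc n)"])
    show "(\<lambda>n. t + T / real (Suc n)) \<longlonglongrightarrow> t" by real_asymp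
  qed (use ge le in auto)
  show "t \<le> of_int \<lceil>t / (T / real (Suc n))\<rceil> * (T / real (Suc n))" by (rule ge)
qed

text \<open>A grid exit is never early. Conversely, if the path is outside \<open>{a..c}\<close> at
  time \<open>t\<close>, right-continuity keeps it outside at the first grid point at or after
  \<open>t\<close> once the mesh is fine, because the complement is open.\<close>

lemma grid_exit_tendsto:
  assumes p: "right_continuous p" and T: "0 < T"
  shows "(\<lambda>n. grid_exit a c T n p) \<longlonglongrightarrow> exit_time a c T p"
proof (rule LIMSEQ_I)
  fix r :: real assume r: "0 < r"
  let ?s = "exit_time a c T p"
  have "\<exists>t\<in>insert T (exits a c p). t < ?s + r"
    using cInf_lessD[of "insert T (exits a c p)" "?s + r"] r by (auto simp: exit_time_def)
  then obtain t where t: "t = T \<or> t \<in> exits a c p" "t < ?s + r" by blast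
  have "\<exists>N. \<forall>n\<ge>N. grid_exit a c T n p < ?s + r"
  proof (cases "t = T")
    case True
    show ?thesis by (rule exI[of _ 0], intro allI impI, rule le_less_trans[OF grid_exit_bounds(2)[OF T]]) (use True t in simp)
  next
    case False
    then have te: "0 < t" "p t \<notin> {a..c}" using t by (auto simp: exits_def)
    let ?u = "\<lambda>n. of_int \<lceil>t / (T / real (Suc n))\<rceil> * (T / real (Suc n))"
    have u: "?u \<longlonglongrightarrow> t" "\<And>n. t \<le> ?u n" using ceiling_grid_tendsto[OF T] by auto
    have "(\<lambda>n. p (?u n)) \<longlonglongrightarrow> p t" by (rule right_continuous_tendsto[OF p u])
    moreover have "open (- {a..c})" "p t \<in> - {a..c}" using te by auto
    ultimately have "\<forall>\<^sub>F n in sequentially. p (?u n) \<in> - {a..c}" by (rule topological_tendstoD)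
    moreover have "\<forall>\<^sub>F n in sequentially. ?u n < ?s + r" using u(1) t(2) by (rule order_tendstoD)
    ultimately have "\<forall>\<^sub>F n in sequentially. grid_exit a c T n p < ?s + r"
    proof eventually_elim
      case (elim n)
      let ?h = "T / real (Suc n)" let ?j = "nat \<lceil>t / ?h\<rceil>"
      have h: "0 < ?h" using T by simp
      have "0 < t / ?h" by (rule divide_pos_pos[OF te(1) h])
      then have j: "1 \<le> ?j" "real ?j = of_int \<lceil>t / ?h\<rceil>" by linarith+
      have "step_index a c ?h (Suc n) p \<le> ?j"
        using j elim(1) by (intro step_index_le_exit) auto
      then have "grid_exit a c T n p \<le> real ?j * ?h" using h by (intro mult_right_mono) auto
      also have "\<dots> < ?s + r" using elim(2) j by simp
      finally show ?case .
    qed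
    then show ?thesis by (simp add: eventually_sequentially)
  qed
  then obtain N where "\<And>n. n \<ge> N \<Longrightarrow> grid_exit a c T n p < ?s + r" by blast
  then have "\<And>n. n \<ge> N \<Longrightarrow> \<bar>grid_exit a c T n p - ?s\<bar> < r"
    using grid_exit_bounds(1)[OF T, of a c p] by (smt (verit))
  then show "\<exists>N. \<forall>n\<ge>N. norm (grid_exit a c T n p - ?s) < r" by auto
qed

lemma grid_index:
  assumes h: "0 < h" and s: "0 \<le> s"
  shows "real (nat \<lfloor>s / h\<rfloor>) * h \<le> s" "s < real (Suc (nat \<lfloor>s / h\<rfloor>)) * h"
proof -
  have eq: "real (nat \<lfloor>s / h\<rfloor>) = of_int \<lfloor>s / h\<rfloor>" using h s by simp
  show "real (nat \<lfloor>s / h\<rfloor>) * h \<le> s" "s < real (Suc (nat \<lfloor>s / h\<rfloor>)) * h"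
    unfolding of_nat_Suc eq using floor_divide_lower[OF h, of s] floor_divide_upper[OF h, of s] by (simp_all add: add.commute)
qed

lemma grid_sum:
  fixes F :: "nat \<Rightarrow> real"
  assumes h: "0 < h" and s: "0 \<le> s" "s < real K * h"
  shows "(\<Sum>j<K. indicator {real j * h..<real (Suc j) * h} s * F j) = F (nat \<lfloor>s / h\<rfloor>)"
    and "nat \<lfloor>s / h\<rfloor> < K"
proof -
  let ?m = "nat \<lfloor>s / h\<rfloor>"
  note m = grid_index[OF h s(1)]
  have "real ?m * h < real K * h" using m(1) s(2) by linarith
  then show K: "?m < K" using h by simp
  have "indicator {real j * h..<real (Suc j) * h} s = (if j = ?m then 1 else 0 :: real)" for j
  proof (cases "j = ?m")
    case False
    then consider "Suc j \<le> ?m" | "Suc ?m \<le> j" by linarith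
    then show ?thesis
    proof cases
      case 1
      then have "real (Suc j) * h \<le> real ?m * h" using h by (intro mult_right_mono) auto
      then show ?thesis using m False by auto
    next
      case 2
      then have "real (Suc ?m) * h \<le> real j * h" using h by (intro mult_right_mono) auto
      then show ?thesis using m False by auto
    qed
  qed (use m in auto)
  then have "(\<Sum>j<K. indicator {real j * h..<real (Suc j) * h} s * F j) = (\<Sum>j<K. if j = ?m then F j else 0)"
    by (intro sum.cong) auto
  then show "(\<Sum>j<K. indicator {real j * h..<real (Suc j) * h} s * F j) = F ?m"
    using K by simp
qed

context spectrally_negative
begin

section \<open>Moments at stopped times and refinement of the grid\<close>

text \<open>The submartingale property of \<open>exp (\<theta> * X)\<close>, which comes from
  \<open>\<psi> \<theta> > 0\<close>.\<close>

lemma exp_growth_step: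
  assumes \<theta>: "rate \<le> \<theta>" and h: "0 < h" and Z: "Z \<in> borel_measurable (past s)" "\<And>w. 0 \<le> Z w" "\<And>w. Z w \<le> 1" and s: "0 \<le> s"
  shows "(LINT w|M. Z w * exp (\<theta> * path x s w)) \<le> (LINT w|M. Z w * exp (\<theta> * path x (s + h) w))"
proof -
  have \<theta>0: "0 \<le> \<theta>" "0 < \<psi> \<theta>" using \<theta> rate_pos exponent_pos[OF \<theta>] by auto
  have [measurable]: "Z \<in> borel_measurable M" by (rule past_measurable[OF Z(1)])
  have i: "integrable M (\<lambda>w. Z w * exp (\<theta> * path x t w))" for t
    by (rule Bochner_Integration.integrable_bound[OF exp_path_integrable[OF \<theta>0(1), of x t]])
      (use Z in \<open>auto simp: abs_mult mult_left_le_one_le\<close>)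
  have "(LINT w|M. Z w * exp (\<theta> * path x s w)) * 1 \<le> (LINT w|M. Z w * exp (\<theta> * path x s w)) * exp (h * \<psi> \<theta>)"
    using Z h \<theta>0 by (intro mult_left_mono integral_nonneg_AE AE_I2) auto
  also have "\<dots> = (LINT w|M. Z w * (LINT v|M. exp (\<theta> * (path x s w + X h v))))"
  proof -
    have "(LINT v|M. exp (\<theta> * (y + X h v))) = exp (\<theta> * y) * exp (h * \<psi> \<theta>)" for y
      using exp_moment(2)[OF \<theta>0(1), of h] h by (simp add: distrib_left exp_add)
    then show ?thesis by (simp add: mult.assoc[symmetric])
  qed
  also have "\<dots> = (LINT w|M. Z w * exp (\<theta> * path x (s + h) w))"
    by (rule markov[symmetric, OF s less_imp_le[OF h] Z(1), where f="\<lambda>y. exp (\<theta> * y)"]) (use i in auto)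
  finally show ?thesis by simp
qed

text \<open>Optional stopping for a submartingale: continuing from the stopping index up to
  \<open>K\<close> can only raise the expectation, since the event \<open>N w \<le> j\<close>
  belongs to the history at step \<open>j\<close>. The bound depends on the grid through
  \<open>real K * h\<close> alone.\<close>

lemma exp_stopped_bound:
  assumes \<theta>: "rate \<le> \<theta>" and h: "0 < h"
  shows "(\<integral>\<^sup>+w. ennreal (exp (\<theta> * path x (real (step_count a c h K x w) * h) w)) \<partial>M)
    \<le> ennreal (exp (\<theta> * x + real K * h * \<psi> \<theta>))"
proof -
  define N where "N = step_count a c h K x"
  define V where "V j w = exp (\<theta> * path x (real j * h) w)" for j w
  have \<theta>0: "0 \<le> \<theta>" using \<theta> rate_pos by simp
  have [measurable]: "N \<in> measurable M (count_space UNIV)" unfolding N_def by measurable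
  have [measurable]: "V j \<in> borel_measurable M" for j unfolding V_def[abs_def] by measurable
  have Vi: "integrable M (V j)" for j
    using exp_path_integrable[OF \<theta>0] by (simp add: V_def[abs_def])
  have NK: "N w \<le> K" for w unfolding N_def by (rule step_index_le)
  have VNi: "integrable M (\<lambda>w. V (N w) w)"
  proof (rule Bochner_Integration.integrable_bound)
    show "integrable M (\<lambda>w. \<Sum>j\<le>K. V j w)" using Vi by simp
    have "V (N w) w \<le> (\<Sum>j\<le>K. V j w)" for w
      using NK[of w] by (intro member_le_sum) (auto simp: V_def)
    then show "AE w in M. norm (V (N w) w) \<le> norm (\<Sum>j\<le>K. V j w)"
      by (auto simp: V_def abs_of_nonneg sum_nonneg)
  qed measurable
  have Zi: "integrable M (\<lambda>w. of_bool (N w \<le> j) * V i w)" for i j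
    by (rule Bochner_Integration.integrable_bound[OF Vi[of i]]) (auto simp: V_def)
  have tele: "V K w - V (N w) w = (\<Sum>j<K. of_bool (N w \<le> j) * V (Suc j) w - of_bool (N w \<le> j) * V j w)" for w
  proof -
    have "(\<Sum>j<K. of_bool (N w \<le> j) * V (Suc j) w - of_bool (N w \<le> j) * V j w) = (\<Sum>j=N w..<K. V (Suc j) w - V j w)"
      by (intro sum.mono_neutral_cong_right) auto
    also have "\<dots> = V K w - V (N w) w" using NK by (rule sum_Suc_diff')
    finally show ?thesis ..
  qed
  have "0 \<le> (\<Sum>j<K. (LINT w|M. of_bool (N w \<le> j) * V (Suc j) w) - (LINT w|M. of_bool (N w \<le> j) * V j w))"
  proof (intro sum_nonneg)
    fix j
    have "Measurable.pred (past (real j * h)) (\<lambda>w. j < N w)"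
      unfolding N_def using h by (intro step_count_past) simp
    then have "(\<lambda>w. of_bool (\<not> j < N w) :: real) \<in> borel_measurable (past (real j * h))" by measurable
    then have "(LINT w|M. of_bool (\<not> j < N w) * V j w) \<le> (LINT w|M. of_bool (\<not> j < N w) * exp (\<theta> * path x (real j * h + h) w))"
      unfolding V_def using h by (intro exp_growth_step[OF \<theta>]) auto
    then show "0 \<le> (LINT w|M. of_bool (N w \<le> j) * V (Suc j) w) - (LINT w|M. of_bool (N w \<le> j) * V j w)"
      by (simp add: V_def not_less algebra_simps)
  qed
  also have "\<dots> = (LINT w|M. V K w) - (LINT w|M. V (N w) w)"
    using Zi by (subst Bochner_Integration.integral_diff[OF Vi VNi, symmetric]) (simp add: tele)
  finally have "(LINT w|M. V (N w) w) \<le> (LINT w|M. V K w)" by simp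
  also have "\<dots> = exp (\<theta> * x + real K * h * \<psi> \<theta>)"
    using exp_moment(2)[OF \<theta>0, of "real K * h"] h by (simp add: V_def path_def distrib_left exp_add)
  finally show ?thesis
    using VNi unfolding V_def N_def by (subst nn_integral_eq_integral) auto
qed

lemma exit_time_measurable [measurable]:
  assumes "0 < T" shows "(\<lambda>w. exit_time a c T (\<lambda>t. path x t w)) \<in> borel_measurable M"
proof (rule borel_measurable_LIMSEQ_real)
  show "(\<lambda>n. grid_exit a c T n (\<lambda>t. path x t w)) \<longlonglongrightarrow> exit_time a c T (\<lambda>t. path x t w)" if "w \<in> space M" for w
    using path_right_continuous[OF that] assms by (rule grid_exit_tendsto)
  show "(\<lambda>w. grid_exit a c T n (\<lambda>t. path x t w)) \<in> borel_measurable M" for n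
    by measurable
qed

lemma path_at_measurable:
  assumes [measurable]: "r \<in> borel_measurable M" shows "(\<lambda>w. path x (r w) w) \<in> borel_measurable M"
  using measurable_compose[OF _ path_joint_measurable'[of x], of "\<lambda>w. (r w, w)" M] by simp

lemma clock_at_measurable:
  assumes "killing_rate B k" and [measurable]: "r \<in> borel_measurable M"
  shows "(\<lambda>w. clock k x (r w) w) \<in> borel_measurable M"
  using measurable_compose[OF _ clock_joint_measurable[OF assms(1), of x], of "\<lambda>w. (r w, w)" M] by simp

text \<open>For each outcome a single time is lost, so the graph is a null set by Fubini's theorem.
  This disposes of the exit time itself, at which the indicators of the grid formula need not
  converge, and of time 0.\<close>

lemma AE_timespace_not_graph:
  assumes r [measurable]: "r \<in> borel_measurable M"
  shows "AE z in timespace T. fst z \<in> {0..<T} \<and> snd z \<in> space M \<and> fst z \<noteq> r (snd z)"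
proof -
  interpret D: finite_measure "density lborel (indicator {0..<T::real})" by (rule finite_time)
  interpret P: pair_sigma_finite "density lborel (indicator {0..<T::real})" M ..
  let ?Q = "\<lambda>s w. s \<in> {0..<T} \<and> w \<in> space M \<and> s \<noteq> r w"
  have m: "Measurable.pred (density lborel (indicator {0..<T}) \<Otimes>\<^sub>M M) (\<lambda>z. ?Q (fst z) (snd z))"
    by measurable
  have "AE w in M. AE s in density lborel (indicator {0..<T}). ?Q s w"
  proof (rule AE_I2)
    fix w assume w: "w \<in> space M"
    have "AE s in lborel. s \<in> {0..<T} \<longrightarrow> ?Q s w"
      using AE_lborel_singleton[of "r w"] by eventually_elim (use w in auto)
    then show "AE s in density lborel (indicator {0..<T}). ?Q s w"
      by (subst AE_density) (auto elim!: eventually_mono simp: indicator_def)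
  qed
  then have "AE s in density lborel (indicator {0..<T}). AE w in M. ?Q s w"
    using m by (subst P.AE_commute) (auto simp: pred_def case_prod_beta')
  then show ?thesis
    unfolding timespace_def using m by (intro P.AE_pair_measure) (auto simp: pred_def)
qed

text \<open>Squaring doubles the exponent; hence second moments of \<open>f\<close> are governed by
  the exponential moment at \<open>2 * rate\<close>.\<close>

lemma square_growth_bound:
  assumes C: "0 \<le> C" "\<bar>v\<bar> \<le> C * (1 + exp (rate * y))"
  shows "v\<^sup>2 \<le> 2 * C\<^sup>2 * (1 + exp (2 * rate * y))"
proof -
  have "v\<^sup>2 = \<bar>v\<bar>\<^sup>2" by simp
  also have "\<dots> \<le> (C * (1 + exp (rate * y)))\<^sup>2" using C(2) by (intro power_mono) auto
  also have "\<dots> = C\<^sup>2 * (1 + exp (rate * y))\<^sup>2" by (simp add: power_mult_distrib)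
  also have "(1 + exp (rate * y))\<^sup>2 \<le> 2 * (1 + (exp (rate * y))\<^sup>2)"
    using sum_squares_bound[of 1 "exp (rate * y)"] by (simp add: power2_eq_square algebra_simps)
  then have "C\<^sup>2 * (1 + exp (rate * y))\<^sup>2 \<le> C\<^sup>2 * (2 * (1 + (exp (rate * y))\<^sup>2))" by (intro mult_left_mono) auto
  also have "(exp (rate * y))\<^sup>2 = exp (2 * rate * y)" by (simp add: exp_double[symmetric] mult.assoc)
  finally show ?thesis by (simp add: algebra_simps)
qed

text \<open>Both sides of the grid formula converge: the integrands converge almost everywhere, by
  right-continuity of the paths and continuity of \<open>f\<close>, and their second moments are
  bounded in \<open>n\<close>.\<close>

theorem stopped_dynkin:
  fixes f g k :: "real \<Rightarrow> real" and a c x :: real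
  assumes fg: "dynkin_pair f g" and k: "killing_rate B k" and T: "0 < T"
  defines "\<sigma> \<equiv> \<lambda>w. exit_time a c T (\<lambda>t. path x t w)"
  shows "integrable M (\<lambda>w. f (path x (\<sigma> w) w) * exp (- clock k x (\<sigma> w) w))" (is ?int)
    and "(LINT w|M. f (path x (\<sigma> w) w) * exp (- clock k x (\<sigma> w) w))
      = f x + (LINT z|timespace T. of_bool (fst z < \<sigma> (snd z)) * exp (- clock k x (fst z) (snd z)) *
          (g (path x (fst z) (snd z)) - k (path x (fst z) (snd z)) * f (path x (fst z) (snd z))))" (is ?eq)
proof -
  note [measurable] = dynkin_pairD(2,3)[OF fg] killing_rateD(1)[OF k]
  have cf: "isCont f y" for y by (rule dynkin_pairD(1)[OF fg])
  obtain C where C: "0 \<le> C" "\<And>y. \<bar>f y\<bar> \<le> C * (1 + exp (rate * y))" using dynkin_pairD(5)[OF fg] by auto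
  obtain G where G: "\<And>y. \<bar>g y\<bar> \<le> G" using dynkin_pairD(4)[OF fg] by auto
  have G0: "0 \<le> G" using G[of 0] by linarith
  have B0: "0 \<le> B" by (rule killing_rateD(4)[OF k])
  have r2: "rate \<le> 2 * rate" "0 < \<psi> (2 * rate)" using rate_pos exponent_pos[of "2 * rate"] by auto
  \<comment> \<open>Bounds the expectation of \<open>exp (2 * rate * X)\<close> at the stopped grid
    times and at all deterministic times up to \<open>T\<close>.\<close>
  define D where "D = exp (2 * rate * x + T * \<psi> (2 * rate))"
  define h where "h n = T / real (Suc n)" for n
  have h: "0 < h n" "real (Suc n) * h n = T" for n using T by (auto simp: h_def)
  define N where "N n w = step_count a c (h n) (Suc n) x w" for n w
  define \<tau> where "\<tau> n w = real (N n w) * h n" for n w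
  have \<tau>_eq: "\<tau> n w = grid_exit a c T n (\<lambda>t. path x t w)" for n w
    by (simp add: \<tau>_def N_def h_def)
  have [measurable]: "N n \<in> measurable M (count_space UNIV)" for n unfolding N_def by measurable
  have [measurable]: "\<tau> n \<in> borel_measurable M" for n unfolding \<tau>_def[abs_def] by measurable
  have [measurable]: "\<sigma> \<in> borel_measurable M" unfolding \<sigma>_def using T by measurable
  have \<tau>_lim: "(\<lambda>n. \<tau> n w) \<longlonglongrightarrow> \<sigma> w" and \<tau>_ge: "\<sigma> w \<le> \<tau> n w" and \<tau>_nonneg: "0 \<le> \<tau> n w"
    if "w \<in> space M" for w n
  proof -
    show "(\<lambda>n. \<tau> n w) \<longlonglongrightarrow> \<sigma> w"
      unfolding \<tau>_eq \<sigma>_def by (rule grid_exit_tendsto[OF path_right_continuous[OF that] T])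
    show "\<sigma> w \<le> \<tau> n w" unfolding \<tau>_eq \<sigma>_def by (rule grid_exit_bounds(1)[OF T])
    show "0 \<le> \<tau> n w" using h(1)[of n] by (simp add: \<tau>_def)
  qed
  define A where "A t w = clock k x t w" for t w
  have A_lim: "(\<lambda>n. A (t n) w) \<longlonglongrightarrow> A s w" if "w \<in> space M" "\<And>n. 0 \<le> t n" "t \<longlonglongrightarrow> s" for t s w
    unfolding A_def by (rule clock_tendsto[OF k that])
  have A_nonneg: "0 \<le> A t w" if "w \<in> space M" for t w
    unfolding A_def by (rule clock_nonneg[OF k that])
  have f_sq: "(f y)\<^sup>2 \<le> 2 * C\<^sup>2 * (1 + exp (2 * rate * y))" for y
    by (rule square_growth_bound[OF C])
  have f_nn: "(\<integral>\<^sup>+w. ennreal ((f (q w))\<^sup>2) \<partial>M) \<le> ennreal (2 * C\<^sup>2 * (1 + D))"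
    if [measurable]: "q \<in> borel_measurable M" and q: "(\<integral>\<^sup>+w. ennreal (exp (2 * rate * q w)) \<partial>M) \<le> ennreal D" for q
  proof -
    have "(\<integral>\<^sup>+w. ennreal ((f (q w))\<^sup>2) \<partial>M) \<le> (\<integral>\<^sup>+w. ennreal (2 * C\<^sup>2) * (1 + ennreal (exp (2 * rate * q w))) \<partial>M)"
      using f_sq by (intro nn_integral_mono) (simp add: ennreal_mult'[symmetric] ennreal_plus[symmetric] flip: ennreal_1 del: ennreal_plus)
    also have "\<dots> = ennreal (2 * C\<^sup>2) * (1 + (\<integral>\<^sup>+w. ennreal (exp (2 * rate * q w)) \<partial>M))"
      by (simp add: nn_integral_cmult nn_integral_add emeasure_space_1)
    also have "\<dots> \<le> ennreal (2 * C\<^sup>2) * (1 + ennreal D)"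
      using q by (intro mult_left_mono add_left_mono) auto
    also have "\<dots> = ennreal (2 * C\<^sup>2 * (1 + D))"
      by (simp add: D_def ennreal_mult'[symmetric] ennreal_plus[symmetric] flip: ennreal_1 del: ennreal_plus)
    finally show ?thesis .
  qed
  define Y where "Y n w = f (path x (\<tau> n w) w) * exp (- A (\<tau> n w) w)" for n w
  define Yl where "Yl w = f (path x (\<sigma> w) w) * exp (- A (\<sigma> w) w)" for w
  have [measurable]: "(\<lambda>w. path x (\<tau> n w) w) \<in> borel_measurable M" "(\<lambda>w. A (\<tau> n w) w) \<in> borel_measurable M"
    "(\<lambda>w. path x (\<sigma> w) w) \<in> borel_measurable M" "(\<lambda>w. A (\<sigma> w) w) \<in> borel_measurable M" for n
    unfolding A_def by (intro path_at_measurable clock_at_measurable[OF k]; measurable)+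
  have Ym: "Y n \<in> borel_measurable M" "Yl \<in> borel_measurable M" for n
    unfolding Y_def[abs_def] Yl_def[abs_def] by measurable
  have Ylim: "AE w in M. (\<lambda>n. Y n w) \<longlonglongrightarrow> Yl w"
  proof (rule AE_I2)
    fix w assume w: "w \<in> space M"
    have "(\<lambda>n. path x (\<tau> n w) w) \<longlonglongrightarrow> path x (\<sigma> w) w"
      by (rule right_continuous_tendsto[OF path_right_continuous[OF w] \<tau>_lim[OF w] \<tau>_ge[OF w]])
    then have "(\<lambda>n. f (path x (\<tau> n w) w)) \<longlonglongrightarrow> f (path x (\<sigma> w) w)" by (rule isCont_tendsto_compose[OF cf])
    then show "(\<lambda>n. Y n w) \<longlonglongrightarrow> Yl w"
      unfolding Y_def Yl_def by (intro tendsto_intros A_lim[OF w \<tau>_nonneg[OF w] \<tau>_lim[OF w]])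
  qed
  have Ybd: "(\<integral>\<^sup>+w. ennreal ((Y n w)\<^sup>2) \<partial>M) \<le> ennreal (2 * C\<^sup>2 * (1 + D))" for n
  proof -
    have "(\<integral>\<^sup>+w. ennreal ((Y n w)\<^sup>2) \<partial>M) \<le> (\<integral>\<^sup>+w. ennreal ((f (path x (\<tau> n w) w))\<^sup>2) \<partial>M)"
    proof (intro nn_integral_mono ennreal_leI)
      fix w assume w: "w \<in> space M"
      have "(exp (- A (\<tau> n w) w))\<^sup>2 \<le> 1" using A_nonneg[OF w] by (simp add: power_le_one)
      then show "(Y n w)\<^sup>2 \<le> (f (path x (\<tau> n w) w))\<^sup>2"
        unfolding Y_def power_mult_distrib by (intro mult_left_le) auto
    qed
    also have "\<dots> \<le> ennreal (2 * C\<^sup>2 * (1 + D))"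
    proof (rule f_nn)
      show "(\<integral>\<^sup>+w. ennreal (exp (2 * rate * path x (\<tau> n w) w)) \<partial>M) \<le> ennreal D"
        using exp_stopped_bound[OF r2(1) h(1)[of n], of x a c "Suc n"] unfolding h(2) D_def \<tau>_def N_def .
    qed measurable
    finally show ?thesis .
  qed
  note Yconv = tendsto_integral_of_bounded_second_moments[OF Ym Ylim Ybd]
  show ?int using Yconv(1) by (simp add: Yl_def[abs_def] A_def)
  define U where "U n z = (\<Sum>j<Suc n. indicator {real j * h n..<real (Suc j) * h n} (fst z) *
        (of_bool (j < N n (snd z)) * exp (- A (real j * h n) (snd z)) *
          (g (path x (fst z) (snd z)) -
           rho (A (real (Suc j) * h n) (snd z) - A (real j * h n) (snd z)) *
             (k (path x (fst z) (snd z)) * f (path x (real (Suc j) * h n) (snd z))))))" for n z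
  define Ul where "Ul z = of_bool (fst z < \<sigma> (snd z)) * exp (- A (fst z) (snd z)) *
          (g (path x (fst z) (snd z)) - k (path x (fst z) (snd z)) * f (path x (fst z) (snd z)))" for z
  have disc: "(LINT w|M. Y n w) = f x + (LINT z|timespace T. U n z)" for n
    unfolding Y_def U_def A_def \<tau>_def N_def using discrete_dynkin[OF fg k h(1)[of n], where a=a and c=c and x=x and K="Suc n"] unfolding h(2) .
  have Am: "A (real j * h n) \<in> borel_measurable M" for j n
    unfolding A_def[abs_def] using h(1)[of n] by (intro clock_measurable[OF k]) simp
  have [measurable]: "(\<lambda>z. A (fst z) (snd z)) \<in> borel_measurable (borel \<Otimes>\<^sub>M M)"
    unfolding A_def by (rule clock_joint_measurable[OF k])
  note [measurable] = Am
  have Um: "U n \<in> borel_measurable (borel \<Otimes>\<^sub>M M)" for n unfolding U_def[abs_def] by measurable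
  have Ulm: "Ul \<in> borel_measurable (borel \<Otimes>\<^sub>M M)" unfolding Ul_def[abs_def] by measurable
  define m where "m n s = nat \<lfloor>s / h n\<rfloor>" for n s
  define lo where "lo n s = real (m n s) * h n" for n s
  define hi where "hi n s = real (Suc (m n s)) * h n" for n s
  have lohi: "lo n s \<le> s" "s < hi n s" "0 \<le> lo n s" "hi n s = lo n s + h n" if "0 \<le> s" for n s
    using grid_index[OF h(1)[of n] that] h(1)[of n] by (auto simp: lo_def hi_def m_def algebra_simps)
  have U_eq: "U n (s, w) = of_bool (m n s < N n w) * exp (- A (lo n s) w) *
      (g (path x s w) - rho (A (hi n s) w - A (lo n s) w) * (k (path x s w) * f (path x (hi n s) w)))"
    and m_less: "m n s < Suc n" if "0 \<le> s" "s < T" for n s w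
  proof -
    have "s < real (Suc n) * h n" using that h(2) by simp
    note gs = grid_sum[OF h(1)[of n] that(1) this]
    show "m n s < Suc n" unfolding m_def by (rule gs(2))
    show "U n (s, w) = of_bool (m n s < N n w) * exp (- A (lo n s) w) *
      (g (path x s w) - rho (A (hi n s) w - A (lo n s) w) * (k (path x s w) * f (path x (hi n s) w)))"
      unfolding U_def fst_conv snd_conv gs(1) unfolding m_def[symmetric] lo_def hi_def ..
  qed
  \<comment> \<open>The grid exit is itself a cell boundary, so comparing it with \<open>s\<close>
    amounts to comparing cell indices.\<close>
  have before: "m n s < N n w \<longleftrightarrow> s < \<tau> n w" if "0 \<le> s" for n s w
  proof
    assume "m n s < N n w"
    then have "hi n s \<le> \<tau> n w" unfolding hi_def \<tau>_def using h(1)[of n] by (intro mult_right_mono) auto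
    then show "s < \<tau> n w" using lohi(2)[OF that, of n] by simp
  next
    assume *: "s < \<tau> n w"
    show "m n s < N n w"
    proof (rule ccontr)
      assume "\<not> m n s < N n w"
      then have "\<tau> n w \<le> lo n s" unfolding lo_def \<tau>_def using h(1)[of n] by (intro mult_right_mono) auto
      then show False using lohi(1)[OF that, of n] * by simp
    qed
  qed
  have h0: "h \<longlonglongrightarrow> 0" unfolding h_def[abs_def] by real_asymp
  have lo_lim: "(\<lambda>n. lo n s) \<longlonglongrightarrow> s" and hi_lim: "(\<lambda>n. hi n s) \<longlonglongrightarrow> s" if s: "0 \<le> s" for s
  proof -
    have "(\<lambda>n. s - h n) \<longlonglongrightarrow> s - 0" "(\<lambda>n. s + h n) \<longlonglongrightarrow> s + 0" by (intro tendsto_intros h0)+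
    then have l: "(\<lambda>n. s - h n) \<longlonglongrightarrow> s" "(\<lambda>n. s + h n) \<longlonglongrightarrow> s" by simp_all
    have b: "s - h n \<le> lo n s" "hi n s \<le> s + h n" for n using lohi[OF s, of n] by linarith+
    show "(\<lambda>n. lo n s) \<longlonglongrightarrow> s"
      by (rule tendsto_sandwich[OF _ _ l(1) tendsto_const]) (use b lohi[OF s] in auto)
    show "(\<lambda>n. hi n s) \<longlonglongrightarrow> s"
      by (rule tendsto_sandwich[OF _ _ tendsto_const l(2)]) (use b less_imp_le[OF lohi(2)[OF s]] in \<open>auto intro!: always_eventually\<close>)
  qed
  have Ulim: "AE z in timespace T. (\<lambda>n. U n z) \<longlonglongrightarrow> Ul z"
    using AE_timespace_not_graph[OF \<open>\<sigma> \<in> borel_measurable M\<close>, of T]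
  proof eventually_elim
    case (elim z)
    obtain s w where z: "z = (s, w)" by (cases z)
    have s: "0 \<le> s" "s < T" and w: "w \<in> space M" and ne: "s \<noteq> \<sigma> w" using elim by (auto simp: z)
    have "\<forall>\<^sub>F n in sequentially. (of_bool (s < \<sigma> w) :: real) = of_bool (m n s < N n w)"
    \<comment> \<open>Grid exits approach \<open>\<sigma> w\<close> from above: for
      \<open>s < \<sigma> w\<close> the indicator is 1 for every \<open>n\<close>, for
      \<open>s > \<sigma> w\<close> it is eventually 0.\<close>
    proof (cases "s < \<sigma> w")
      case True
      have "s < \<tau> n w" for n using True \<tau>_ge[OF w, of n] by simp
      then show ?thesis using True before[OF s(1)] by simp
    next
      case False
      then have "\<sigma> w < s" using ne by simp
      then have "\<forall>\<^sub>F n in sequentially. \<tau> n w < s" using \<tau>_lim[OF w] by (intro order_tendstoD)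
      then show ?thesis by eventually_elim (use False before[OF s(1)] in auto)
    qed
    then have b: "(\<lambda>n. of_bool (m n s < N n w) :: real) \<longlonglongrightarrow> of_bool (s < \<sigma> w)"
      by (rule Lim_transform_eventually[OF tendsto_const])
    have Alo: "(\<lambda>n. A (lo n s) w) \<longlonglongrightarrow> A s w" using lohi(3)[OF s(1)] lo_lim[OF s(1)] by (rule A_lim[OF w])
    have hi0: "0 \<le> hi n s" for n using lohi(2)[OF s(1), of n] s(1) by linarith
    have Ahi: "(\<lambda>n. A (hi n s) w) \<longlonglongrightarrow> A s w" using hi0 hi_lim[OF s(1)] by (rule A_lim[OF w])
    have "(\<lambda>n. A (hi n s) w - A (lo n s) w) \<longlonglongrightarrow> A s w - A s w" by (intro tendsto_intros Alo Ahi)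
    then have d: "(\<lambda>n. A (hi n s) w - A (lo n s) w) \<longlonglongrightarrow> 0" by simp
    have "A (lo n s) w \<le> A (hi n s) w" for n
      unfolding A_def using lohi[OF s(1), of n] by (intro clock_increment(1)[OF k w]) linarith+
    then have r: "(\<lambda>n. rho (A (hi n s) w - A (lo n s) w)) \<longlonglongrightarrow> 1" using d by (intro rho_tendsto) auto
    have "(\<lambda>n. path x (hi n s) w) \<longlonglongrightarrow> path x s w"
      by (rule right_continuous_tendsto[OF path_right_continuous[OF w] hi_lim[OF s(1)] less_imp_le[OF lohi(2)[OF s(1)]]])
    then have fl: "(\<lambda>n. f (path x (hi n s) w)) \<longlonglongrightarrow> f (path x s w)" by (rule isCont_tendsto_compose[OF cf])
    have "(\<lambda>n. of_bool (m n s < N n w) * exp (- A (lo n s) w) *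
      (g (path x s w) - rho (A (hi n s) w - A (lo n s) w) * (k (path x s w) * f (path x (hi n s) w))))
      \<longlonglongrightarrow> of_bool (s < \<sigma> w) * exp (- A s w) * (g (path x s w) - 1 * (k (path x s w) * f (path x s w)))"
      by (intro tendsto_intros b Alo r fl)
    then show ?case unfolding z U_eq[OF s] Ul_def by simp
  qed
  \<comment> \<open>Comes from \<open>(G + B * F)^2 \<le> 2 * G^2 + 2 * (B * F)^2\<close> and the
    second moment bound for \<open>f\<close>.\<close>
  define E where "E = 2 * G\<^sup>2 + 2 * B\<^sup>2 * (2 * C\<^sup>2 * (1 + D))"
  have E0: "0 \<le> E" by (simp add: E_def D_def)
  have Ubd: "(\<integral>\<^sup>+z. ennreal ((U n z)\<^sup>2) \<partial>timespace T) \<le> ennreal (E * T)" for n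
  proof -
    have slice: "(\<integral>\<^sup>+w. ennreal ((U n (s, w))\<^sup>2) \<partial>M) \<le> ennreal E" if s: "0 \<le> s" "s < T" for s
    proof -
      have hiT: "hi n s \<le> T"
      proof -
        have "real (Suc (m n s)) * h n \<le> real (Suc n) * h n"
          using m_less[OF s, of n] h(1)[of n] by (intro mult_right_mono) auto
        then show ?thesis unfolding hi_def h(2) .
      qed
      have hi0: "0 \<le> hi n s" using lohi(2)[OF s(1), of n] s(1) by linarith
      have "(\<integral>\<^sup>+w. ennreal ((U n (s, w))\<^sup>2) \<partial>M)
          \<le> (\<integral>\<^sup>+w. ennreal (2 * G\<^sup>2) + ennreal (2 * B\<^sup>2) * ennreal ((f (path x (hi n s) w))\<^sup>2) \<partial>M)"
      proof (rule nn_integral_mono)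
        fix w assume w: "w \<in> space M"
        define F where "F = \<bar>f (path x (hi n s) w)\<bar>"
        define u where "u = of_bool (m n s < N n w) * exp (- A (lo n s) w)"
        define v where "v = rho (A (hi n s) w - A (lo n s) w) * (k (path x s w) * f (path x (hi n s) w))"
        have u: "\<bar>u\<bar> \<le> 1" using A_nonneg[OF w, of "lo n s"] by (auto simp: u_def)
        have mono: "A (lo n s) w \<le> A (hi n s) w"
          unfolding A_def using lohi[OF s(1), of n] by (intro clock_increment(1)[OF k w]) linarith+
        have "\<bar>v\<bar> = \<bar>rho (A (hi n s) w - A (lo n s) w)\<bar> * (\<bar>k (path x s w)\<bar> * F)" by (simp add: v_def F_def abs_mult)
        also have "\<dots> \<le> 1 * (B * F)"
          using mono killing_rateD(2,3)[OF k] B0 by (intro mult_mono rho_abs) (auto simp: F_def)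
        finally have v: "\<bar>v\<bar> \<le> B * F" by simp
        have "\<bar>U n (s, w)\<bar> = \<bar>u\<bar> * \<bar>g (path x s w) - v\<bar>" unfolding U_eq[OF s] by (simp add: u_def v_def abs_mult)
        also have "\<dots> \<le> 1 * (G + B * F)"
          using u G[of "path x s w"] v by (intro mult_mono) auto
        finally have "\<bar>U n (s, w)\<bar>\<^sup>2 \<le> (G + B * F)\<^sup>2" by (intro power_mono) auto
        also have "\<dots> \<le> 2 * G\<^sup>2 + 2 * (B * F)\<^sup>2"
          using sum_squares_bound[of G "B * F"] by (simp add: power2_eq_square algebra_simps)
        finally have "(U n (s, w))\<^sup>2 \<le> 2 * G\<^sup>2 + 2 * B\<^sup>2 * (f (path x (hi n s) w))\<^sup>2"
          by (simp add: F_def power_mult_distrib)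
        then show "ennreal ((U n (s, w))\<^sup>2) \<le> ennreal (2 * G\<^sup>2) + ennreal (2 * B\<^sup>2) * ennreal ((f (path x (hi n s) w))\<^sup>2)"
          by (simp add: ennreal_mult'[symmetric] ennreal_plus[symmetric] del: ennreal_plus)
      qed
      also have "\<dots> = ennreal (2 * G\<^sup>2) + ennreal (2 * B\<^sup>2) * (\<integral>\<^sup>+w. ennreal ((f (path x (hi n s) w))\<^sup>2) \<partial>M)"
        by (simp add: nn_integral_cmult nn_integral_add emeasure_space_1)
      also have "\<dots> \<le> ennreal (2 * G\<^sup>2) + ennreal (2 * B\<^sup>2) * ennreal (2 * C\<^sup>2 * (1 + D))"
      proof (intro add_left_mono mult_left_mono f_nn)
        have "hi n s * \<psi> (2 * rate) \<le> T * \<psi> (2 * rate)" using hiT r2(2) by (intro mult_right_mono) auto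
        then show "(\<integral>\<^sup>+w. ennreal (exp (2 * rate * path x (hi n s) w)) \<partial>M) \<le> ennreal D"
          using nn_integral_exp_path[of "2 * rate" "hi n s" x] hi0 rate_pos by (simp add: D_def ennreal_leI)
      qed auto
      also have "\<dots> = ennreal E"
        by (simp add: E_def D_def ennreal_mult'[symmetric] ennreal_plus[symmetric] del: ennreal_plus)
      finally show ?thesis .
    qed
    have "(\<integral>\<^sup>+z. ennreal ((U n z)\<^sup>2) \<partial>timespace T) = (\<integral>\<^sup>+s. indicator {0..<T} s * (\<integral>\<^sup>+w. ennreal ((U n (s, w))\<^sup>2) \<partial>M) \<partial>lborel)"
      using Um by (intro nn_integral_timespace) measurable
    also have "\<dots> \<le> (\<integral>\<^sup>+s. ennreal E * indicator {0..T} s \<partial>lborel)"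
      using slice by (intro nn_integral_mono) (auto simp: indicator_def)
    also have "\<dots> = ennreal (E * T)"
      using T E0 by (subst nn_integral_cmult_indicator) (auto simp: ennreal_mult')
    finally show ?thesis .
  qed
  have Um': "U n \<in> borel_measurable (timespace T)" and Ulm': "Ul \<in> borel_measurable (timespace T)" for n
    using Um Ulm by measurable
  have "(\<lambda>n. LINT z|timespace T. U n z) \<longlonglongrightarrow> (LINT z|timespace T. Ul z)"
    by (rule finite_measure.tendsto_integral_of_bounded_second_moments(3)[OF timespace_finite Um' Ulm' Ulim Ubd])
  then have "(\<lambda>n. LINT w|M. Y n w) \<longlonglongrightarrow> f x + (LINT z|timespace T. Ul z)"
    unfolding disc by (intro tendsto_intros)
  then have "(LINT w|M. Yl w) = f x + (LINT z|timespace T. Ul z)"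
    using Yconv(3) by (rule LIMSEQ_unique[rotated])
  then show ?eq by (simp add: Yl_def Ul_def A_def)
qed

end

subsection \<open>Exit from an interval\<close>

lemma exit_time_min:
  assumes "exits a c p \<noteq> {}" shows "exit_time a c T p = min T (Inf (exits a c p))"
proof -
  have "bdd_below (exits a c p)" by (auto simp: exits_def intro!: bdd_belowI[of _ 0])
  then show ?thesis unfolding exit_time_def using assms by (simp add: cInf_insert inf_min)
qed

text \<open>Expresses the absence of exits through countably many capped exit times, for the sake of
  measurability.\<close>

lemma exits_empty_iff:
  "exits a c p = {} \<longleftrightarrow> (\<forall>n. exit_time a c (real (Suc n)) p = real (Suc n))"
proof
  assume "exits a c p = {}" then show "\<forall>n. exit_time a c (real (Suc n)) p = real (Suc n)"
    by (simp add: exit_time_def)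
next
  assume *: "\<forall>n. exit_time a c (real (Suc n)) p = real (Suc n)"
  show "exits a c p = {}"
  proof (rule ccontr)
    assume "exits a c p \<noteq> {}"
    then obtain t where t: "t \<in> exits a c p" by blast
    obtain n where "t < real n" using reals_Archimedean2 by blast
    moreover have "exit_time a c (real (Suc n)) p \<le> t" by (rule exit_time_le_exit[OF _ t]) simp
    ultimately show False using *[rule_format, of n] by simp
  qed
qed

text \<open>Taken as a limit of capped exit times, so that measurability is inherited. For a path
  without exits the capped times diverge and the value carries no meaning; later uses are guarded by
  the existence of exits or by its holding almost surely.\<close>

definition first_exit :: "real \<Rightarrow> real \<Rightarrow> (real \<Rightarrow> real) \<Rightarrow> real" where
  "first_exit a c p = lim (\<lambda>n. exit_time a c (real (Suc n)) p)"

lemma eventually_exit_time_eq: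
  assumes "exits a c p \<noteq> {}"
  shows "\<forall>\<^sub>F n in sequentially. exit_time a c (real (Suc n)) p = Inf (exits a c p)"
proof -
  obtain N where N: "Inf (exits a c p) < real N" using reals_Archimedean2 by blast
  show ?thesis unfolding exit_time_min[OF assms]
    by (rule eventually_sequentiallyI[of N]) (use N in auto)
qed

lemma first_exit_eq:
  assumes "exits a c p \<noteq> {}" shows "first_exit a c p = Inf (exits a c p)"
proof -
  have "(\<lambda>n. exit_time a c (real (Suc n)) p) \<longlonglongrightarrow> Inf (exits a c p)"
    using eventually_exit_time_eq[OF assms] by (rule tendsto_eventually)
  then show ?thesis unfolding first_exit_def by (rule limI)
qed

lemma first_exit_le:
  assumes "t \<in> exits a c p" shows "first_exit a c p \<le> t"
proof -
  have "bdd_below (exits a c p)" by (auto simp: exits_def intro!: bdd_belowI[of _ 0])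
  then show ?thesis using assms by (subst first_exit_eq) (auto intro: cInf_lower)
qed

lemma first_exit_nonneg:
  assumes "exits a c p \<noteq> {}" shows "0 \<le> first_exit a c p"
  unfolding first_exit_eq[OF assms] by (rule cInf_greatest[OF assms]) (auto simp: exits_def)

lemma in_before_first_exit: "exits a c p \<noteq> {} \<Longrightarrow> 0 < s \<Longrightarrow> s < first_exit a c p \<Longrightarrow> p s \<in> {a..c}"
  using first_exit_le[of s a c p] by (auto simp: exits_def)

lemma exits_near_first_exit:
  assumes "exits a c p \<noteq> {}" "first_exit a c p < b"
  shows "\<exists>t\<in>exits a c p. first_exit a c p \<le> t \<and> t < b"
  using cInf_lessD[of "exits a c p" b] assms first_exit_eq[OF assms(1)] first_exit_le[of _ a c p] by metis

lemma right_nbhd: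
  assumes p: "right_continuous p" and U: "open U" "p t \<in> U"
  shows "\<exists>b>t. \<forall>s. t \<le> s \<and> s < b \<longrightarrow> p s \<in> U"
proof -
  have "\<forall>\<^sub>F s in at_right t. p s \<in> U"
    using p U unfolding right_continuous_def by (blast intro: topological_tendstoD)
  then obtain b where "b > t" "\<And>s. t < s \<Longrightarrow> s < b \<Longrightarrow> p s \<in> U"
    unfolding eventually_at_right_field by blast
  then show ?thesis using U(2) by (metis order_le_less)
qed

lemma Inf_ereal_eq:
  assumes "\<And>t. t \<in> S \<Longrightarrow> r \<le> t" and "\<And>b. r < b \<Longrightarrow> \<exists>t\<in>S. t < b"
  shows "Inf {ereal t | t. t \<in> S} = ereal r"
proof (rule antisym)
  show "ereal r \<le> Inf {ereal t | t. t \<in> S}" using assms(1) by (auto intro!: Inf_greatest)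
  show "Inf {ereal t | t. t \<in> S} \<le> ereal r"
  proof (rule dense_ge)
    fix y assume y: "ereal r < y"
    then obtain b where b: "ereal r < ereal b" "ereal b < y" using ereal_dense2 by blast
    then obtain t where t: "t \<in> S" "t < b" using assms(2) by auto
    have "Inf {ereal t | t. t \<in> S} \<le> ereal t" using t by (auto intro!: Inf_lower)
    also have "\<dots> \<le> y" using t b less_ereal.simps(1) by (meson less_imp_le less_trans)
    finally show "Inf {ereal t | t. t \<in> S} \<le> y" .
  qed
qed

lemma less_Inf_ereal:
  assumes "r < b" "\<And>t. t \<in> S \<Longrightarrow> b \<le> t"
  shows "ereal r < Inf {ereal t | t. t \<in> S}"
proof -
  have "ereal b \<le> Inf {ereal t | t. t \<in> S}" using assms(2) by (auto intro!: Inf_greatest)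
  then show ?thesis using assms(1) by (meson less_ereal.simps(1) less_le_trans)
qed

lemma tau_eq_Inf:
  "tau_minus a p = Inf {ereal t | t. t \<in> {t. 0 < t \<and> p t < a}}"
  "tau_plus c p = Inf {ereal t | t. t \<in> {t. 0 < t \<and> c < p t}}"
  by (simp_all add: tau_minus_def tau_plus_def)

text \<open>The path stays above \<open>a\<close> for a while after the first exit, so the exits
  found arbitrarily soon after it are passages above \<open>c\<close>, and passage below
  \<open>a\<close> comes strictly later. The side of an exit is thus read off from the position
  relative to \<open>c\<close> alone.\<close>

lemma exit_up:
  assumes p: "right_continuous p" and ac: "a < c" and ne: "exits a c p \<noteq> {}" and up: "c \<le> p (first_exit a c p)"
  shows "tau_plus c p = ereal (first_exit a c p)" "ereal (first_exit a c p) < tau_minus a p"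
proof -
  let ?r = "first_exit a c p"
  obtain b where b: "b > ?r" "\<And>s. ?r \<le> s \<Longrightarrow> s < b \<Longrightarrow> a < p s"
    using right_nbhd[OF p, of "{a<..}" ?r] up ac by auto
  show "tau_plus c p = ereal ?r"
    unfolding tau_eq_Inf
  proof (rule Inf_ereal_eq)
    show "?r \<le> t" if "t \<in> {t. 0 < t \<and> c < p t}" for t
      using that by (intro first_exit_le) (auto simp: exits_def)
    fix b' assume "?r < b'"
    then obtain t where t: "t \<in> exits a c p" "?r \<le> t" "t < min b b'"
      using exits_near_first_exit[OF ne, of "min b b'"] b(1) by auto
    then have "t \<in> {t. 0 < t \<and> c < p t}" using b(2)[of t] by (auto simp: exits_def)
    then show "\<exists>t\<in>{t. 0 < t \<and> c < p t}. t < b'" using t by auto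
  qed
  show "ereal ?r < tau_minus a p"
    unfolding tau_eq_Inf
  proof (rule less_Inf_ereal[OF b(1)])
    fix t assume t: "t \<in> {t. 0 < t \<and> p t < a}"
    then have "?r \<le> t" by (intro first_exit_le) (auto simp: exits_def)
    then show "b \<le> t" using b(2)[of t] t by force
  qed
qed

text \<open>The path stays below \<open>c\<close> for a while, so the exits nearby are passages
  below \<open>a\<close>. At the first exit itself the path may still be at \<open>a\<close>, whence
  \<open>\<le>\<close> in the first conclusion.\<close>

lemma exit_down:
  assumes p: "right_continuous p" and ne: "exits a c p \<noteq> {}" and down: "p (first_exit a c p) < c"
  shows "p (first_exit a c p) \<le> a" "tau_minus a p = ereal (first_exit a c p)" "ereal (first_exit a c p) < tau_plus c p"
proof -
  let ?r = "first_exit a c p"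
  obtain b where b: "b > ?r" "\<And>s. ?r \<le> s \<Longrightarrow> s < b \<Longrightarrow> p s < c"
    using right_nbhd[OF p, of "{..<c}" ?r] down by auto
  have near: "\<exists>t. 0 < t \<and> ?r \<le> t \<and> t < b' \<and> p t < a" if lt: "?r < b'" for b'
  proof -
    obtain t where t: "t \<in> exits a c p" "?r \<le> t" "t < min b b'"
      using exits_near_first_exit[OF ne, of "min b b'"] b(1) lt by auto
    then show ?thesis using b(2)[of t] by (auto simp: exits_def)
  qed
  show "p ?r \<le> a"
  proof (rule ccontr)
    assume "\<not> p ?r \<le> a"
    then obtain b' where b': "b' > ?r" "\<And>s. ?r \<le> s \<Longrightarrow> s < b' \<Longrightarrow> a < p s"
      using right_nbhd[OF p, of "{a<..}" ?r] by auto
    show False using near[OF b'(1)] b'(2) by force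
  qed
  show "tau_minus a p = ereal ?r"
    unfolding tau_eq_Inf
  proof (rule Inf_ereal_eq)
    show "?r \<le> t" if "t \<in> {t. 0 < t \<and> p t < a}" for t
      using that by (intro first_exit_le) (auto simp: exits_def)
    show "\<exists>t\<in>{t. 0 < t \<and> p t < a}. t < b'" if "?r < b'" for b' using near[OF that] by auto
  qed
  show "ereal ?r < tau_plus c p"
    unfolding tau_eq_Inf
  proof (rule less_Inf_ereal[OF b(1)])
    fix t assume t: "t \<in> {t. 0 < t \<and> c < p t}"
    then have "?r \<le> t" by (intro first_exit_le) (auto simp: exits_def)
    then show "b \<le> t" using b(2)[of t] t by force
  qed
qed

lemma no_exit:
  assumes "exits a c p = {}" shows "tau_minus a p = \<infinity>" "tau_plus c p = \<infinity>"
proof -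
  have e: "{t. 0 < t \<and> p t < a} = {}" "{t. 0 < t \<and> c < p t} = {}"
    using assms by (force simp: exits_def)+
  show "tau_minus a p = \<infinity>" "tau_plus c p = \<infinity>"
    unfolding tau_eq_Inf e by (simp_all add: top_ereal_def)
qed

text \<open>Before the exit the path is at most \<open>c\<close>, hence so is its left limit, and it
  cannot jump upwards. For an exit at time 0 the starting point decides.\<close>

lemma first_exit_le_barrier:
  assumes cadlag: "cadlag p" "no_positive_jumps p" and ne: "exits a c p \<noteq> {}" and p0: "p 0 \<le> c"
  shows "p (first_exit a c p) \<le> c"
proof (cases "first_exit a c p = 0")
  case False
  let ?r = "first_exit a c p"
  have r: "0 < ?r" using False first_exit_nonneg[OF ne] by simp
  then obtain l where l: "(p \<longlongrightarrow> l) (at_left ?r)" using cadlag(1) by (auto simp: cadlag_def)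
  have "p ?r \<le> l" using cadlag(2) l r by (simp add: no_positive_jumps_def)
  also have "l \<le> c"
  proof (rule tendsto_upperbound[OF l])
    have "\<forall>\<^sub>F s in at_left ?r. s \<in> {0<..<?r}" by (rule eventually_at_leftI[of 0]) (use r in auto)
    then show "\<forall>\<^sub>F s in at_left ?r. p s \<le> c"
      by eventually_elim (use in_before_first_exit[OF ne] in auto)
  qed simp
  finally show ?thesis .
qed (use p0 in simp)

lemma stopped_le_barrier:
  assumes "cadlag p" "no_positive_jumps p" "p 0 \<le> c" "0 < T"
  shows "p (exit_time a c T p) \<le> c"
proof (cases "exits a c p = {}")
  case True
  then have "exit_time a c T p = T" by (simp add: exit_time_def)
  moreover have "T \<notin> exits a c p" using True by simp
  ultimately show ?thesis using assms(4) by (simp add: exits_def)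
next
  case False
  show ?thesis
  proof (cases "T < first_exit a c p")
    case True
    then show ?thesis using in_before_first_exit[OF False assms(4)] by (simp add: exit_time_min[OF False] first_exit_eq[OF False])
  next
    case not: False
    then show ?thesis using first_exit_le_barrier[OF assms(1,2) False assms(3)]
      by (simp add: exit_time_min[OF False] first_exit_eq[OF False] min_def)
  qed
qed

context spectrally_negative
begin

lemma path_cadlag:
  assumes w: "w \<in> space M" shows "cadlag (\<lambda>t. path x t w)"
  unfolding cadlag_def
proof (intro conjI allI impI)
  show "((\<lambda>t. path x t w) \<longlongrightarrow> path x t w) (at_right t)" for t
    using path_right_continuous[OF w] by (simp add: right_continuous_def)
  fix t :: real assume t: "0 < t"
  have "cadlag (\<lambda>t. X t w)" using levy w by (simp add: levy_process_def)
  then obtain l where "((\<lambda>t. X t w) \<longlongrightarrow> l) (at_left t)" using t by (auto simp: cadlag_def)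
  then have "((\<lambda>t. x + X t w) \<longlongrightarrow> x + l) (at_left t)" by (intro tendsto_intros)
  moreover have "\<forall>\<^sub>F s in at_left t. x + X s w = path x s w"
    by (rule eventually_at_leftI[of 0]) (use t in \<open>auto simp: path_def\<close>)
  ultimately have "((\<lambda>t. path x t w) \<longlongrightarrow> x + l) (at_left t)" by (rule Lim_transform_eventually)
  then show "\<exists>l. ((\<lambda>t. path x t w) \<longlongrightarrow> l) (at_left t)" ..
qed

lemma path_no_positive_jumps:
  assumes w: "w \<in> space M" shows "no_positive_jumps (\<lambda>t. path x t w)"
  unfolding no_positive_jumps_def
proof (intro allI impI)
  fix t l :: real assume t: "0 < t" and l: "((\<lambda>t. path x t w) \<longlongrightarrow> l) (at_left t)"
  have "((\<lambda>s. path x s w - x) \<longlongrightarrow> l - x) (at_left t)" using l by (intro tendsto_intros)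
  moreover have "\<forall>\<^sub>F s in at_left t. path x s w - x = X s w"
    by (rule eventually_at_leftI[of 0]) (use t in \<open>auto simp: path_def\<close>)
  ultimately have "((\<lambda>s. X s w) \<longlongrightarrow> l - x) (at_left t)" by (rule Lim_transform_eventually)
  moreover have "no_positive_jumps (\<lambda>t. X t w)" using snl w by (simp add: spectrally_negative_levy_def)
  ultimately have "X t w \<le> l - x" using t by (simp add: no_positive_jumps_def)
  then show "path x t w \<le> l" using t by (simp add: path_def)
qed

lemma path_0_le: "x \<le> c \<Longrightarrow> AE w in M. path x 0 w \<le> c"
  using path_0[of x] by eventually_elim simp

abbreviation hits :: "real \<Rightarrow> real \<Rightarrow> real \<Rightarrow> 'a \<Rightarrow> bool" where
  "hits a c x w \<equiv> exits a c (\<lambda>t. path x t w) \<noteq> {}"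

abbreviation exit_at :: "real \<Rightarrow> real \<Rightarrow> real \<Rightarrow> 'a \<Rightarrow> real" where
  "exit_at a c x w \<equiv> first_exit a c (\<lambda>t. path x t w)"

abbreviation stop_at :: "real \<Rightarrow> real \<Rightarrow> real \<Rightarrow> real \<Rightarrow> 'a \<Rightarrow> real" where
  "stop_at a c T x w \<equiv> exit_time a c T (\<lambda>t. path x t w)"

lemma hits_measurable [measurable]: "Measurable.pred M (\<lambda>w. hits a c x w)"
  unfolding exits_empty_iff by measurable

lemma exit_at_measurable [measurable]: "(\<lambda>w. exit_at a c x w) \<in> borel_measurable M"
  unfolding first_exit_def by (rule borel_measurable_lim_metric) measurable

section \<open>Finite mean exit time and almost sure exit\<close>

lemma test_function_indicator: "test_function (\<lambda>y. C * indicator {a..c} y)"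
  unfolding test_function_def
  by (intro conjI exI[of _ "\<bar>C\<bar>"] exI[of _ a] exI[of _ c]) (auto simp: abs_mult)

lemma conv_mono:
  assumes g: "test_function g" "\<And>y. 0 \<le> g y" and xy: "x \<le> y" shows "conv g x \<le> conv g y"
  unfolding conv_def
  by (intro integral_mono conv_integrable[OF g(1)] mult_right_mono monoD[OF W_mono]) (use g(2) xy in auto)

lemma occupation_of_stop:
  assumes T: "0 < T"
  shows "(LINT z|timespace T. of_bool (fst z < stop_at a c T x (snd z))) = (LINT w|M. stop_at a c T x w)"
    and "integrable (timespace T) (\<lambda>z. of_bool (fst z < stop_at a c T x (snd z)) :: real)"
proof -
  interpret F: finite_measure "timespace T" by (rule timespace_finite)
  note [measurable] = exit_time_measurable[OF T, of a c x]
  show i: "integrable (timespace T) (\<lambda>z. of_bool (fst z < stop_at a c T x (snd z)) :: real)"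
    by (rule F.integrable_const_bound[of _ 1]) auto
  have "(LINT s|lborel. indicator {0..<T} s * of_bool (s < stop_at a c T x w)) = stop_at a c T x w" for w
  proof -
    have "(LINT s|lborel. indicator {0..<T} s * of_bool (s < stop_at a c T x w)) = (LINT s|lborel. indicator {0..<stop_at a c T x w} s :: real)"
      using exit_time_le[of T a c "\<lambda>t. path x t w"] T
      by (intro Bochner_Integration.integral_cong) (auto simp: indicator_def)
    then show ?thesis using exit_time_nonneg[of T a c "\<lambda>t. path x t w"] T by simp
  qed
  then show "(LINT z|timespace T. of_bool (fst z < stop_at a c T x (snd z))) = (LINT w|M. stop_at a c T x w)"
    unfolding integral_timespace(2)[OF i] by simp
qed

text \<open>Time 0 must be left out, as the starting point may lie below \<open>a\<close>.\<close>

lemma AE_timespace_before: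
  "AE z in timespace T. fst z < stop_at a c T x (snd z) \<longrightarrow> path x (fst z) (snd z) \<in> {a..c}"
  using AE_timespace_not_graph[OF borel_measurable_const[of 0], of T]
proof eventually_elim
  case (elim z)
  show ?case
  proof
    assume "fst z < stop_at a c T x (snd z)"
    then show "path x (fst z) (snd z) \<in> {a..c}"
      using elim by (intro in_before_exit_time[of T "fst z" a c "\<lambda>t. path x t (snd z)"]) auto
  qed
qed

text \<open>Dynkin's formula without killing, for the indicator of \<open>{a..c}\<close>: the drift
  accumulated before the exit is the elapsed time, while \<open>conv g\<close> is monotone and the
  stopped process is at most \<open>c\<close>. The bound on the mean does not depend on
  \<open>T\<close>.\<close>

lemma stop_mean:
  fixes a c x T :: real
  assumes T: "0 < T" and x: "x \<le> c"
  defines "g \<equiv> (\<lambda>y. 1 * indicator {a..c} y :: real)"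
  shows "conv g x + (LINT w|M. stop_at a c T x w) \<le> conv g c"
proof -
  have tg: "test_function g" unfolding g_def by (rule test_function_indicator)
  have g0: "0 \<le> g y" for y by (simp add: g_def)
  have fg: "dynkin_pair (conv g) g" using dynkin_pair_conv[OF tg, of 0] by simp
  have k: "killing_rate 0 (\<lambda>_. 0)" by (simp add: killing_rate_def)
  have c0: "clock (\<lambda>_. 0) x t w = 0" for t w by (simp add: clock_def)
  note S = stopped_dynkin[OF fg k T, where a=a and c=c and x=x, unfolded c0]
  note [measurable] = exit_time_measurable[OF T, of a c x] test_functionD[OF tg] conv_measurable[OF tg]
  have "(LINT z|timespace T. of_bool (fst z < stop_at a c T x (snd z)) * exp (- 0) *
      (g (path x (fst z) (snd z)) - 0 * conv g (path x (fst z) (snd z)))) = (LINT z|timespace T. of_bool (fst z < stop_at a c T x (snd z)))"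
  proof (rule integral_cong_AE)
    show "AE z in timespace T. of_bool (fst z < stop_at a c T x (snd z)) * exp (- 0) *
      (g (path x (fst z) (snd z)) - 0 * conv g (path x (fst z) (snd z))) = of_bool (fst z < stop_at a c T x (snd z))"
      using AE_timespace_before[where T=T and a=a and c=c and x=x] by eventually_elim (auto simp: g_def)
  qed measurable
  then have "conv g x + (LINT w|M. stop_at a c T x w) = (LINT w|M. conv g (path x (stop_at a c T x w) w) * exp (- 0))"
    using S(2) occupation_of_stop(1)[OF T, of a c x] by simp
  also have "\<dots> \<le> (LINT w|M. conv g c)"
  proof (rule integral_mono_AE[OF S(1)])
    show "AE w in M. conv g (path x (stop_at a c T x w) w) * exp (- 0) \<le> conv g c"
      using path_0_le[OF x] AE_space
    proof eventually_elim
      case (elim w)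
      then show ?case
        using conv_mono[OF tg g0 stopped_le_barrier[OF path_cadlag path_no_positive_jumps _ T]] by simp
    qed
  qed simp
  finally show ?thesis by (simp add: prob_space)
qed

text \<open>The capped times have bounded means, so their increasing limit is almost surely finite;
  without exits the limit would be infinite.\<close>

lemma AE_hits:
  assumes x: "x \<le> c" shows "AE w in M. hits a c x w"
proof -
  define K where "K = conv (\<lambda>y. 1 * indicator {a..c} y) c"
  let ?s = "\<lambda>n w. stop_at a c (real (Suc n)) x w"
  have bd: "(\<integral>\<^sup>+w. ennreal (?s n w) \<partial>M) \<le> ennreal K" for n
  proof -
    have pos: "0 < real (Suc n)" by simp
    have "0 \<le> conv (\<lambda>y. 1 * indicator {a..c} y) x" by (rule conv_nonneg) simp
    then have "(LINT w|M. ?s n w) \<le> K" using stop_mean[OF pos x, of a] by (simp add: K_def)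
    moreover have "integrable M (\<lambda>w. ?s n w)"
      using exit_time_nonneg[of "real (Suc n)" a c] exit_time_le[of "real (Suc n)" a c] exit_time_measurable[OF pos, of a c x]
      by (intro integrable_const_bound[of _ "real (Suc n)"]) auto
    ultimately show ?thesis
      using exit_time_nonneg[of "real (Suc n)" a c] by (subst nn_integral_eq_integral) (auto intro: ennreal_leI)
  qed
  have "incseq (\<lambda>n w. ennreal (?s n w))"
  proof (rule incseq_SucI, rule le_funI, rule ennreal_leI)
    fix n w
    show "?s n w \<le> ?s (Suc n) w"
      by (cases "hits a c x w") (auto simp: exit_time_min, auto simp: exit_time_def)
  qed
  then have "(\<integral>\<^sup>+w. (SUP n. ennreal (?s n w)) \<partial>M) = (SUP n. \<integral>\<^sup>+w. ennreal (?s n w) \<partial>M)"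
    by (rule nn_integral_monotone_convergence_SUP) measurable
  also have "\<dots> \<le> ennreal K" using bd by (rule SUP_least)
  finally have "(\<integral>\<^sup>+w. (SUP n. ennreal (?s n w)) \<partial>M) \<noteq> \<infinity>" by (auto simp: top_unique)
  then have "AE w in M. (SUP n. ennreal (?s n w)) \<noteq> \<infinity>"
    by (intro nn_integral_noteq_infinite) measurable
  then show ?thesis
  proof eventually_elim
    case (elim w)
    show ?case
    proof
      assume e: "exits a c (\<lambda>t. path x t w) = {}"
      obtain r where r: "0 \<le> r" "(SUP n. ennreal (?s n w)) = ennreal r"
        using elim by (cases "SUP n. ennreal (?s n w)") auto
      obtain n where "r < real n" using reals_Archimedean2 by blast
      moreover have "ennreal (?s n w) \<le> ennreal r" unfolding r(2)[symmetric] by (rule SUP_upper) simp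
      then have "?s n w \<le> r" using r(1) by (simp only: ennreal_le_iff)
      then have "real (Suc n) \<le> r" using e by (simp add: exit_time_def)
      ultimately show False by simp
    qed
  qed
qed

section \<open>Exit functionals and comparison of drifts\<close>

text \<open>The guard \<open>hits\<close> excludes paths on which \<open>exit_at\<close> carries no
  meaning. The position relative to \<open>c\<close> decides the side, in line with
  \<open>exit_up\<close>.\<close>

definition up_value :: "(real \<Rightarrow> real) \<Rightarrow> real \<Rightarrow> real \<Rightarrow> real \<Rightarrow> real" where
  "up_value k a c x = (LINT w|M. of_bool (hits a c x w \<and> c \<le> path x (exit_at a c x w) w) *
     exp (- clock k x (exit_at a c x w) w))"

text \<open>The function \<open>f\<close> is evaluated at the exit position, because the process may
  leave downwards by a jump.\<close>

definition down_value :: "(real \<Rightarrow> real) \<Rightarrow> real \<Rightarrow> real \<Rightarrow> real \<Rightarrow> (real \<Rightarrow> real) \<Rightarrow> real" where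
  "down_value k a c x f = (LINT w|M. of_bool (hits a c x w \<and> path x (exit_at a c x w) w < c) *
     (f (path x (exit_at a c x w) w) * exp (- clock k x (exit_at a c x w) w)))"

text \<open>The horizon tends to \<infinity>. The process stopped at the exit never exceeds
  \<open>c\<close>, so \<open>F\<close> is a constant majorant, and an upward exit takes place
  exactly at \<open>c\<close>, which produces the factor \<open>f c\<close>.\<close>

lemma exit_limit:
  assumes fg: "dynkin_pair f g" and k: "killing_rate B k" and x: "x \<le> c"
    and Bf: "\<And>y. y \<le> c \<Longrightarrow> \<bar>f y\<bar> \<le> F"
  shows "(\<lambda>n. f x + (LINT z|timespace (real (Suc n)). of_bool (fst z < stop_at a c (real (Suc n)) x (snd z)) *
      exp (- clock k x (fst z) (snd z)) *
      (g (path x (fst z) (snd z)) - k (path x (fst z) (snd z)) * f (path x (fst z) (snd z)))))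
    \<longlonglongrightarrow> f c * up_value k a c x + down_value k a c x f"
proof -
  have pos: "0 < real (Suc n)" for n by simp
  let ?s = "\<lambda>n w. stop_at a c (real (Suc n)) x w" and ?t = "exit_at a c x"
  let ?Y = "\<lambda>n w. f (path x (?s n w) w) * exp (- clock k x (?s n w) w)"
  let ?Yl = "\<lambda>w. f (path x (?t w) w) * exp (- clock k x (?t w) w)"
  note [measurable] = dynkin_pairD(2)[OF fg] exit_time_measurable[OF pos]
  have [measurable]: "(\<lambda>w. path x (?s n w) w) \<in> borel_measurable M" "(\<lambda>w. clock k x (?s n w) w) \<in> borel_measurable M"
    "(\<lambda>w. path x (?t w) w) \<in> borel_measurable M" "(\<lambda>w. clock k x (?t w) w) \<in> borel_measurable M" for n
    by (intro path_at_measurable clock_at_measurable[OF k]; measurable)+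
  have F0: "0 \<le> F" using Bf[of c] by simp
  have ebd: "\<bar>f y * exp (- clock k x t w)\<bar> \<le> F" if "w \<in> space M" "y \<le> c" for y t w
  proof -
    have "\<bar>f y\<bar> * exp (- clock k x t w) \<le> F * 1"
      using Bf[OF that(2)] clock_nonneg[OF k that(1)] F0 by (intro mult_mono) auto
    then show ?thesis by (simp add: abs_mult)
  qed
  have lim: "(\<lambda>n. LINT w|M. ?Y n w) \<longlonglongrightarrow> (LINT w|M. ?Yl w)"
  proof (rule integral_dominated_convergence[where w="\<lambda>_. F"])
    show "AE w in M. (\<lambda>n. ?Y n w) \<longlonglongrightarrow> ?Yl w"
      using AE_hits[OF x, of a]
    proof eventually_elim
      case (elim w)
      have "\<forall>\<^sub>F n in sequentially. ?Y n w = ?Yl w"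
        using eventually_exit_time_eq[OF elim] by eventually_elim (simp add: first_exit_eq[OF elim])
      then show ?case by (rule tendsto_eventually)
    qed
    show "AE w in M. norm (?Y n w) \<le> F" for n
      using path_0_le[OF x] AE_space
    proof eventually_elim
      case (elim w)
      then show ?case
        using ebd[OF _ stopped_le_barrier[OF path_cadlag path_no_positive_jumps _ pos]] by simp
    qed
    show "?Yl \<in> borel_measurable M" "?Y n \<in> borel_measurable M" for n by measurable
  qed simp
  have AE_barrier: "AE w in M. hits a c x w \<and> path x (?t w) w \<le> c \<and> w \<in> space M"
    using AE_hits[OF x, of a] path_0_le[OF x] AE_space
  proof eventually_elim
    case (elim w)
    then show ?case using first_exit_le_barrier[OF path_cadlag path_no_positive_jumps, of w a c x] by simp
  qed
  let ?U = "\<lambda>w. of_bool (hits a c x w \<and> c \<le> path x (?t w) w) * exp (- clock k x (?t w) w)"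
  let ?D = "\<lambda>w. of_bool (hits a c x w \<and> path x (?t w) w < c) * ?Yl w"
  have Ui: "integrable M ?U"
    using clock_nonneg[OF k] by (intro integrable_const_bound[of _ 1]) (auto intro!: AE_I2)
  have Di: "integrable M ?D"
  proof (rule integrable_const_bound[of _ F])
    show "AE w in M. norm (?D w) \<le> F"
      using AE_barrier by eventually_elim (use ebd F0 in auto)
  qed measurable
  have "(LINT w|M. ?Yl w) = (LINT w|M. f c * ?U w + ?D w)"
  proof (rule integral_cong_AE)
    show "AE w in M. ?Yl w = f c * ?U w + ?D w"
      using AE_barrier
    proof eventually_elim
      case (elim w)
      then consider "path x (?t w) w = c" | "path x (?t w) w < c" by linarith
      then show ?case using elim by cases auto
    qed
  qed measurable
  also have "\<dots> = f c * up_value k a c x + down_value k a c x f"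
    unfolding up_value_def down_value_def using Ui Di by (simp add: Bochner_Integration.integral_add)
  finally show ?thesis using lim unfolding stopped_dynkin(2)[OF fg k pos] by simp
qed

text \<open>A nonpositive drift \<open>g - k * f\<close> on \<open>{a..c}\<close> lets the
  discounted value decrease on average up to the exit.\<close>

lemma exit_supersolution:
  assumes fg: "dynkin_pair f g" and k: "killing_rate B k" and x: "x \<le> c"
    and Bf: "\<And>y. y \<le> c \<Longrightarrow> \<bar>f y\<bar> \<le> F"
    and sup: "\<And>y. y \<in> {a..c} \<Longrightarrow> g y \<le> k y * f y"
  shows "f c * up_value k a c x + down_value k a c x f \<le> f x"
proof (rule LIMSEQ_le_const2[OF exit_limit[OF fg k x Bf]])
  show "\<exists>N. \<forall>n\<ge>N. f x + (LINT z|timespace (real (Suc n)). of_bool (fst z < stop_at a c (real (Suc n)) x (snd z)) *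
      exp (- clock k x (fst z) (snd z)) *
      (g (path x (fst z) (snd z)) - k (path x (fst z) (snd z)) * f (path x (fst z) (snd z)))) \<le> f x"
  proof (intro exI allI impI)
    fix n
    let ?U = "\<lambda>z. of_bool (fst z < stop_at a c (real (Suc n)) x (snd z)) * exp (- clock k x (fst z) (snd z)) *
      (g (path x (fst z) (snd z)) - k (path x (fst z) (snd z)) * f (path x (fst z) (snd z)))"
    have "0 \<le> (LINT z|timespace (real (Suc n)). - ?U z)"
    proof (rule integral_nonneg_AE)
      show "AE z in timespace (real (Suc n)). 0 \<le> - ?U z"
        using AE_timespace_before[where T="real (Suc n)" and a=a and c=c and x=x]
        by eventually_elim (use sup in \<open>auto simp: mult_le_0_iff\<close>)
    qed
    then show "f x + (LINT z|timespace (real (Suc n)). ?U z) \<le> f x" by simp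
  qed
qed

text \<open>A drift of at least \<open>- e\<close> costs at most \<open>e\<close> per unit of time,
  in total \<open>e\<close> times the mean exit time; discounting only lowers this cost.\<close>

lemma exit_subsolution:
  assumes fg: "dynkin_pair f g" and k: "killing_rate B k" and x: "x \<le> c"
    and Bf: "\<And>y. y \<le> c \<Longrightarrow> \<bar>f y\<bar> \<le> F"
    and sub: "\<And>y. y \<in> {a..c} \<Longrightarrow> k y * f y - e \<le> g y" and e: "0 \<le> e"
    and D: "\<And>T. 0 < T \<Longrightarrow> (LINT w|M. stop_at a c T x w) \<le> D"
  shows "f x - e * D \<le> f c * up_value k a c x + down_value k a c x f"
proof (rule LIMSEQ_le_const[OF exit_limit[OF fg k x Bf]])
  show "\<exists>N. \<forall>n\<ge>N. f x - e * D \<le> f x + (LINT z|timespace (real (Suc n)). of_bool (fst z < stop_at a c (real (Suc n)) x (snd z)) *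
      exp (- clock k x (fst z) (snd z)) *
      (g (path x (fst z) (snd z)) - k (path x (fst z) (snd z)) * f (path x (fst z) (snd z))))"
  proof (intro exI allI impI)
    fix n
    have pos: "0 < real (Suc n)" by simp
    let ?b = "\<lambda>z. of_bool (fst z < stop_at a c (real (Suc n)) x (snd z)) :: real"
    let ?U = "\<lambda>z. ?b z * exp (- clock k x (fst z) (snd z)) *
      (g (path x (fst z) (snd z)) - k (path x (fst z) (snd z)) * f (path x (fst z) (snd z)))"
    let ?Q = "timespace (real (Suc n))"
    have "0 \<le> (LINT w|M. stop_at a c 1 x w)" using exit_time_nonneg[of 1 a c] by (intro integral_nonneg_AE AE_I2) simp
    then have D0: "0 \<le> D" using D[of 1] by simp
    have "- (e * D) \<le> (LINT z|?Q. ?U z)"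
    \<comment> \<open>Should the drift fail to be integrable, its integral is 0 by convention and
      the bound is trivial, \<open>e * D\<close> being nonnegative.\<close>
    proof (cases "integrable ?Q ?U")
      case True
      have "- (e * D) \<le> - (e * (LINT z|?Q. ?b z))"
        using mult_left_mono[OF D[OF pos] e] occupation_of_stop(1)[OF pos, of a c x] by simp
      also have "\<dots> = (LINT z|?Q. - (e * ?b z))" by simp
      also have "\<dots> \<le> (LINT z|?Q. ?U z)"
      proof (rule integral_mono_AE[OF _ True])
        show "integrable ?Q (\<lambda>z. - (e * ?b z))"
          using occupation_of_stop(2)[OF pos, of a c x] by (intro Bochner_Integration.integrable_minus integrable_mult_right)
        show "AE z in ?Q. - (e * ?b z) \<le> ?U z"
          using AE_timespace_before[where T="real (Suc n)" and a=a and c=c and x=x] AE_space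
        proof eventually_elim
          case (elim z)
          have "snd z \<in> space M" using elim(2) by (auto simp: timespace_def space_pair_measure)
          then have ex: "exp (- clock k x (fst z) (snd z)) \<le> 1" using clock_nonneg[OF k] by simp
          show ?case
          proof (cases "fst z < stop_at a c (real (Suc n)) x (snd z)")
            case True
            then have "- e \<le> g (path x (fst z) (snd z)) - k (path x (fst z) (snd z)) * f (path x (fst z) (snd z))"
              using elim(1) sub[of "path x (fst z) (snd z)"] by auto
            from mult_left_mono[OF this exp_ge_zero[of "- clock k x (fst z) (snd z)"]]
            have "- (exp (- clock k x (fst z) (snd z)) * e) \<le> exp (- clock k x (fst z) (snd z)) *
              (g (path x (fst z) (snd z)) - k (path x (fst z) (snd z)) * f (path x (fst z) (snd z)))" by simp
            moreover have "exp (- clock k x (fst z) (snd z)) * e \<le> e" using ex e by (simp add: mult_left_le_one_le)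
            ultimately show ?thesis using True by simp
          qed simp
        qed
      qed
      finally show ?thesis .
    next
      case False
      then have "(LINT z|?Q. ?U z) = 0" by (rule not_integrable_integral_eq)
      then show ?thesis using mult_nonneg_nonneg[OF e D0] by linarith
    qed
    then show "f x - e * D \<le> f x + (LINT z|?Q. ?U z)" by simp
  qed
qed

end

section \<open>Moving the lower barrier\<close>

text \<open>Lowering the barrier removes exits, so the first exit cannot come earlier. Just after an
  upward exit the path is above \<open>a\<close>, so the exits nearby are passages above
  \<open>c\<close> and remain exits of the larger interval.\<close>

lemma first_exit_up_shrink:
  assumes p: "right_continuous p" and aa: "a' \<le> a" "a < c" and ne: "exits a c p \<noteq> {}" and up: "c \<le> p (first_exit a c p)"
  shows "exits a' c p \<noteq> {}" "first_exit a' c p = first_exit a c p"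
proof -
  let ?r = "first_exit a c p"
  have sub: "exits a' c p \<subseteq> exits a c p" using aa(1) by (auto simp: exits_def)
  obtain b where b: "b > ?r" "\<And>s. ?r \<le> s \<Longrightarrow> s < b \<Longrightarrow> a < p s"
    using right_nbhd[OF p, of "{a<..}" ?r] up aa by auto
  have near: "\<exists>t\<in>exits a' c p. t < b'" if lt: "?r < b'" for b'
  proof -
    obtain t where t: "t \<in> exits a c p" "?r \<le> t" "t < min b b'"
      using exits_near_first_exit[OF ne, of "min b b'"] b(1) lt by auto
    then have "t \<in> exits a' c p" using b(2)[of t] by (auto simp: exits_def)
    then show ?thesis using t by auto
  qed
  show ne': "exits a' c p \<noteq> {}" using near[of "?r + 1"] by auto
  show "first_exit a' c p = ?r"
  proof (rule antisym)
    show "first_exit a' c p \<le> ?r"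
    proof (rule ccontr)
      assume "\<not> first_exit a' c p \<le> ?r"
      then obtain t where "t \<in> exits a' c p" "t < first_exit a' c p" using near[of "first_exit a' c p"] by auto
      then show False using first_exit_le[of t a' c p] by simp
    qed
    show "?r \<le> first_exit a' c p"
    proof (rule ccontr)
      assume "\<not> ?r \<le> first_exit a' c p"
      then obtain t where "t \<in> exits a' c p" "t < ?r" using exits_near_first_exit[OF ne', of ?r] by auto
      then show False using first_exit_le[of t a c p] sub by auto
    qed
  qed
qed

text \<open>A downward exit is followed, while the path is still below \<open>c\<close>, by a time
  \<open>t\<close> with \<open>p t < 0\<close>; every barrier \<open>- d\<close> above
  \<open>p t\<close> is crossed by then.\<close>

lemma first_exit_down_shrink:
  assumes p: "right_continuous p" and ne: "exits 0 c p \<noteq> {}" and down: "p (first_exit 0 c p) < c"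
  shows "\<exists>e>0. \<forall>d. 0 < d \<and> d < e \<longrightarrow> exits (- d) c p \<noteq> {} \<and> p (first_exit (- d) c p) < c"
proof -
  let ?r = "first_exit 0 c p"
  obtain b where b: "b > ?r" "\<And>s. ?r \<le> s \<Longrightarrow> s < b \<Longrightarrow> p s < c"
    using right_nbhd[OF p, of "{..<c}" ?r] down by auto
  obtain t where t: "t \<in> exits 0 c p" "?r \<le> t" "t < b" using exits_near_first_exit[OF ne b(1)] by auto
  then have pt: "0 < t" "p t < 0" using b(2)[of t] by (auto simp: exits_def)
  show ?thesis
  proof (intro exI[of _ "- p t"] conjI allI impI)
    show "0 < - p t" using pt by simp
    fix d assume d: "0 < d \<and> d < - p t"
    then have te: "t \<in> exits (- d) c p" using pt by (auto simp: exits_def)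
    then show ne': "exits (- d) c p \<noteq> {}" by blast
    have "first_exit (- d) c p < b" using first_exit_le[OF te] t(3) by simp
    then obtain s where "s \<in> exits (- d) c p" "first_exit (- d) c p \<le> s" using exits_near_first_exit[OF ne'] by blast
    have "?r \<le> first_exit (- d) c p"
    proof (rule ccontr)
      assume "\<not> ?r \<le> first_exit (- d) c p"
      then obtain s where "s \<in> exits (- d) c p" "s < ?r" using exits_near_first_exit[OF ne', of ?r] by auto
      then show False using first_exit_le[of s 0 c p] d by (auto simp: exits_def)
    qed
    then show "p (first_exit (- d) c p) < c" using b(2) \<open>first_exit (- d) c p < b\<close> by simp
  qed
qed

lemma tau_cong:
  assumes "\<And>t. 0 < t \<Longrightarrow> p t = q t"
  shows "tau_minus a p = tau_minus a q" "tau_plus c p = tau_plus c q"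
  unfolding tau_minus_def tau_plus_def using assms by (auto intro!: arg_cong[where f=Inf])

lemma locally_bounded_Icc: "locally_bounded f \<Longrightarrow> \<exists>B\<ge>0. \<forall>y\<in>{a..b}. \<bar>f y\<bar> \<le> B"
  unfolding locally_bounded_def
  by (drule spec[of _ "{a..b}"]) (auto simp: bounded_pos, meson less_imp_le)

lemma interval_integral_ereal:
  "0 \<le> r \<Longrightarrow> (LBINT t=0..ereal r. f t) = (LINT t|lborel. indicator {0<..<r} t * (f t :: real))"
  "r < 0 \<Longrightarrow> (LBINT t=0..ereal r. f t) = - (LINT t|lborel. indicator {r<..<0} t * (f t :: real))"
  by (simp_all add: interval_lebesgue_integral_def set_lebesgue_integral_def zero_ereal_def)

context spectrally_negative
begin

text \<open>If \<open>W c = 0\<close>, monotonicity makes the convolution in the mean exit time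
  bound vanish, so the process from \<open>c / 2\<close> would leave \<open>{0..c}\<close> at once;
  right-continuity keeps it inside for a positive time.\<close>

lemma W_pos:
  assumes c: "0 < c" shows "0 < W c"
proof (rule ccontr)
  assume "\<not> 0 < W c"
  then have Wc: "W c = 0" using W_nonneg[of c] by simp
  let ?g = "\<lambda>y. 1 * indicator {0..c} y :: real" and ?s = "\<lambda>w. stop_at 0 c 1 (c / 2) w"
  have z: "W (c - y) * ?g y = 0" for y
    using monoD[OF W_mono, of "c - y" c] W_nonneg[of "c - y"] Wc by (cases "y \<in> {0..c}") auto
  have "conv ?g c = 0" unfolding conv_def z by simp
  moreover have "0 \<le> conv ?g (c / 2)" by (rule conv_nonneg) simp
  ultimately have le: "(LINT w|M. ?s w) \<le> 0" using stop_mean[of 1 "c / 2" c 0] c by simp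
  have nn: "0 \<le> ?s w" and le1: "?s w \<le> 1" for w by (auto intro: exit_time_nonneg exit_time_le)
  have "integrable M ?s"
    using nn le1 exit_time_measurable[of 1 0 c "c / 2"] by (intro integrable_const_bound[of _ 1]) auto
  moreover have "(LINT w|M. ?s w) = 0" using le nn by (intro antisym integral_nonneg_AE) auto
  ultimately have "AE w in M. ?s w = 0" using nn by (subst (asm) integral_nonneg_eq_0_iff_AE) auto
  then have "AE w in M. False"
    using path_0[of "c / 2"] AE_space
  proof eventually_elim
    case (elim w)
    let ?p = "\<lambda>t. path (c / 2) t w"
    obtain b where b: "b > 0" "\<And>s. 0 \<le> s \<Longrightarrow> s < b \<Longrightarrow> ?p s \<in> {0<..<c}"
      using right_nbhd[OF path_right_continuous[OF elim(3)], of "{0<..<c}" "c / 2" 0] elim(2) c by auto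
    have "min 1 b \<le> ?s w" unfolding exit_time_def
    proof (rule cInf_greatest)
      fix t assume "t \<in> insert 1 (exits 0 c ?p)"
      then show "min 1 b \<le> t" using b(2)[of t] by (fastforce simp: exits_def)
    qed simp
    then show False using elim(1) b(1) by simp
  qed
  then show False by simp
qed

section \<open>Volterra equations as convolutions and smoothing of the scale function\<close>

lemma conv_eq_0_below:
  assumes "\<And>y. y < x \<Longrightarrow> g y = 0" shows "conv g x = 0"
  unfolding conv_def
proof (rule integral_eq_zero_AE)
  show "AE y in lborel. W (x - y) * g y = 0"
    using AE_lborel_singleton[of x]
  proof eventually_elim
    case (elim y)
    then show ?case using assms[of y] W_neg[of "x - y"] by (cases "y < x") auto
  qed
qed

lemma conv_bounded_below_barrier:
  assumes g: "test_function g" shows "\<exists>F. \<forall>y\<le>c. \<bar>k + conv g y\<bar> \<le> F"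
proof -
  obtain C where C: "0 \<le> C" "\<And>y. \<bar>conv g y\<bar> \<le> C * exp (rate * y)" using conv_exp_bound[OF g] by auto
  have "\<bar>k + conv g y\<bar> \<le> \<bar>k\<bar> + C * exp (rate * c)" if "y \<le> c" for y
  proof -
    have "C * exp (rate * y) \<le> C * exp (rate * c)" using C(1) rate_pos that by (intro mult_left_mono) auto
    then show ?thesis using C(2)[of y] by linarith
  qed
  then show ?thesis by blast
qed

text \<open>For arguments up to \<open>c\<close> only values on \<open>{0..c}\<close> enter, so the
  rate can be cut off there; for locally bounded factors this turns the integrand of the Volterra
  equation into a test function.\<close>

lemma conv_volterra:
  fixes \<omega> S :: "real \<Rightarrow> real"
  assumes m [measurable]: "\<omega> \<in> borel_measurable borel" "S \<in> borel_measurable borel" and yc: "y \<le> c"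
  shows "(LBINT z=0..ereal y. W (y - z) * \<omega> z * S z) = conv (\<lambda>z. \<omega> z * indicator {0..c} z * S z) y"
proof (cases "0 \<le> y")
  case True
  show ?thesis
    unfolding interval_integral_ereal(1)[OF True] conv_def
  proof (rule integral_cong_AE)
    show "AE z in lborel. indicator {0<..<y} z * (W (y - z) * \<omega> z * S z) = W (y - z) * (\<omega> z * indicator {0..c} z * S z)"
      using AE_lborel_singleton[of y] AE_lborel_singleton[of 0]
    proof eventually_elim
      case (elim z)
      then consider "z < 0" | "0 < z" "z < y" | "y < z" by linarith
      then show ?case using W_neg[of "y - z"] yc by cases auto
    qed
  qed measurable
next
  case False
  then have y: "y < 0" by simp
  have "(LINT t|lborel. indicator {y<..<0} t * (W (y - t) * \<omega> t * S t)) = 0"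
    by (rule integral_eq_zero_AE) (auto simp: indicator_def W_neg)
  moreover have "conv (\<lambda>z. \<omega> z * indicator {0..c} z * S z) y = 0"
    using y by (intro conv_eq_0_below) auto
  ultimately show ?thesis unfolding interval_integral_ereal(2)[OF y] by simp
qed

text \<open>The mass lies to the left of 0, so that \<open>conv (approx_delta d) y\<close> averages
  \<open>W\<close> between \<open>y\<close> and \<open>y + d\<close>: it dominates \<open>W\<close>
  and converges to it even at 0, where only right-continuity of \<open>W\<close> is
  available.\<close>

definition approx_delta :: "real \<Rightarrow> real \<Rightarrow> real" where
  "approx_delta d y = 1 / d * indicator {- d..<0} y"

lemma approx_delta_test: "0 < d \<Longrightarrow> test_function (approx_delta d)"
  by (rule test_function_mono[OF test_function_indicator[of "1 / d" "- d" 0]])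
    (auto simp: approx_delta_def[abs_def] indicator_def)

lemma conv_approx_delta:
  assumes d: "0 < d" shows "W y \<le> conv (approx_delta d) y" "conv (approx_delta d) y \<le> W (y + d)"
proof -
  note i = conv_integrable[OF approx_delta_test[OF d], of y]
  have one: "(LINT z|lborel. C * approx_delta d z) = C" "integrable lborel (\<lambda>z. C * approx_delta d z)" for C
  proof -
    have fin: "emeasure lborel {- d..<0} < \<infinity>"
      using d by simp
    show "integrable lborel (\<lambda>z. C * approx_delta d z)"
      unfolding approx_delta_def using fin by (intro integrable_mult_right integrable_real_indicator) auto
    show "(LINT z|lborel. C * approx_delta d z) = C" unfolding approx_delta_def using d by simp
  qed
  have "(LINT z|lborel. W y * approx_delta d z) \<le> conv (approx_delta d) y"
    unfolding conv_def
    by (rule integral_mono[OF one(2) i]) (use d in \<open>auto simp: approx_delta_def indicator_def intro!: divide_right_mono monoD[OF W_mono]\<close>)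
  then show "W y \<le> conv (approx_delta d) y" by (simp only: one)
  have "conv (approx_delta d) y \<le> (LINT z|lborel. W (y + d) * approx_delta d z)"
    unfolding conv_def
    by (rule integral_mono[OF i one(2)]) (use d in \<open>auto simp: approx_delta_def indicator_def intro!: divide_right_mono monoD[OF W_mono]\<close>)
  then show "conv (approx_delta d) y \<le> W (y + d)" by (simp only: one)
qed

lemma conv_approx_delta_tendsto:
  assumes d: "\<And>n. 0 < d n" "d \<longlonglongrightarrow> 0" shows "(\<lambda>n. conv (approx_delta (d n)) y) \<longlonglongrightarrow> W y"
proof (rule tendsto_sandwich[OF _ _ tendsto_const])
  have l: "(\<lambda>n. y + d n) \<longlonglongrightarrow> y" using tendsto_add[OF tendsto_const d(2), of y] by simp
  show "(\<lambda>n. W (y + d n)) \<longlonglongrightarrow> W y"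
  proof (cases "0 \<le> y")
    case True
    show ?thesis
      by (rule continuous_on_tendsto_compose[OF W_continuous_on l]) (use True less_imp_le[OF d(1)] in \<open>auto intro!: always_eventually add_nonneg_nonneg\<close>)
  next
    case False
    then show ?thesis using l by (intro isCont_tendsto_compose[OF W_isCont]) auto
  qed
qed (use conv_approx_delta[OF d(1)] in auto)

text \<open>Uniform continuity on the compact interval \<open>{0..c + 1}\<close>, which has room for
  \<open>y + d\<close>. A bound uniform in \<open>y\<close> is what the drift of a subsolution
  requires.\<close>

lemma W_uniform:
  assumes "0 < e" shows "\<exists>d0>0. \<forall>d. 0 < d \<and> d < d0 \<longrightarrow> (\<forall>y\<in>{0..c}. W (y + d) - W y \<le> e)"
proof -
  have "uniformly_continuous_on {0..c + 1} W"
    using W_continuous_on by (intro compact_uniformly_continuous continuous_on_subset[OF W_continuous_on]) auto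
  then obtain d0 where d0: "d0 > 0" "\<And>x y. x \<in> {0..c + 1} \<Longrightarrow> y \<in> {0..c + 1} \<Longrightarrow> dist y x < d0 \<Longrightarrow> dist (W y) (W x) < e"
    unfolding uniformly_continuous_on_def using assms by blast
  show ?thesis
  proof (intro exI[of _ "min d0 1"] conjI allI impI ballI)
    fix d y assume "0 < d \<and> d < min d0 1" "y \<in> {0..c}"
    then show "W (y + d) - W y \<le> e" using d0(2)[of y "y + d"] by (auto simp: dist_real_def)
  qed (use d0 in auto)
qed

text \<open>Pathwise, an upward exit is unaffected by lowering the barrier, and a downward exit from
  \<open>{0..c}\<close> is a downward exit from \<open>{- d..c}\<close> as soon as \<open>d\<close>
  is small. The discounts are at most 1.\<close>

lemma up_value_tendsto:
  assumes k: "killing_rate B k" and c: "0 < c" and x: "x \<le> c" and d: "\<And>n. 0 < d n" "d \<longlonglongrightarrow> 0"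
  shows "(\<lambda>n. up_value k (- d n) c x) \<longlonglongrightarrow> up_value k 0 c x"
  unfolding up_value_def
proof (rule integral_dominated_convergence[where w="\<lambda>_. 1"])
  have m: "(\<lambda>w. path x (exit_at a c x w) w) \<in> borel_measurable M" "(\<lambda>w. clock k x (exit_at a c x w) w) \<in> borel_measurable M" for a
    by (intro path_at_measurable clock_at_measurable[OF k]; measurable)+
  note [measurable] = m
  have mm: "(\<lambda>w. of_bool (hits a c x w \<and> c \<le> path x (exit_at a c x w) w) * exp (- clock k x (exit_at a c x w) w)) \<in> borel_measurable M" for a
    by measurable
  show "(\<lambda>w. of_bool (hits 0 c x w \<and> c \<le> path x (exit_at 0 c x w) w) * exp (- clock k x (exit_at 0 c x w) w)) \<in> borel_measurable M"
    by (rule mm)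
  show "(\<lambda>w. of_bool (hits (- d n) c x w \<and> c \<le> path x (exit_at (- d n) c x w) w) * exp (- clock k x (exit_at (- d n) c x w) w)) \<in> borel_measurable M" for n
    by (rule mm)
  show "AE w in M. norm (of_bool (hits (- d n) c x w \<and> c \<le> path x (exit_at (- d n) c x w) w) * exp (- clock k x (exit_at (- d n) c x w) w)) \<le> 1" for n
    using clock_nonneg[OF k] by (auto intro!: AE_I2)
  show "AE w in M. (\<lambda>n. of_bool (hits (- d n) c x w \<and> c \<le> path x (exit_at (- d n) c x w) w) * exp (- clock k x (exit_at (- d n) c x w) w))
      \<longlonglongrightarrow> of_bool (hits 0 c x w \<and> c \<le> path x (exit_at 0 c x w) w) * exp (- clock k x (exit_at 0 c x w) w)"
    using AE_hits[OF x, of 0] AE_space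
  proof eventually_elim
    case (elim w)
    note rc = path_right_continuous[OF elim(2), of x]
    show ?case
    proof (cases "c \<le> path x (exit_at 0 c x w) w")
      case True
      have "hits (- d n) c x w \<and> exit_at (- d n) c x w = exit_at 0 c x w" for n
        using first_exit_up_shrink[OF rc _ c elim(1) True, of "- d n"] d(1)[of n] by simp
      then show ?thesis using True elim(1) by simp
    next
      case False
      then obtain e where e: "e > 0" "\<And>d. 0 < d \<Longrightarrow> d < e \<Longrightarrow> exits (- d) c (\<lambda>t. path x t w) \<noteq> {} \<and> path x (exit_at (- d) c x w) w < c"
        using first_exit_down_shrink[OF rc elim(1)] by auto
      have "\<forall>\<^sub>F n in sequentially. d n < e" using d(2) e(1) by (rule order_tendstoD)
      then have "\<forall>\<^sub>F n in sequentially. of_bool (hits (- d n) c x w \<and> c \<le> path x (exit_at (- d n) c x w) w) * exp (- clock k x (exit_at (- d n) c x w) w) = (0::real)"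
      proof eventually_elim
        case (elim n)
        then show ?case using e(2)[OF d(1) elim] by simp
      qed
      then show ?thesis using False by (simp add: tendsto_eventually)
    qed
  qed
qed simp

text \<open>Between time 0 and the exit the path lies in \<open>{0..c}\<close>, so the clock of the
  clipped rate equals the integral along the path. Paths without exit have both passage times
  infinite and belong to neither event.\<close>

lemma exit_expectation:
  fixes \<omega> :: "real \<Rightarrow> real" and c :: real
  assumes m [measurable]: "\<omega> \<in> borel_measurable borel" and c: "0 < c"
  defines "k \<equiv> \<lambda>y. \<omega> y * indicator {0..c} y"
  shows "expectation_from M X x (\<lambda>p. exp (- (LBINT t=0..tau_plus c p. \<omega> (p t)))) {p. tau_plus c p < tau_minus 0 p} = up_value k 0 c x"
    and "expectation_from M X x (\<lambda>p. exp (- (LBINT t=0..tau_minus 0 p. \<omega> (p t)))) {p. tau_minus 0 p < tau_plus c p} = down_value k 0 c x (\<lambda>_. 1)"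
proof -
  have cong: "tau_minus 0 (\<lambda>t. x + X t w) = tau_minus 0 (\<lambda>t. path x t w)" "tau_plus c (\<lambda>t. x + X t w) = tau_plus c (\<lambda>t. path x t w)" for w
    by (intro tau_cong; simp add: path_def)+
  have int: "(LBINT t=0..ereal (exit_at 0 c x w). \<omega> (x + X t w)) = clock k x (exit_at 0 c x w) w"
    if w: "w \<in> space M" and h: "hits 0 c x w" for w
  proof -
    let ?r = "exit_at 0 c x w"
    have "(LINT t|lborel. indicator {0<..<?r} t * \<omega> (x + X t w)) = (LINT t|lborel. indicator {0<..<?r} t * \<omega> (path x t w))"
      by (intro Bochner_Integration.integral_cong) (auto simp: indicator_def path_def)
    also have "\<dots> = (LINT t|lborel. indicator {0..?r} t * k (path x t w))"
    proof (rule integral_cong_AE)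
      note [measurable] = path_time_measurable[OF w]
      show "(\<lambda>t. indicator {0<..<?r} t * \<omega> (path x t w)) \<in> borel_measurable lborel" by measurable
      show "(\<lambda>t. indicator {0..?r} t * k (path x t w)) \<in> borel_measurable lborel" unfolding k_def by measurable
      show "AE t in lborel. indicator {0<..<?r} t * \<omega> (path x t w) = indicator {0..?r} t * k (path x t w)"
        using AE_lborel_singleton[of 0] AE_lborel_singleton[of ?r]
      proof eventually_elim
        case (elim t)
        then show ?case using in_before_first_exit[OF h, of t] by (auto simp: k_def indicator_def)
      qed
    qed
    finally show ?thesis unfolding interval_integral_ereal(1)[OF first_exit_nonneg[OF h]] clock_def .
  qed
  show "expectation_from M X x (\<lambda>p. exp (- (LBINT t=0..tau_plus c p. \<omega> (p t)))) {p. tau_plus c p < tau_minus 0 p} = up_value k 0 c x"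
    unfolding expectation_from_def up_value_def
  proof (rule Bochner_Integration.integral_cong[OF refl])
    fix w assume w: "w \<in> space M"
    note rc = path_right_continuous[OF w, of x]
    show "exp (- (LBINT t=0..tau_plus c (\<lambda>t. x + X t w). \<omega> (x + X t w))) * indicator {p. tau_plus c p < tau_minus 0 p} (\<lambda>t. x + X t w)
      = of_bool (hits 0 c x w \<and> c \<le> path x (exit_at 0 c x w) w) * exp (- clock k x (exit_at 0 c x w) w)"
    proof (cases "hits 0 c x w")
      case h: True
      show ?thesis
      proof (cases "c \<le> path x (exit_at 0 c x w) w")
        case True
        then show ?thesis using exit_up[OF rc c h True] h int[OF w h] by (simp add: cong)
      next
        case False
        then show ?thesis using exit_down[OF rc h] h by (simp add: cong)
      qed
    next
      case False
      then show ?thesis using no_exit[of 0 c "\<lambda>t. path x t w"] by (simp add: cong)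
    qed
  qed
  show "expectation_from M X x (\<lambda>p. exp (- (LBINT t=0..tau_minus 0 p. \<omega> (p t)))) {p. tau_minus 0 p < tau_plus c p} = down_value k 0 c x (\<lambda>_. 1)"
    unfolding expectation_from_def down_value_def
  proof (rule Bochner_Integration.integral_cong[OF refl])
    fix w assume w: "w \<in> space M"
    note rc = path_right_continuous[OF w, of x]
    show "exp (- (LBINT t=0..tau_minus 0 (\<lambda>t. x + X t w). \<omega> (x + X t w))) * indicator {p. tau_minus 0 p < tau_plus c p} (\<lambda>t. x + X t w)
      = of_bool (hits 0 c x w \<and> path x (exit_at 0 c x w) w < c) * (1 * exp (- clock k x (exit_at 0 c x w) w))"
    proof (cases "hits 0 c x w")
      case h: True
      show ?thesis
      proof (cases "c \<le> path x (exit_at 0 c x w) w")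
        case True
        then show ?thesis using exit_up[OF rc c h True] h by (simp add: cong)
      next
        case False
        then show ?thesis using exit_down[OF rc h] h int[OF w h] by (simp add: cong)
      qed
    next
      case False
      then show ?thesis using no_exit[of 0 c "\<lambda>t. path x t w"] by (simp add: cong)
    qed
  qed
qed

end

subsection \<open>The exit identities\<close>

locale omega_killed = spectrally_negative +
  fixes \<omega> Wo Zo :: "real \<Rightarrow> real" and c :: real
  assumes omega_measurable [measurable]: "\<omega> \<in> borel_measurable borel"
    and omega_nonneg: "\<And>y. 0 \<le> \<omega> y"
    and omega_bounded: "locally_bounded \<omega>"
    and Wo: "omega_scale_W W \<omega> Wo"
    and Zo: "omega_scale_Z W \<omega> Zo"
    and c_pos: "0 < c"
begin

definition clipped :: "real \<Rightarrow> real" where "clipped y = \<omega> y * indicator {0..c} y"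

lemma clipped_killing: "\<exists>B. killing_rate B clipped"
proof -
  obtain B where B: "0 \<le> B" "\<forall>y\<in>{0..c}. \<bar>\<omega> y\<bar> \<le> B" using locally_bounded_Icc[OF omega_bounded, of 0 c] by auto
  have "killing_rate B clipped"
    unfolding killing_rate_def clipped_def[abs_def] using B omega_nonneg by (auto simp: indicator_def)
  then show ?thesis ..
qed

lemma clipped_outside: "y \<notin> {0..c} \<Longrightarrow> clipped y = 0"
  by (auto simp: clipped_def)

lemma clipped_times_test:
  assumes [measurable]: "S \<in> borel_measurable borel" and S: "locally_bounded S"
  shows "test_function (\<lambda>y. clipped y * S y)"
proof -
  obtain B where B: "killing_rate B clipped" using clipped_killing by auto
  obtain D where D: "0 \<le> D" "\<forall>y\<in>{0..c}. \<bar>S y\<bar> \<le> D" using locally_bounded_Icc[OF S, of 0 c] by auto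
  note [measurable] = killing_rateD(1)[OF B]
  have "\<bar>clipped y * S y\<bar> \<le> \<bar>B * D * indicator {0..c} y\<bar>" for y
  proof (cases "y \<in> {0..c}")
    case True
    then show ?thesis using D killing_rateD(2-4)[OF B] by (auto simp: abs_mult intro!: mult_mono)
  qed (simp add: clipped_outside)
  then show ?thesis by (intro test_function_mono[OF test_function_indicator[of "B * D" 0 c]]) auto
qed

lemma Wo_measurable [measurable]: "Wo \<in> borel_measurable borel" and Wo_bounded: "locally_bounded Wo"
  using Wo by (auto simp: omega_scale_W_def)

lemma Zo_measurable [measurable]: "Zo \<in> borel_measurable borel" and Zo_bounded: "locally_bounded Zo"
  using Zo by (auto simp: omega_scale_Z_def)

lemma Wo_eq: assumes "y \<le> c" shows "Wo y = W y + conv (\<lambda>z. clipped z * Wo z) y"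
proof -
  have "Wo y = W y + (LBINT z=0..ereal y. W (y - z) * \<omega> z * Wo z)"
    using Wo unfolding omega_scale_W_def by blast
  then show ?thesis unfolding conv_volterra[OF omega_measurable Wo_measurable assms] clipped_def .
qed

lemma Zo_eq: assumes "y \<le> c" shows "Zo y = 1 + conv (\<lambda>z. clipped z * Zo z) y"
proof -
  have "Zo y = 1 + (LBINT z=0..ereal y. W (y - z) * \<omega> z * Zo z)"
    using Zo unfolding omega_scale_Z_def by blast
  then show ?thesis unfolding conv_volterra[OF omega_measurable Zo_measurable assms] clipped_def .
qed

lemma clipped_conv_nonpos: "y \<le> 0 \<Longrightarrow> conv (\<lambda>z. clipped z * S z) y = 0"
  by (rule conv_eq_0_below) (simp add: clipped_outside)

text \<open>Up to \<open>c\<close>, \<open>Wo\<close> is formally the convolution of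
  \<open>W\<close> with the sum of \<open>clipped y * Wo y\<close> and a unit mass at 0; the mass is
  replaced by \<open>approx_delta d\<close>.\<close>

definition source :: "real \<Rightarrow> real \<Rightarrow> real" where
  "source d y = clipped y * Wo y + approx_delta d y"

lemma source_test: "0 < d \<Longrightarrow> test_function (source d)"
proof -
  assume d: "0 < d"
  obtain B l r where B: "0 \<le> B" "\<And>y. \<bar>clipped y * Wo y\<bar> \<le> B * indicator {l..r} y"
    using clipped_times_test[OF Wo_measurable Wo_bounded] by (auto simp: test_function_def)
  obtain B' l' r' where B': "0 \<le> B'" "\<And>y. \<bar>approx_delta d y\<bar> \<le> B' * indicator {l'..r'} y"
    using approx_delta_test[OF d] by (auto simp: test_function_def)
  have "\<bar>source d y\<bar> \<le> \<bar>(B + B') * indicator {min l l'..max r r'} y\<bar>" for y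
  proof -
    have "B * indicator {l..r} y \<le> B * indicator {min l l'..max r r'} y"
      "B' * indicator {l'..r'} y \<le> B' * indicator {min l l'..max r r'} y"
      using B(1) B'(1) by (auto intro!: mult_left_mono simp: indicator_def)
    then show ?thesis using B(2)[of y] B'(2)[of y] unfolding source_def distrib_right by linarith
  qed
  moreover have "source d \<in> borel_measurable borel"
    unfolding source_def[abs_def]
    using test_functionD[OF clipped_times_test[OF Wo_measurable Wo_bounded]] test_functionD[OF approx_delta_test[OF d]] by measurable
  ultimately show ?thesis by (intro test_function_mono[OF test_function_indicator]) auto
qed

lemma conv_source:
  assumes "0 < d"
  shows "conv (source d) y = conv (\<lambda>z. clipped z * Wo z) y + conv (approx_delta d) y"
  unfolding source_def[abs_def] using assms
  by (intro conv_add clipped_times_test Wo_measurable Wo_bounded approx_delta_test)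

lemma conv_source_eq:
  assumes "0 < d" "y \<le> c" shows "conv (source d) y = Wo y - W y + conv (approx_delta d) y"
  using conv_source[OF assms(1), of y] Wo_eq[OF assms(2)] by simp

lemma conv_source_tendsto:
  assumes d: "\<And>n. 0 < d n" "d \<longlonglongrightarrow> 0" and y: "y \<le> c"
  shows "(\<lambda>n. conv (source (d n)) y) \<longlonglongrightarrow> Wo y"
proof -
  have "(\<lambda>n. Wo y - W y + conv (approx_delta (d n)) y) \<longlonglongrightarrow> Wo y - W y + W y"
    by (intro tendsto_intros conv_approx_delta_tendsto d)
  then show ?thesis using conv_source_eq[OF d(1) y] by simp
qed

lemma dynkin_source: "0 < d \<Longrightarrow> dynkin_pair (conv (source d)) (source d)"
  using dynkin_pair_conv[OF source_test, of d 0] by simp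

lemma conv_source_bounded: "0 < d \<Longrightarrow> \<exists>F. \<forall>y\<le>c. \<bar>conv (source d) y\<bar> \<le> F"
  using conv_bounded_below_barrier[OF source_test, of d c 0] by simp

lemma exit_down_le:
  assumes "w \<in> space M" "hits a c x w" "path x (exit_at a c x w) w < c"
  shows "path x (exit_at a c x w) w \<le> a"
  using exit_down(1)[OF path_right_continuous[OF assms(1)] assms(2,3)] .

text \<open>With the barrier at 0 the smeared mass does not act on \<open>{0..c}\<close>, and there
  \<open>conv (source d)\<close> is at least \<open>Wo\<close>, so the drift is nonpositive. At and
  below 0 only the smeared mass contributes, with a nonnegative value, so dropping the downward
  exits preserves the inequality.\<close>

lemma up_value_le:
  assumes x: "x \<le> c" shows "Wo c * up_value clipped 0 c x \<le> Wo x"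
proof -
  obtain B where B: "killing_rate B clipped" using clipped_killing by auto
  define d where "d n = 1 / real (Suc n)" for n
  have d: "\<And>n. 0 < d n" "d \<longlonglongrightarrow> 0" unfolding d_def[abs_def] by (simp, real_asymp)
  have "conv (source (d n)) c * up_value clipped 0 c x \<le> conv (source (d n)) x" for n
  proof -
    obtain F where F: "\<And>y. y \<le> c \<Longrightarrow> \<bar>conv (source (d n)) y\<bar> \<le> F" using conv_source_bounded[OF d(1)] by auto
    have "conv (source (d n)) c * up_value clipped 0 c x + down_value clipped 0 c x (conv (source (d n))) \<le> conv (source (d n)) x"
    proof (rule exit_supersolution[OF dynkin_source[OF d(1)] B x F])
      fix y assume y: "y \<in> {0..c}"
      have "conv (source (d n)) y = Wo y - W y + conv (approx_delta (d n)) y" using y by (intro conv_source_eq d) auto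
      then have "Wo y \<le> conv (source (d n)) y" using conv_approx_delta(1)[OF d(1), of y n] by simp
      then show "source (d n) y \<le> clipped y * conv (source (d n)) y"
        using y killing_rateD(2)[OF B, of y] by (simp add: source_def approx_delta_def mult_left_mono)
    qed
    moreover have "0 \<le> down_value clipped 0 c x (conv (source (d n)))"
      unfolding down_value_def
    proof (rule integral_nonneg_AE, rule AE_I2)
      fix w assume w: "w \<in> space M"
      have nn: "0 \<le> conv (source (d n)) y" if "y \<le> 0" for y
        unfolding conv_source[OF d(1)] clipped_conv_nonpos[OF that]
        using conv_nonneg[of "approx_delta (d n)" y] d(1)[of n] by (simp add: approx_delta_def)
      show "0 \<le> of_bool (hits 0 c x w \<and> path x (exit_at 0 c x w) w < c) *
          (conv (source (d n)) (path x (exit_at 0 c x w) w) * exp (- clock clipped x (exit_at 0 c x w) w))"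
      proof (cases "hits 0 c x w \<and> path x (exit_at 0 c x w) w < c")
        case True
        then have "path x (exit_at 0 c x w) w \<le> 0" using exit_down_le[OF w] by blast
        then show ?thesis using nn by simp
      qed (simp only: of_bool_eq mult_zero_left order_refl)
    qed
    ultimately show ?thesis by linarith
  qed
  moreover have "(\<lambda>n. conv (source (d n)) c * up_value clipped 0 c x) \<longlonglongrightarrow> Wo c * up_value clipped 0 c x"
    by (intro tendsto_intros conv_source_tendsto d) simp
  moreover have "(\<lambda>n. conv (source (d n)) x) \<longlonglongrightarrow> Wo x" by (intro conv_source_tendsto d x)
  ultimately show ?thesis by (intro LIMSEQ_le) auto
qed

text \<open>For the reverse inequality the lower barrier is moved to \<open>-d\<close>, so that the mass of
  \<open>approx_delta d\<close> is collected before the exit.\<close>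

lemma up_value_ge:
  assumes x: "x \<le> c" shows "Wo x \<le> Wo c * up_value clipped 0 c x"
proof -
  obtain B where B: "killing_rate B clipped" using clipped_killing by auto
  have B0: "0 \<le> B" by (rule killing_rateD(4)[OF B])
  define d where "d n = 1 / real (Suc n)" for n
  have d: "\<And>n. 0 < d n" "d \<longlonglongrightarrow> 0" unfolding d_def[abs_def] by (simp, real_asymp)
  have d1: "d n \<le> 1" for n by (simp add: d_def)
  \<comment> \<open>Since \<open>d n \<le> 1\<close>, the interval \<open>{- 1..c}\<close> contains
    all intervals \<open>{- d n..c}\<close> and bounds their mean exit times simultaneously.\<close>
  define D where "D = conv (\<lambda>y. 1 * indicator {- 1..c} y) c"
  have D0: "0 \<le> D" unfolding D_def by (rule conv_nonneg) simp
  have mean: "(LINT w|M. stop_at (- d n) c T x w) \<le> D" if T: "0 < T" for n T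
  proof -
    have "0 \<le> conv (\<lambda>y. 1 * indicator {- d n..c} y) x" by (rule conv_nonneg) simp
    moreover have "conv (\<lambda>y. 1 * indicator {- d n..c} y) c \<le> D"
      unfolding D_def conv_def using d1[of n] W_nonneg
      by (intro integral_mono conv_integrable test_function_indicator mult_left_mono) (auto simp: indicator_def)
    ultimately show ?thesis using stop_mean[OF T x, of "- d n"] by linarith
  qed
  \<comment> \<open>For fixed \<open>e\<close> first \<open>d n\<close> tends to 0, then
    \<open>e\<close> does. On \<open>{0..c}\<close>, \<open>e\<close> bounds the excess of
    \<open>conv (source (d n))\<close> over \<open>Wo\<close>, and \<open>B * e\<close> the
    resulting drift error.\<close>
  have main: "Wo x - B * e * D \<le> Wo c * up_value clipped 0 c x" if e: "0 < e" for e
  proof -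
    obtain d0 where d0: "d0 > 0" "\<And>d y. 0 < d \<Longrightarrow> d < d0 \<Longrightarrow> y \<in> {0..c} \<Longrightarrow> W (y + d) - W y \<le> e"
      using W_uniform[OF e, of c] by auto
    have step: "conv (source (d n)) x - B * e * D \<le> conv (source (d n)) c * up_value clipped (- d n) c x" if n: "d n < d0" for n
    proof -
      obtain F where F: "\<And>y. y \<le> c \<Longrightarrow> \<bar>conv (source (d n)) y\<bar> \<le> F" using conv_source_bounded[OF d(1)] by auto
      have "conv (source (d n)) x - (B * e) * D \<le> conv (source (d n)) c * up_value clipped (- d n) c x + down_value clipped (- d n) c x (conv (source (d n)))"
      proof (rule exit_subsolution[OF dynkin_source[OF d(1)] B x F])
        fix y assume y: "y \<in> {- d n..c}"
        have a0: "0 \<le> approx_delta (d n) y" using d(1)[of n] by (simp add: approx_delta_def)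
        show "clipped y * conv (source (d n)) y - B * e \<le> source (d n) y"
        proof (cases "y \<in> {0..c}")
          case True
          have "conv (source (d n)) y \<le> Wo y + e"
            using conv_source_eq[OF d(1)[of n], of y] conv_approx_delta(2)[OF d(1)[of n], of y] d0(2)[OF d(1) n True] True by simp
          then have "clipped y * conv (source (d n)) y \<le> clipped y * (Wo y + e)" by (intro mult_left_mono killing_rateD(2)[OF B])
          also have "\<dots> \<le> clipped y * Wo y + B * e"
            using killing_rateD(3)[OF B, of y] e by (simp add: distrib_left mult_right_mono)
          finally show ?thesis using a0 by (simp add: source_def)
        next
          \<comment> \<open>On \<open>{- d n..<0}\<close> there is no killing, and the smeared mass
            enters with the favourable sign.\<close>
          case False
          then have "clipped y = 0" by (rule clipped_outside)
          then show ?thesis using a0 mult_nonneg_nonneg[OF B0 less_imp_le[OF e]]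
            unfolding source_def by simp
        qed
      qed (use B0 e mean in auto)
      moreover have "down_value clipped (- d n) c x (conv (source (d n))) = 0"
        unfolding down_value_def
      proof (rule integral_eq_zero_AE, rule AE_I2)
        fix w assume w: "w \<in> space M"
        \<comment> \<open>The source lives on \<open>{- d n..c}\<close>, so its convolution vanishes
          at and below \<open>- d n\<close>: downward exits contribute nothing.\<close>
        have z: "conv (source (d n)) y = 0" if "y \<le> - d n" for y
        proof -
          have "conv (approx_delta (d n)) y = 0"
            using that by (intro conv_eq_0_below) (simp add: approx_delta_def)
          moreover have "y \<le> 0" using that d(1)[of n] by linarith
          ultimately show ?thesis unfolding conv_source[OF d(1)] by (simp add: clipped_conv_nonpos)
        qed
        show "of_bool (hits (- d n) c x w \<and> path x (exit_at (- d n) c x w) w < c) *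
            (conv (source (d n)) (path x (exit_at (- d n) c x w) w) * exp (- clock clipped x (exit_at (- d n) c x w) w)) = 0"
        proof (cases "hits (- d n) c x w \<and> path x (exit_at (- d n) c x w) w < c")
          case True
          then have "path x (exit_at (- d n) c x w) w \<le> - d n" using exit_down_le[OF w] by blast
          then show ?thesis by (simp only: z mult_zero_left mult_zero_right)
        qed (simp only: of_bool_eq mult_zero_left)
      qed
      ultimately show ?thesis by simp
    qed
    have "\<forall>\<^sub>F n in sequentially. d n < d0" using d(2) d0(1) by (rule order_tendstoD)
    then have "\<forall>\<^sub>F n in sequentially. conv (source (d n)) x - B * e * D \<le> conv (source (d n)) c * up_value clipped (- d n) c x"
      by eventually_elim (rule step)
    moreover have "(\<lambda>n. conv (source (d n)) x - B * e * D) \<longlonglongrightarrow> Wo x - B * e * D"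
      by (intro tendsto_intros conv_source_tendsto d x)
    moreover have "(\<lambda>n. conv (source (d n)) c * up_value clipped (- d n) c x) \<longlonglongrightarrow> Wo c * up_value clipped 0 c x"
      by (intro tendsto_intros conv_source_tendsto up_value_tendsto[OF B c_pos x] d) simp
    ultimately show ?thesis by (intro tendsto_le[OF sequentially_bot]) auto
  qed
  show ?thesis
  proof (rule field_le_epsilon)
    fix e :: real assume e: "0 < e"
    \<comment> \<open>Keeps \<open>B * e' * D\<close> at most \<open>e\<close>; the \<open>1\<close>
      covers the case \<open>B * D = 0\<close>.\<close>
    define e' where "e' = e / (B * D + 1)"
    have BD: "0 \<le> B * D" using B0 D0 by simp
    have "0 < e'" using e BD by (simp add: e'_def)
    have "B * e' * D = e * (B * D / (B * D + 1))" by (simp add: e'_def)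
    also have "\<dots> \<le> e * 1" using e BD by (intro mult_left_mono) auto
    finally show "Wo x \<le> Wo c * up_value clipped 0 c x + e" using main[OF \<open>0 < e'\<close>] by simp
  qed
qed

text \<open>If \<open>Wo c = 0\<close>, the two inequalities force \<open>Wo\<close> to vanish up to
  \<open>c\<close>; the Volterra equation then gives \<open>Wo c = W c\<close>, which is
  positive.\<close>

lemma Wo_c_nonzero: "Wo c \<noteq> 0"
proof
  assume 0: "Wo c = 0"
  have "Wo y = 0" if "y \<le> c" for y using up_value_le[OF that] up_value_ge[OF that] 0 by simp
  then have "conv (\<lambda>z. clipped z * Wo z) c = conv (\<lambda>_. 0) c" by (intro conv_cong_below) simp
  then have "Wo c = W c" using Wo_eq[of c] by (simp add: conv_def)
  then show False using W_pos[OF c_pos] 0 by simp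
qed

lemma up_value_eq: "x \<le> c \<Longrightarrow> up_value clipped 0 c x = Wo x / Wo c"
  using up_value_le[of x] up_value_ge[of x] Wo_c_nonzero by (simp add: field_simps)

text \<open>The equation of \<open>Zo\<close> starts from the constant 1, which has generator value
  0, so no smearing occurs: the drift vanishes on \<open>{0..c}\<close> and both comparisons apply,
  the second with error 0. At a downward exit the position is at most 0, where the function equals
  1.\<close>

lemma down_value_eq:
  assumes x: "x \<le> c" shows "down_value clipped 0 c x (\<lambda>_. 1) = Zo x - Wo x / Wo c * Zo c"
proof -
  obtain B where B: "killing_rate B clipped" using clipped_killing by auto
  let ?g = "\<lambda>z. clipped z * Zo z" and ?f = "\<lambda>y. 1 + conv (\<lambda>z. clipped z * Zo z) y"
  have tg: "test_function ?g" by (rule clipped_times_test[OF Zo_measurable Zo_bounded])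
  have fg: "dynkin_pair ?f ?g" by (rule dynkin_pair_conv[OF tg])
  obtain F where F: "\<And>y. y \<le> c \<Longrightarrow> \<bar>?f y\<bar> \<le> F" using conv_bounded_below_barrier[OF tg, of c 1] by auto
  have eq: "?f y = Zo y" if "y \<le> c" for y using Zo_eq[OF that] by simp
  have mean: "(LINT w|M. stop_at 0 c T x w) \<le> conv (\<lambda>y. 1 * indicator {0..c} y) c" if T: "0 < T" for T
    using stop_mean[OF T x, of 0] conv_nonneg[of "\<lambda>y. 1 * indicator {0..c} y" x] by simp
  have "?f c * up_value clipped 0 c x + down_value clipped 0 c x ?f \<le> ?f x"
    by (rule exit_supersolution[OF fg B x F]) (simp_all add: eq)
  moreover have "?f x - 0 * conv (\<lambda>y. 1 * indicator {0..c} y) c \<le> ?f c * up_value clipped 0 c x + down_value clipped 0 c x ?f"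
    by (rule exit_subsolution[OF fg B x F _ _ mean]) (simp_all add: eq)
  ultimately have "Zo c * up_value clipped 0 c x + down_value clipped 0 c x ?f = Zo x" by (simp add: eq x)
  moreover have "down_value clipped 0 c x ?f = down_value clipped 0 c x (\<lambda>_. 1)"
    unfolding down_value_def
  proof (rule Bochner_Integration.integral_cong[OF refl])
    fix w assume w: "w \<in> space M"
    show "of_bool (hits 0 c x w \<and> path x (exit_at 0 c x w) w < c) *
          (?f (path x (exit_at 0 c x w) w) * exp (- clock clipped x (exit_at 0 c x w) w))
      = of_bool (hits 0 c x w \<and> path x (exit_at 0 c x w) w < c) * (1 * exp (- clock clipped x (exit_at 0 c x w) w))"
    proof (cases "hits 0 c x w \<and> path x (exit_at 0 c x w) w < c")
      case True
      then have "path x (exit_at 0 c x w) w \<le> 0" using exit_down_le[OF w] by blast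
      then show ?thesis by (simp only: clipped_conv_nonpos add_0_right)
    qed (simp only: of_bool_eq mult_zero_left)
  qed
  ultimately show ?thesis using up_value_eq[OF x] by (simp add: mult.commute)
qed

end

theorem theorem2p1:
  fixes M :: "'a measure" and X :: "real \<Rightarrow> 'a \<Rightarrow> real"
    and \<psi> W \<omega> Wo Zo :: "real \<Rightarrow> real" and c x :: real
  assumes "spectrally_negative_levy M X"
    and "laplace_exponent M X \<psi>"
    and "scale_function \<psi> 0 W"
    and "\<omega> \<in> borel_measurable borel" and "\<forall>y. 0 \<le> \<omega> y" and "locally_bounded \<omega>"
    and "omega_scale_W W \<omega> Wo"
    and "omega_scale_Z W \<omega> Zo"
    and "0 < c" and "x \<le> c"
  shows "expectation_from M X x (\<lambda>p. exp (- (LBINT t=0..tau_plus c p. \<omega> (p t))))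
           {p. tau_plus c p < tau_minus 0 p} = Wo x / Wo c
       \<and> expectation_from M X x (\<lambda>p. exp (- (LBINT t=0..tau_minus 0 p. \<omega> (p t))))
           {p. tau_minus 0 p < tau_plus c p} = Zo x - Wo x / Wo c * Zo c"
proof -
  have "prob_space M" using assms(1) by (simp add: spectrally_negative_levy_def levy_process_def)
  then interpret omega_killed M X \<psi> W \<omega> Wo Zo c
    using assms(1-9) by (simp add: omega_killed_def omega_killed_axioms_def spectrally_negative_def spectrally_negative_axioms_def)
  have "clipped = (\<lambda>y. \<omega> y * indicator {0..c} y)" by (simp add: clipped_def fun_eq_iff)
  then show ?thesis
    using exit_expectation[OF assms(4,9), of x] up_value_eq[OF assms(10)] down_value_eq[OF assms(10)] by simp
qed

end
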